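(* Let $1<p<\infty$. Suppose that $\zeta\in\mathring{L}^p(\mathbb S^2)$ satisfies $$\zeta(\mathbf x)=g\big(\mathcal G\zeta(\mathbf x)+\beta\,\mathbf p\cdot\mathbf x\big)\quad\text{for a.e. }\mathbf x\in\mathbb S^2$$ for some decreasing function $g:\mathbb R\to\mathbb R\cup\{\pm\infty\}$ (i.e. $g(s_1)\ge g(s_2)$ whenever $s_1\le s_2$), some unit vector $\mathbf p\in\mathbb R^3$ and some $\beta\in\mathbb R$. Then $\zeta$ is $L^p$-stable under the dynamics of $(V_0)$: for any $\varepsilon>0$ there exists $\delta>0$ such that for any smooth solution $\zeta(t,\mathbf x)$ of $(V_0)$, $$\|\zeta(0,\cdot)-\zeta\|_{L^p(\mathbb S^2)}<\delta\quad\Longrightarrow\quad\|\zeta(t,\cdot)-\zeta\|_{L^p(\mathbb S^2)}<\varepsilon\quad\forall\,t\in\mathbb R.$$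
   Context: $\mathbb S^2\subset\mathbb R^3$ is the unit sphere centered at the origin with the standard induced metric, area element $\mathrm d\sigma$, gradient $\nabla$ and Laplace-Beltrami operator $\Delta$. $\mathring{L}^p(\mathbb S^2)=\{v\in L^p(\mathbb S^2): \int_{\mathbb S^2}v\,\mathrm d\sigma=0\}$. For $v\in\mathring{L}^p(\mathbb S^2)$, $1<p<\infty$, $\mathcal Gv$ denotes the unique function in $W^{2,p}(\mathbb S^2)$ (taken continuous) with $-\Delta(\mathcal Gv)=v$ on $\mathbb S^2$ and $\int_{\mathbb S^2}\mathcal Gv\,\mathrm d\sigma=0$. For a function $\psi$ on $\mathbb S^2$, $\nabla^\perp\psi(\mathbf x)=\nabla\psi(\mathbf x)\times\mathbf x$. The equation $(V_0)$ is the vorticity form of the incompressible Euler equation on the non-rotating sphere: $\partial_t\zeta+\nabla^\perp(\mathcal G\zeta)\cdot\nabla\zeta=0$, $t\in\mathbb R$, $\mathbf x\in\mathbb S^2$, where $\zeta(t,\cdot)$ has zero mean on $\mathbb S^2$ for every $t$. *)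

theory Defs
  imports "HOL-Analysis.Analysis"
begin

text \<open>Functions on the unit sphere are functions on the ambient space \<open>real^3\<close> of which only
  the values on the sphere matter.\<close>

abbreviation S2 :: "(real^3) set"
  where "S2 \<equiv> sphere 0 1"

definition spherical_coords :: "real \<times> real \<Rightarrow> real^3"
  where "spherical_coords = (\<lambda>(\<theta>, \<phi>). vector [sin \<theta> * cos \<phi>, sin \<theta> * sin \<phi>, cos \<theta>])"

text \<open>The area measure of the induced metric. In spherical coordinates the area element is
  \<open>sin \<theta> d\<theta> d\<phi>\<close>, and the coordinates cover the sphere once up to a null set. The space of
  this measure is the sphere, so that measurability and integrals ignore values off the sphere.\<close>

definition \<sigma> :: "(real^3) measure"
  where "\<sigma> = distr
    (density lborel (\<lambda>(\<theta>, \<phi>). ennreal (sin \<theta>) * indicator ({0..pi} \<times> {0..2 * pi}) (\<theta>, \<phi>)))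
    (restrict_space borel S2) spherical_coords"

definition in_Lp :: "real \<Rightarrow> (real^3 \<Rightarrow> 'a::euclidean_space) \<Rightarrow> bool"
  where "in_Lp p f \<longleftrightarrow> f \<in> borel_measurable \<sigma> \<and> integrable \<sigma> (\<lambda>x. norm (f x) powr p)"

definition Lp_norm :: "real \<Rightarrow> (real^3 \<Rightarrow> real) \<Rightarrow> real"
  where "Lp_norm p f = (\<integral>x. \<bar>f x\<bar> powr p \<partial>\<sigma>) powr (1 / p)"

definition in_Lp0 :: "real \<Rightarrow> (real^3 \<Rightarrow> real) \<Rightarrow> bool"
  where "in_Lp0 p v \<longleftrightarrow> in_Lp p v \<and> (\<integral>x. v x \<partial>\<sigma>) = 0"

text \<open>\<open>C\<^sup>k\<close> functions on an embedded submanifold \<open>M\<close> of a Euclidean space. Derivatives are taken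
  within \<open>M\<close>, so the component of the field \<open>F\<close> normal to \<open>M\<close> is unconstrained apart from its
  regularity; the component tangent to \<open>M\<close> is the gradient of \<open>f\<close> on \<open>M\<close>. It is used for the
  sphere and for the product of the time axis with the sphere.\<close>

primrec Ck_on :: "nat \<Rightarrow> 'a::euclidean_space set \<Rightarrow> ('a \<Rightarrow> real) \<Rightarrow> bool"
  where
    "Ck_on 0 M f \<longleftrightarrow> continuous_on M f"
  | "Ck_on (Suc k) M f \<longleftrightarrow>
      (\<exists>F. (\<forall>z\<in>M. (f has_derivative (\<lambda>h. F z \<bullet> h)) (at z within M)) \<and>
           (\<forall>b\<in>Basis. Ck_on k M (\<lambda>z. F z \<bullet> b)))"

definition smooth_on :: "'a::euclidean_space set \<Rightarrow> ('a \<Rightarrow> real) \<Rightarrow> bool"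
  where "smooth_on M f \<longleftrightarrow> (\<forall>k. Ck_on k M f)"

text \<open>The gradient on the sphere: the tangent vector representing the differential.\<close>

definition has_sgrad :: "(real^3 \<Rightarrow> real) \<Rightarrow> real^3 \<Rightarrow> real^3 \<Rightarrow> bool"
  where "has_sgrad f x w \<longleftrightarrow>
    w \<bullet> x = 0 \<and> (f has_derivative (\<lambda>h. w \<bullet> h)) (at x within S2)"

definition sgrad :: "(real^3 \<Rightarrow> real) \<Rightarrow> real^3 \<Rightarrow> real^3"
  where "sgrad f x = (THE w. has_sgrad f x w)"

definition sgrad_perp :: "(real^3 \<Rightarrow> real) \<Rightarrow> real^3 \<Rightarrow> real^3"
  where "sgrad_perp \<psi> x = cross3 (sgrad \<psi> x) x"

text \<open>The divergence of a tangent field: the trace over the tangent plane of its derivative,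
  written in ambient coordinates.\<close>

definition sdiv :: "(real^3 \<Rightarrow> real^3) \<Rightarrow> real^3 \<Rightarrow> real"
  where "sdiv X x = (\<Sum>i\<in>UNIV. sgrad (\<lambda>y. X y $ i) x $ i)"

definition smooth_tangent_field :: "(real^3 \<Rightarrow> real^3) \<Rightarrow> bool"
  where "smooth_tangent_field X \<longleftrightarrow>
    (\<forall>i. smooth_on S2 (\<lambda>x. X x $ i)) \<and> (\<forall>x\<in>S2. X x \<bullet> x = 0)"

text \<open>\<open>F\<close> is the weak gradient of \<open>u\<close>.\<close>

definition has_weak_grad :: "(real^3 \<Rightarrow> real) \<Rightarrow> (real^3 \<Rightarrow> real^3) \<Rightarrow> bool"
  where "has_weak_grad u F \<longleftrightarrow>
    integrable \<sigma> u \<and> integrable \<sigma> F \<and> (AE x in \<sigma>. F x \<bullet> x = 0) \<and>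
    (\<forall>X. smooth_tangent_field X \<longrightarrow>
      (\<integral>x. u x * sdiv X x \<partial>\<sigma>) = - (\<integral>x. F x \<bullet> X x \<partial>\<sigma>))"

definition in_W1p :: "real \<Rightarrow> (real^3 \<Rightarrow> real) \<Rightarrow> bool"
  where "in_W1p p u \<longleftrightarrow> in_Lp p u \<and> (\<exists>F. has_weak_grad u F \<and> in_Lp p F)"

definition in_W2p :: "real \<Rightarrow> (real^3 \<Rightarrow> real) \<Rightarrow> bool"
  where "in_W2p p u \<longleftrightarrow>
    in_Lp p u \<and> (\<exists>F. has_weak_grad u F \<and> in_Lp p F \<and> (\<forall>i. in_W1p p (\<lambda>x. F x $ i)))"

text \<open>\<open>w\<close> is the Laplace--Beltrami operator applied to \<open>u\<close>, i.e. the divergence of the gradient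
  of \<open>u\<close>, with weak first and second derivatives.\<close>

definition has_weak_laplacian :: "(real^3 \<Rightarrow> real) \<Rightarrow> (real^3 \<Rightarrow> real) \<Rightarrow> bool"
  where "has_weak_laplacian u w \<longleftrightarrow>
    (\<exists>F H. has_weak_grad u F \<and> (\<forall>i. has_weak_grad (\<lambda>x. F x $ i) (H i)) \<and>
           (AE x in \<sigma>. w x = (\<Sum>i\<in>UNIV. H i x $ i)))"

text \<open>\<open>is_G p v u\<close> says that \<open>u\<close> is \<open>\<G> v\<close>, for \<open>v\<close> in \<open>L\<^sup>p\<close> with zero mean. Such a \<open>u\<close> exists,
  and its values on the sphere are determined by \<open>v\<close> alone (in particular not by the exponent).
  It is a relation rather than a function because values off the sphere are arbitrary.\<close>

definition is_G :: "real \<Rightarrow> (real^3 \<Rightarrow> real) \<Rightarrow> (real^3 \<Rightarrow> real) \<Rightarrow> bool"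
  where "is_G p v u \<longleftrightarrow>
    in_Lp0 p v \<and> in_W2p p u \<and> continuous_on S2 u \<and>
    has_weak_laplacian u (\<lambda>x. - v x) \<and> (\<integral>x. u x \<partial>\<sigma>) = 0"

text \<open>Smooth solutions, global in time, of the vorticity equation. \<open>\<psi> t\<close> is \<open>\<G>\<close> applied to
  \<open>\<zeta> t\<close>, with any exponent. The equation is understood classically, hence the requirement that
  the gradient of \<open>\<psi> t\<close> exists; by elliptic regularity this holds automatically.\<close>

definition smooth_euler_solution :: "(real \<Rightarrow> real^3 \<Rightarrow> real) \<Rightarrow> bool"
  where "smooth_euler_solution \<zeta> \<longleftrightarrow>
    smooth_on (UNIV \<times> S2) (\<lambda>(t, x). \<zeta> t x) \<and>
    (\<forall>t. (\<integral>x. \<zeta> t x \<partial>\<sigma>) = 0) \<and>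
    (\<exists>\<psi>. (\<forall>t. \<exists>q>1. is_G q (\<zeta> t) (\<psi> t)) \<and>
      (\<forall>t. \<forall>x\<in>S2. (\<exists>w. has_sgrad (\<psi> t) x w) \<and>
        deriv (\<lambda>s. \<zeta> s x) t + sgrad_perp (\<psi> t) x \<bullet> sgrad (\<zeta> t) x = 0))"

definition Lp_stable :: "real \<Rightarrow> (real^3 \<Rightarrow> real) \<Rightarrow> bool"
  where "Lp_stable p \<zeta> \<longleftrightarrow>
    (\<forall>\<epsilon>>0. \<exists>\<delta>>0. \<forall>Z. smooth_euler_solution Z \<longrightarrow>
      Lp_norm p (\<lambda>x. Z 0 x - \<zeta> x) < \<delta> \<longrightarrow> (\<forall>t. Lp_norm p (\<lambda>x. Z t x - \<zeta> x) < \<epsilon>))"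

end

theory Submission
  imports Defs "HOL-Real_Asymp.Real_Asymp"
begin

text \<open>
  Expanding \<open>- ln (1 - t) = \<Sum>t\<^bsup>n\<^esup> / n\<close> turns the Green's function of the sphere into a sum of the
  kernels \<open>(x \<bullet> y)\<^bsup>n\<^esup> / n\<close>, which are visibly positive definite and symmetric and turn derivatives along
  rotations of \<open>x\<close> into derivatives along rotations of \<open>y\<close>. This gives the potential of a weak
  solution, its regularity, and the conservation of Casimirs, angular momentum and energy without
  any elliptic theory.

  With \<open>\<Theta> = \<G>\<zeta> + \<beta> P \<bullet> x\<close>, these conservation laws give
  \<open>\<integral>(v\<^sub>t - \<zeta>) \<G>(v\<^sub>t - \<zeta>) = \<integral>(v\<^sub>0 - \<zeta>) \<G>(v\<^sub>0 - \<zeta>) + 2 \<integral>\<Theta> (v\<^sub>0 - v\<^sub>t)\<close> for a solution \<open>v\<close>. Since \<open>\<zeta> = g(\<Theta>)\<close>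
  with \<open>g\<close> decreasing, there is a convex \<open>F\<close> for which \<open>F(a) + \<Theta> a\<close> is minimal at \<open>a = \<zeta>\<close>; because
  \<open>\<Theta>\<close> is bounded, \<open>F\<close> can be taken Lipschitz. As \<open>\<integral>F(v\<^sub>t)\<close> is conserved, the right-hand side is
  bounded by a multiple of \<open>\<parallel>v\<^sub>0 - \<zeta>\<parallel>\<close> in \<open>L\<^sup>p\<close>. So the left-hand side stays small, hence all moments
  of \<open>v\<^sub>t - \<zeta>\<close> do, and equimeasurability of \<open>v\<^sub>t\<close> with \<open>v\<^sub>0\<close> upgrades this weak closeness to the norm.
\<close>

section \<open>The area measure of the sphere\<close>

text \<open>Two features of the hypotheses shape the proof. Since \<open>g\<close> may jump and may
  be constant on intervals, \<open>F\<close> need not be strictly convex or differentiable, and its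
  minimality at \<zeta> is not coercive. Coercivity comes solely from the energy of the difference,
  a squared negative Sobolev norm; hence the separate passage to the \<open>L^p\<close> norm. Since
  \<open>p\<close> may be close to 1, \<zeta> need not be square integrable: pairings with \<zeta>
  make sense because potentials of \<open>L^p\<close> densities are bounded, the term of degree
  \<open>k\<close> decaying like \<open>k^(1/p - 2)\<close>, and the upgrade to the norm works with
  truncations.

  The logarithmic kernel itself is never integrated. With \<open>t = x \<bullet> y\<close>, the
  Laplacian maps \<open>t^n\<close> to a combination of \<open>t^n\<close> and
  \<open>t^(n-2)\<close>, so Poisson's equation becomes a two-term recursion that telescopes to an
  approximate identity. Derivatives are taken along the fields \<open>cross3 e x\<close>, which are
  global, tangent and area preserving, and compatible with every kernel \<open>t^n\<close>.\<close>

lemma space_\<sigma> [simp]: "space \<sigma> = S2"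
  by (simp add: \<sigma>_def space_restrict_space)

lemma sets_\<sigma>: "sets \<sigma> = sets (restrict_space borel S2)"
  by (simp add: \<sigma>_def)

lemma borel_measurable_\<sigma>: "borel_measurable \<sigma> = borel_measurable (restrict_space borel S2)"
  by (rule measurable_cong_sets) (simp_all add: sets_\<sigma>)

lemma continuous_on_measurable_\<sigma>: "continuous_on S2 f \<Longrightarrow> f \<in> borel_measurable \<sigma>"
  unfolding borel_measurable_\<sigma> by (rule borel_measurable_continuous_on_restrict)

lemma spherical_coords_nth [simp]:
  "spherical_coords z $ 1 = sin (fst z) * cos (snd z)"
  "spherical_coords z $ 2 = sin (fst z) * sin (snd z)"
  "spherical_coords z $ 3 = cos (fst z)"
  by (simp_all add: spherical_coords_def case_prod_unfold)

lemma inner_3: "(x::real^3) \<bullet> y = x$1 * y$1 + x$2 * y$2 + x$3 * y$3"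
  by (simp add: inner_vec_def sum_3)

lemma norm_spherical_coords [simp]: "norm (spherical_coords z) = 1"
proof -
  have "spherical_coords z \<bullet> spherical_coords z
      = (sin (fst z))\<^sup>2 * ((sin (snd z))\<^sup>2 + (cos (snd z))\<^sup>2) + (cos (fst z))\<^sup>2"
    unfolding inner_3 spherical_coords_nth by algebra
  then have "spherical_coords z \<bullet> spherical_coords z = 1" by simp
  then show ?thesis by (simp add: norm_eq_sqrt_inner)
qed

lemma continuous_on_spherical_coords: "continuous_on T spherical_coords"
proof -
  have "continuous_on T (\<lambda>z. spherical_coords z $ i)" for i
    using exhaust_3[of i] by (elim disjE; simp; intro continuous_intros)
  then show ?thesis
    by (subst continuous_on_componentwise) (auto simp: Basis_vec_def inner_axis)
qed

abbreviation coord_box :: "(real \<times> real) set"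
  where "coord_box \<equiv> cbox (0, 0) (pi, 2 * pi)"

definition coord_density :: "real \<times> real \<Rightarrow> real"
  where "coord_density z = sin (fst z) * indicator coord_box z"

lemma coord_density_nonneg: "0 \<le> coord_density z"
  by (auto simp: coord_density_def indicator_def cbox_Pair_eq intro!: sin_ge_zero)

lemma measurable_coord_density [measurable]: "coord_density \<in> borel_measurable borel"
  unfolding coord_density_def by (intro borel_measurable_times borel_measurable_continuous_onI
      borel_measurable_indicator continuous_intros) auto

lemma \<sigma>_alt: "\<sigma> = distr (density lborel (\<lambda>z. ennreal (coord_density z)))
    (restrict_space borel S2) spherical_coords"
proof -
  have "(\<lambda>(\<theta>, \<phi>). ennreal (sin \<theta>) * indicator ({0..pi} \<times> {0..2 * pi}) (\<theta>, \<phi>))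
      = (\<lambda>z. ennreal (coord_density z))"
    by (auto simp: coord_density_def indicator_def fun_eq_iff cbox_Pair_eq)
  then show ?thesis unfolding \<sigma>_def by simp
qed

lemma measurable_spherical_coords [measurable]:
  "spherical_coords \<in> borel \<rightarrow>\<^sub>M restrict_space borel S2"
  by (intro measurable_restrict_space2 borel_measurable_continuous_onI continuous_on_spherical_coords)
    auto

lemma integrable_coord:
  assumes "continuous_on S2 f"
  shows "integrable lborel (\<lambda>z. coord_density z * f (spherical_coords z))"
proof -
  have "continuous_on coord_box (\<lambda>z. sin (fst z) * f (spherical_coords z))"
    by (intro continuous_intros continuous_on_compose2[OF assms continuous_on_spherical_coords]) auto
  then have "integrable lborel (\<lambda>z. indicator coord_box z *\<^sub>R (sin (fst z) * f (spherical_coords z)))"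
    by (intro borel_integrable_compact) (auto simp: compact_cbox)
  then show ?thesis
    by (simp add: coord_density_def mult_ac)
qed

lemma integrable_\<sigma>_continuous:
  fixes f :: "real^3 \<Rightarrow> real"
  assumes "continuous_on S2 f"
  shows "integrable \<sigma> f"
proof -
  have m: "f \<in> borel_measurable (restrict_space borel S2)"
    using assms by (rule borel_measurable_continuous_on_restrict)
  have m': "(\<lambda>z. f (spherical_coords z)) \<in> borel_measurable borel"
    using m measurable_spherical_coords by (rule measurable_compose_rev)
  show ?thesis
    unfolding \<sigma>_alt using integrable_coord[OF assms] m m'
    by (subst integrable_distr_eq) (auto simp: integrable_density coord_density_nonneg)
qed

text \<open>The bridge to gauge integrals over the coordinate box, where iterated integrals, the
  fundamental theorem of calculus and the Leibniz rule apply.\<close>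

lemma integral_\<sigma>_continuous:
  fixes f :: "real^3 \<Rightarrow> real"
  assumes "continuous_on S2 f"
  shows "(\<integral>x. f x \<partial>\<sigma>) = integral coord_box (\<lambda>z. sin (fst z) * f (spherical_coords z))"
proof -
  have m: "f \<in> borel_measurable (restrict_space borel S2)"
    using assms by (rule borel_measurable_continuous_on_restrict)
  have m': "(\<lambda>z. f (spherical_coords z)) \<in> borel_measurable borel"
    using m measurable_spherical_coords by (rule measurable_compose_rev)
  have "(\<integral>x. f x \<partial>\<sigma>) = (\<integral>z. coord_density z * f (spherical_coords z) \<partial>lborel)"
    unfolding \<sigma>_alt using m m'
    by (subst integral_distr) (auto simp: integral_density coord_density_nonneg)
  also have "\<dots> = integral UNIV (\<lambda>z. coord_density z * f (spherical_coords z))"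
    using integrable_coord[OF assms] by (rule integral_lborel[symmetric])
  also have "\<dots> = integral UNIV (\<lambda>z. if z \<in> coord_box then sin (fst z) * f (spherical_coords z) else 0)"
    by (intro arg_cong2[where f=integral]) (auto simp: coord_density_def)
  also have "\<dots> = integral coord_box (\<lambda>z. sin (fst z) * f (spherical_coords z))"
    by (simp add: integral_restrict_UNIV)
  finally show ?thesis .
qed

lemma finite_measure_\<sigma>: "finite_measure \<sigma>"
proof (rule finite_measureI)
  have "integrable \<sigma> (\<lambda>x. 1::real)"
    by (intro integrable_\<sigma>_continuous continuous_intros)
  then show "emeasure \<sigma> (space \<sigma>) \<noteq> \<infinity>"
    by (simp add: integrable_iff_bounded)
qed

interpretation S: finite_measure \<sigma> by (rule finite_measure_\<sigma>)

abbreviation area :: real where "area \<equiv> measure \<sigma> S2"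

lemma area_pos: "0 < area"
proof -
  have "area = integral coord_box (\<lambda>z. sin (fst z))"
    using integral_\<sigma>_continuous[of "\<lambda>x. 1"] by simp
  also have "\<dots> = integral {0..pi} (\<lambda>\<theta>. integral {0..2*pi} (\<lambda>\<phi>. sin \<theta>))"
    by (subst integral_prod_continuous) (auto intro!: continuous_intros)
  also have "\<dots> = 2 * pi * integral {0..pi} sin"
    by simp
  also have "(sin has_integral (- cos pi - - cos 0)) {0..pi}"
    by (rule fundamental_theorem_of_calculus)
      (auto intro!: derivative_eq_intros simp: has_real_derivative_iff_has_vector_derivative[symmetric])
  then have "integral {0..pi} sin = 2"
    by (simp add: integral_unique)
  finally show ?thesis by simp
qed

lemma integrable_\<sigma>_mult_continuous:
  fixes f h :: "real^3 \<Rightarrow> real"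
  assumes "continuous_on S2 f" "integrable \<sigma> h"
  shows "integrable \<sigma> (\<lambda>x. f x * h x)"
proof -
  have "compact (f ` S2)"
    using assms(1) by (intro compact_continuous_image) auto
  then obtain C where C: "\<forall>x\<in>S2. \<bar>f x\<bar> \<le> C"
    using compact_imp_bounded bounded_real by (metis imageI)
  show ?thesis
  proof (rule Bochner_Integration.integrable_bound[where f="\<lambda>x. C * h x"])
    show "(\<lambda>x. f x * h x) \<in> borel_measurable \<sigma>"
      using continuous_on_measurable_\<sigma>[OF assms(1)] assms(2) by measurable
    show "AE x in \<sigma>. norm (f x * h x) \<le> norm (C * h x)"
    proof (rule AE_I2)
      fix x assume "x \<in> space \<sigma>"
      then have "\<bar>f x\<bar> \<le> \<bar>C\<bar>" using C by force
      then show "norm (f x * h x) \<le> norm (C * h x)"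
        by (simp add: abs_mult mult_right_mono)
    qed
  qed (use assms(2) in auto)
qed

section \<open>The divergence theorem for rotation fields\<close>

text \<open>As in \<open>Ck_on\<close>, the component of \<open>F\<close> normal to the sphere is
  left free, so that ambient gradients can be used directly. Derivatives are later taken along
  tangent vectors such as \<open>cross3 e x\<close>, which do not see that component.\<close>

definition C1_grad :: "(real^3 \<Rightarrow> real) \<Rightarrow> (real^3 \<Rightarrow> real^3) \<Rightarrow> bool"
  where "C1_grad f F \<longleftrightarrow>
    (\<forall>x\<in>S2. (f has_derivative (\<lambda>h. F x \<bullet> h)) (at x within S2)) \<and> continuous_on S2 F"

lemma continuous_on_cross3 [continuous_intros]: "continuous_on T (cross3 e)"
  using continuous_on_cross[of T "\<lambda>x. e" "\<lambda>x. x"] by simp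

lemma C1_grad_continuous: "C1_grad f F \<Longrightarrow> continuous_on S2 f"
  unfolding C1_grad_def by (meson has_derivative_continuous_on)

lemma C1_grad_const: "C1_grad (\<lambda>x. c) (\<lambda>x. 0)"
  by (auto simp: C1_grad_def intro!: continuous_intros)

lemma C1_grad_inner: "C1_grad (\<lambda>x. v \<bullet> x) (\<lambda>x. v)"
  by (auto simp: C1_grad_def intro!: continuous_intros derivative_eq_intros)

lemma C1_grad_add:
  assumes "C1_grad f F" "C1_grad g G"
  shows "C1_grad (\<lambda>x. f x + g x) (\<lambda>x. F x + G x)"
  using assms by (auto simp: C1_grad_def inner_add_left intro!: continuous_intros derivative_eq_intros)

lemma C1_grad_cmult:
  assumes "C1_grad f F"
  shows "C1_grad (\<lambda>x. c * f x) (\<lambda>x. c *\<^sub>R F x)"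
  using assms by (auto simp: C1_grad_def intro!: continuous_intros derivative_eq_intros)

lemma C1_grad_mult:
  assumes "C1_grad f F" "C1_grad g G"
  shows "C1_grad (\<lambda>x. f x * g x) (\<lambda>x. g x *\<^sub>R F x + f x *\<^sub>R G x)"
  using assms C1_grad_continuous[OF assms(1)] C1_grad_continuous[OF assms(2)]
  by (auto simp: C1_grad_def inner_add_left intro!: continuous_intros derivative_eq_intros)

lemma C1_grad_sum:
  assumes "\<And>i. i \<in> I \<Longrightarrow> C1_grad (f i) (F i)"
  shows "C1_grad (\<lambda>x. \<Sum>i\<in>I. f i x) (\<lambda>x. \<Sum>i\<in>I. F i x)"
  using assms
  by (induction I rule: infinite_finite_induct) (auto intro: C1_grad_add C1_grad_const)

lemma C1_grad_compose:
  assumes "C1_grad f F" "\<And>s. (g has_real_derivative g' s) (at s)" "continuous_on UNIV g'"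
  shows "C1_grad (\<lambda>x. g (f x)) (\<lambda>x. g' (f x) *\<^sub>R F x)"
proof -
  have "continuous_on S2 (\<lambda>x. g' (f x) *\<^sub>R F x)"
    using assms C1_grad_continuous[OF assms(1)]
    by (auto simp: C1_grad_def intro!: continuous_intros continuous_on_compose2[OF assms(3)])
  moreover have "((\<lambda>x. g (f x)) has_derivative (\<lambda>h. g' (f x) *\<^sub>R F x \<bullet> h)) (at x within S2)"
    if "x \<in> S2" for x
  proof -
    have "(f has_derivative (\<lambda>h. F x \<bullet> h)) (at x within S2)"
      using assms(1) that by (auto simp: C1_grad_def)
    then have "((\<lambda>x. g (f x)) has_derivative (\<lambda>h. g' (f x) * (F x \<bullet> h))) (at x within S2)"
      by (rule has_derivative_compose) (use assms(2) in \<open>auto simp: has_field_derivative_def\<close>)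
    then show ?thesis by simp
  qed
  ultimately show ?thesis by (auto simp: C1_grad_def)
qed

text \<open>Derivatives within the sphere can only be probed by curves that stay in it. Coordinate
  lines and great circles thereby reduce calculus on the sphere to one real variable.\<close>

lemma has_derivative_along_curve:
  fixes c :: "real \<Rightarrow> real^3"
  assumes "(f has_derivative (\<lambda>h. w \<bullet> h)) (at (c s) within S2)"
    and "(c has_vector_derivative v) (at s within T)" and "c ` T \<subseteq> S2"
  shows "((\<lambda>r. f (c r)) has_real_derivative w \<bullet> v) (at s within T)"
proof -
  have "(c has_derivative (\<lambda>x. x *\<^sub>R v)) (at s within T)"
    using assms(2) by (simp add: has_vector_derivative_def)
  moreover have "(f has_derivative (\<lambda>h. w \<bullet> h)) (at (c s) within c ` T)"
    using assms(1,3) by (rule has_derivative_subset)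
  ultimately have "((\<lambda>r. f (c r)) has_derivative (\<lambda>x. w \<bullet> (x *\<^sub>R v))) (at s within T)"
    by (rule has_derivative_in_compose)
  then show ?thesis
    by (simp add: has_field_derivative_def mult.commute[of _ "w \<bullet> v"])
qed

section \<open>Spherical coordinates as a parametrisation\<close>

lemma has_vector_derivative_vec3:
  assumes "(f has_real_derivative f') (at s within T)" "(g has_real_derivative g') (at s within T)"
    "(h has_real_derivative h') (at s within T)"
  shows "((\<lambda>r. vector [f r, g r, h r] :: real^3) has_vector_derivative vector [f', g', h']) (at s within T)"
proof -
  have eq: "vector [a, b, c] = a *\<^sub>R axis 1 1 + b *\<^sub>R axis 2 1 + c *\<^sub>R (axis 3 1 :: real^3)" for a b c
    by (simp add: vec_eq_iff forall_3 axis_def)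
  show ?thesis
    unfolding eq using assms
    by (auto intro!: derivative_eq_intros simp: has_real_derivative_iff_has_vector_derivative)
qed

definition d_theta :: "real \<times> real \<Rightarrow> real^3"
  where "d_theta z = vector [cos (fst z) * cos (snd z), cos (fst z) * sin (snd z), - sin (fst z)]"

definition d_phi :: "real \<times> real \<Rightarrow> real^3"
  where "d_phi z = vector [- sin (fst z) * sin (snd z), sin (fst z) * cos (snd z), 0]"

lemma spherical_coords_d_theta:
  "((\<lambda>\<theta>. spherical_coords (\<theta>, \<phi>)) has_vector_derivative d_theta (\<theta>, \<phi>)) (at \<theta> within T)"
  unfolding spherical_coords_def d_theta_def case_prod_unfold fst_conv snd_conv
  by (intro has_vector_derivative_vec3) (auto intro!: derivative_eq_intros)

lemma spherical_coords_d_phi: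
  "((\<lambda>\<phi>. spherical_coords (\<theta>, \<phi>)) has_vector_derivative d_phi (\<theta>, \<phi>)) (at \<phi> within T)"
  unfolding spherical_coords_def d_phi_def case_prod_unfold fst_conv snd_conv
  by (intro has_vector_derivative_vec3) (auto intro!: derivative_eq_intros)

lemma continuous_on_d_theta: "continuous_on T d_theta" and continuous_on_d_phi: "continuous_on T d_phi"
proof -
  have "continuous_on T (\<lambda>z. d_theta z $ i)" "continuous_on T (\<lambda>z. d_phi z $ i)" for i
    using exhaust_3[of i] by (elim disjE; simp add: d_theta_def d_phi_def; intro continuous_intros)+
  then show "continuous_on T d_theta" "continuous_on T d_phi"
    by (subst continuous_on_componentwise; auto simp: Basis_vec_def inner_axis)+
qed

lemma integral_theta_exact:
  fixes f :: "real \<times> real \<Rightarrow> real"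
  assumes "\<And>\<phi>. \<phi> \<in> {0..2*pi} \<Longrightarrow> ((\<lambda>\<theta>. f (\<theta>, \<phi>)) has_integral 0) {0..pi}"
    and "continuous_on coord_box f"
  shows "integral coord_box f = 0"
proof -
  have "integral coord_box f = integral {0..pi} (\<lambda>\<theta>. integral {0..2*pi} (\<lambda>\<phi>. f (\<theta>, \<phi>)))"
    using assms(2) by (subst integral_prod_continuous) auto
  also have "\<dots> = integral {0..2*pi} (\<lambda>\<phi>. integral {0..pi} (\<lambda>\<theta>. f (\<theta>, \<phi>)))"
    using assms(2) integral_swap_continuous[of 0 0 pi "2*pi" "\<lambda>x y. f (x, y)"] by simp
  also have "\<dots> = integral {0..2*pi} (\<lambda>\<phi>. 0)"
    by (rule integral_cong) (use assms(1) integral_unique in blast)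
  finally show ?thesis by simp
qed

lemma integral_phi_exact:
  fixes f :: "real \<times> real \<Rightarrow> real"
  assumes "\<And>\<theta>. \<theta> \<in> {0..pi} \<Longrightarrow> ((\<lambda>\<phi>. f (\<theta>, \<phi>)) has_integral 0) {0..2*pi}"
    and "continuous_on coord_box f"
  shows "integral coord_box f = 0"
proof -
  have "integral coord_box f = integral {0..pi} (\<lambda>\<theta>. integral {0..2*pi} (\<lambda>\<phi>. f (\<theta>, \<phi>)))"
    using assms(2) by (subst integral_prod_continuous) auto
  also have "\<dots> = integral {0..pi} (\<lambda>\<phi>. 0)"
    by (rule integral_cong) (use assms(1) integral_unique in blast)
  finally show ?thesis by simp
qed

text \<open>Infinitesimal form of the invariance of area under rotation about \<open>e\<close>. In
  coordinates the density times the rotation field is \<open>a * d_theta + b * d_phi\<close>, where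
  the \<theta>-derivative of \<open>a\<close> and the \<phi>-derivative of \<open>b\<close> cancel.
  So the integrand is an exact \<theta>-derivative of \<open>a * f\<close> plus an exact
  \<phi>-derivative of \<open>b * f\<close>; the former integrates to 0 because \<open>a\<close>
  vanishes at the poles, the latter by periodicity.\<close>

lemma integral_rotation_derivative:
  assumes "C1_grad f F"
  shows "(\<integral>x. F x \<bullet> cross3 e x \<partial>\<sigma>) = 0"
proof -
  define a where "a z = sin (fst z) * (e$2 * cos (snd z) - e$1 * sin (snd z))" for z :: "real \<times> real"
  define a' where "a' z = cos (fst z) * (e$2 * cos (snd z) - e$1 * sin (snd z))" for z :: "real \<times> real"
  define b where "b z = e$3 * sin (fst z) - cos (fst z) * (e$1 * cos (snd z) + e$2 * sin (snd z))"
    for z :: "real \<times> real"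
  let ?s = spherical_coords
  define A where "A z = a' z * f (?s z) + a z * (F (?s z) \<bullet> d_theta z)" for z
  define B where "B z = - a' z * f (?s z) + b z * (F (?s z) \<bullet> d_phi z)" for z
  have cF: "continuous_on S2 F" and cf: "continuous_on S2 f"
    using assms C1_grad_continuous by (auto simp: C1_grad_def)
  have cF': "continuous_on T (\<lambda>z. F (?s z))" for T
    by (rule continuous_on_compose2[OF cF continuous_on_spherical_coords]) auto
  have cf': "continuous_on T (\<lambda>z. f (?s z))" for T
    by (rule continuous_on_compose2[OF cf continuous_on_spherical_coords]) auto
  have fF: "(f has_derivative (\<lambda>h. F x \<bullet> h)) (at x within S2)" if "norm x = 1" for x
    using assms that by (auto simp: C1_grad_def)
  have cA: "continuous_on coord_box A" and cB: "continuous_on coord_box B"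
    unfolding A_def B_def a_def a'_def b_def
    by (intro continuous_intros cF' cf' continuous_on_d_theta continuous_on_d_phi)+
  have "(\<integral>x. F x \<bullet> cross3 e x \<partial>\<sigma>) = integral coord_box (\<lambda>z. sin (fst z) * (F (?s z) \<bullet> cross3 e (?s z)))"
    by (rule integral_\<sigma>_continuous) (intro continuous_intros cF)
  also have "(\<lambda>z. sin (fst z) * (F (?s z) \<bullet> cross3 e (?s z))) = (\<lambda>z. A z + B z)"
  proof
    fix z
    \<comment> \<open>The factor \<open>sin (fst z)\<close> of the area element clears the pole
      singularity of the \<phi>-coefficient, so \<open>a\<close> and \<open>b\<close> are smooth on
      the closed box.\<close>
    have "sin (fst z) *\<^sub>R cross3 e (?s z) = a z *\<^sub>R d_theta z + b z *\<^sub>R d_phi z"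
    proof -
      have *: "st * (e2 * ct - e3 * (st * sp))
            = st * (e2 * cp - e1 * sp) * (ct * cp) - (e3 * st - ct * (e1 * cp + e2 * sp)) * (st * sp)"
        "st * (e3 * (st * cp) - e1 * ct)
            = st * (e2 * cp - e1 * sp) * (ct * sp) + (e3 * st - ct * (e1 * cp + e2 * sp)) * (st * cp)"
        "st * (e1 * (st * sp) - e2 * (st * cp)) = - (st * (e2 * cp - e1 * sp) * st)"
        if "sp\<^sup>2 + cp\<^sup>2 = 1" for e1 e2 e3 st ct sp cp :: real
        subgoal using that by algebra
        subgoal using that by algebra
        subgoal by algebra
        done
      show ?thesis
        unfolding vec_eq_iff forall_3
        by (simp add: cross3_def a_def b_def d_theta_def d_phi_def *)
    qed
    then have "F (?s z) \<bullet> (sin (fst z) *\<^sub>R cross3 e (?s z)) = F (?s z) \<bullet> (a z *\<^sub>R d_theta z + b z *\<^sub>R d_phi z)"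
      by simp
    then show "sin (fst z) * (F (?s z) \<bullet> cross3 e (?s z)) = A z + B z"
      by (simp add: A_def B_def inner_add_right)
  qed
  also have "integral coord_box (\<lambda>z. A z + B z) = integral coord_box A + integral coord_box B"
    by (intro integral_add integrable_continuous cA cB)
  also have "integral coord_box A = 0"
  proof (rule integral_theta_exact[OF _ cA])
    fix \<phi> :: real
    have "((\<lambda>\<theta>. A (\<theta>, \<phi>)) has_integral (a (pi, \<phi>) * f (?s (pi, \<phi>)) - a (0, \<phi>) * f (?s (0, \<phi>)))) {0..pi}"
    proof (rule fundamental_theorem_of_calculus)
      fix \<theta> :: real
      have "((\<lambda>r. f (?s (r, \<phi>))) has_real_derivative F (?s (\<theta>, \<phi>)) \<bullet> d_theta (\<theta>, \<phi>)) (at \<theta> within {0..pi})"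
        by (rule has_derivative_along_curve[OF fF spherical_coords_d_theta]) auto
      moreover have "((\<lambda>r. a (r, \<phi>)) has_real_derivative a' (\<theta>, \<phi>)) (at \<theta> within {0..pi})"
        unfolding a_def a'_def by (auto intro!: derivative_eq_intros)
      ultimately show "((\<lambda>\<theta>. a (\<theta>, \<phi>) * f (?s (\<theta>, \<phi>))) has_vector_derivative A (\<theta>, \<phi>)) (at \<theta> within {0..pi})"
        unfolding has_real_derivative_iff_has_vector_derivative[symmetric] A_def
        by (auto intro!: derivative_eq_intros)
    qed simp
    then show "((\<lambda>\<theta>. A (\<theta>, \<phi>)) has_integral 0) {0..pi}" by (simp add: a_def)
  qed
  also have "integral coord_box B = 0"
  proof (rule integral_phi_exact[OF _ cB])
    fix \<theta> :: real
    have eq: "?s (\<theta>, 2 * pi) = ?s (\<theta>, 0)"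
      unfolding vec_eq_iff forall_3 by simp
    have "((\<lambda>\<phi>. B (\<theta>, \<phi>)) has_integral (b (\<theta>, 2*pi) * f (?s (\<theta>, 2*pi)) - b (\<theta>, 0) * f (?s (\<theta>, 0)))) {0..2*pi}"
    proof (rule fundamental_theorem_of_calculus)
      fix \<phi> :: real
      have "((\<lambda>r. f (?s (\<theta>, r))) has_real_derivative F (?s (\<theta>, \<phi>)) \<bullet> d_phi (\<theta>, \<phi>)) (at \<phi> within {0..2*pi})"
        by (rule has_derivative_along_curve[OF fF spherical_coords_d_phi]) auto
      moreover have "((\<lambda>r. b (\<theta>, r)) has_real_derivative - a' (\<theta>, \<phi>)) (at \<phi> within {0..2*pi})"
        unfolding b_def a'_def by (auto intro!: derivative_eq_intros simp: algebra_simps)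
      ultimately show "((\<lambda>\<phi>. b (\<theta>, \<phi>) * f (?s (\<theta>, \<phi>))) has_vector_derivative B (\<theta>, \<phi>)) (at \<phi> within {0..2*pi})"
        unfolding has_real_derivative_iff_has_vector_derivative[symmetric] B_def
        by (auto intro!: derivative_eq_intros)
    qed simp
    then show "((\<lambda>\<phi>. B (\<theta>, \<phi>)) has_integral 0) {0..2*pi}" by (simp add: b_def eq)
  qed
  finally show ?thesis by simp
qed

lemma rotation_by_parts:
  assumes "C1_grad f F" "C1_grad g G"
  shows "(\<integral>x. f x * (G x \<bullet> cross3 e x) \<partial>\<sigma>) = - (\<integral>x. g x * (F x \<bullet> cross3 e x) \<partial>\<sigma>)"
proof -
  have c: "continuous_on S2 F" "continuous_on S2 f" "continuous_on S2 G" "continuous_on S2 g"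
    using assms C1_grad_continuous by (auto simp: C1_grad_def)
  have "0 = (\<integral>x. (g x *\<^sub>R F x + f x *\<^sub>R G x) \<bullet> cross3 e x \<partial>\<sigma>)"
    using integral_rotation_derivative[OF C1_grad_mult[OF assms]] by simp
  also have "\<dots> = (\<integral>x. g x * (F x \<bullet> cross3 e x) + f x * (G x \<bullet> cross3 e x) \<partial>\<sigma>)"
    by (simp add: inner_add_left)
  also have "\<dots> = (\<integral>x. g x * (F x \<bullet> cross3 e x) \<partial>\<sigma>) + (\<integral>x. f x * (G x \<bullet> cross3 e x) \<partial>\<sigma>)"
    by (intro Bochner_Integration.integral_add integrable_\<sigma>_continuous continuous_intros c)
  finally show ?thesis by simp
qed

section \<open>Zonal moments\<close>

text \<open>One power of the expanded logarithmic kernel as an integral operator. Its values are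
  homogeneous polynomials of degree \<open>n\<close> in \<open>x\<close> on the whole space, so
  ambient derivatives are available.\<close>

definition zmom :: "nat \<Rightarrow> (real^3 \<Rightarrow> real) \<Rightarrow> real^3 \<Rightarrow> real"
  where "zmom n h x = (\<integral>y. (x \<bullet> y) ^ n * h y \<partial>\<sigma>)"

text \<open>Up to the factor \<open>Suc n\<close> this is the ambient gradient of
  \<open>zmom (Suc n) h\<close>; the weight \<open>1 / Suc n\<close> of the logarithmic series
  cancels that factor.\<close>

definition zmom_vec :: "nat \<Rightarrow> (real^3 \<Rightarrow> real) \<Rightarrow> real^3 \<Rightarrow> real^3"
  where "zmom_vec n h x = (\<chi> i. zmom n (\<lambda>y. y $ i * h y) x)"

lemma integrable_nth_mult: "integrable \<sigma> h \<Longrightarrow> integrable \<sigma> (\<lambda>y. y $ i * h y)"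
  by (intro integrable_\<sigma>_mult_continuous continuous_intros)

lemma integrable_zmom: "integrable \<sigma> h \<Longrightarrow> integrable \<sigma> (\<lambda>y. (x \<bullet> y) ^ n * h y)"
  by (intro integrable_\<sigma>_mult_continuous continuous_intros)

lemma inner_eq_sum: "(x::real^3) \<bullet> y = (\<Sum>i\<in>UNIV. x $ i * y $ i)"
  by (simp add: inner_vec_def)

lemma zmom_0: "zmom 0 h x = (\<integral>y. h y \<partial>\<sigma>)"
  by (simp add: zmom_def)

text \<open>Splitting one factor \<open>x \<bullet> y\<close> into coordinates lowers the degree at
  the cost of weights \<open>y $ i\<close> in the density. The inductions for derivative, symmetry
  and positivity rest on this and therefore generalise over \<open>h\<close>; no product measure and
  no exchange of integrals is involved.\<close>

lemma zmom_Suc: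
  assumes "integrable \<sigma> h"
  shows "zmom (Suc n) h x = (\<Sum>i\<in>UNIV. x $ i * zmom n (\<lambda>y. y $ i * h y) x)"
proof -
  have "zmom (Suc n) h x = (\<integral>y. (\<Sum>i\<in>UNIV. x $ i * ((x \<bullet> y) ^ n * (y $ i * h y))) \<partial>\<sigma>)"
  proof -
    have "(x \<bullet> y) ^ Suc n * h y = (\<Sum>i\<in>UNIV. x $ i * ((x \<bullet> y) ^ n * (y $ i * h y)))" for y
    proof -
      have "(x \<bullet> y) ^ Suc n * h y = (\<Sum>i\<in>UNIV. x $ i * y $ i) * ((x \<bullet> y) ^ n * h y)"
        by (simp add: inner_eq_sum[symmetric])
      then show ?thesis by (simp add: sum_distrib_right sum_distrib_left mult_ac)
    qed
    then show ?thesis unfolding zmom_def by simp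
  qed
  also have "\<dots> = (\<Sum>i\<in>UNIV. x $ i * zmom n (\<lambda>y. y $ i * h y) x)"
    unfolding zmom_def
    by (subst Bochner_Integration.integral_sum)
      (auto intro!: integrable_zmom integrable_nth_mult assms)
  finally show ?thesis .
qed

lemma zmom_cong:
  assumes "\<And>y. y \<in> S2 \<Longrightarrow> f y = g y"
  shows "zmom n f x = zmom n g x"
  unfolding zmom_def by (rule Bochner_Integration.integral_cong) (use assms in auto)

lemma zmom_diff:
  "integrable \<sigma> f \<Longrightarrow> integrable \<sigma> g \<Longrightarrow> zmom n (\<lambda>y. f y - g y) x = zmom n f x - zmom n g x"
  unfolding zmom_def by (simp add: right_diff_distrib integrable_zmom)

lemma zmom_cmult: "zmom n (\<lambda>y. c * f y) x = c * zmom n f x"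
  unfolding zmom_def by (simp add: mult.left_commute)

lemma zmom_vec_nth: "zmom_vec n h x $ i = zmom n (\<lambda>y. y $ i * h y) x"
  by (simp add: zmom_vec_def)

lemma has_derivative_zmom_Suc:
  assumes "integrable \<sigma> h"
  shows "(zmom (Suc n) h has_derivative (\<lambda>v. (real (Suc n) *\<^sub>R zmom_vec n h x) \<bullet> v)) (at x)"
  using assms
proof (induction n arbitrary: h)
  case 0
  have "zmom (Suc 0) h = (\<lambda>x. \<Sum>i\<in>UNIV. x $ i * (\<integral>y. y $ i * h y \<partial>\<sigma>))"
    by (rule ext) (simp add: zmom_Suc[OF 0] zmom_0)
  then show ?case
    by (auto intro!: derivative_eq_intros bounded_linear_imp_has_derivative[OF bounded_linear_vec_nth]
        simp: inner_eq_sum zmom_vec_def zmom_0 mult.commute)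
next
  case (Suc n)
  let ?h = "\<lambda>i y. y $ i * h y"
  have eq: "zmom (Suc (Suc n)) h = (\<lambda>x. \<Sum>i\<in>UNIV. x $ i * zmom (Suc n) (?h i) x)"
    by (rule ext) (rule zmom_Suc[OF Suc.prems])
  have int: "integrable \<sigma> (?h i)" for i by (intro integrable_nth_mult Suc.prems)
  have "((\<lambda>x. \<Sum>i\<in>UNIV. x $ i * zmom (Suc n) (?h i) x) has_derivative
      (\<lambda>v. \<Sum>i\<in>UNIV. x $ i * ((real (Suc n) *\<^sub>R zmom_vec n (?h i) x) \<bullet> v) + v $ i * zmom (Suc n) (?h i) x)) (at x)"
    by (intro has_derivative_sum has_derivative_mult Suc.IH int)
       (rule bounded_linear_imp_has_derivative[OF bounded_linear_vec_nth])
  also have "(\<lambda>v. \<Sum>i\<in>UNIV. x $ i * ((real (Suc n) *\<^sub>R zmom_vec n (?h i) x) \<bullet> v) + v $ i * zmom (Suc n) (?h i) x)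
     = (\<lambda>v. (real (Suc (Suc n)) *\<^sub>R zmom_vec (Suc n) h x) \<bullet> v)"
  proof
    fix v
    \<comment> \<open>The weights commute in \<open>i\<close> and \<open>j\<close>, so
      differentiating the inner moments gives \<open>Suc n\<close> copies of
      \<open>zmom_vec (Suc n) h x\<close>; the other half of the product rule supplies one
      more.\<close>
    have comm: "zmom n (\<lambda>y. y $ j * (y $ i * h y)) x = zmom n (\<lambda>y. y $ i * (y $ j * h y)) x" for i j
      by (rule zmom_cong) (rule mult.left_commute)
    have "(\<Sum>i\<in>UNIV. x $ i * (zmom_vec n (?h i) x \<bullet> v))
        = (\<Sum>i\<in>UNIV. \<Sum>j\<in>UNIV. v $ j * (x $ i * zmom n (\<lambda>y. y $ j * (y $ i * h y)) x))"
      unfolding inner_eq_sum zmom_vec_nth sum_distrib_left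
      by (intro sum.cong refl) (simp only: mult_ac)
    also have "\<dots> = (\<Sum>j\<in>UNIV. \<Sum>i\<in>UNIV. v $ j * (x $ i * zmom n (\<lambda>y. y $ j * (y $ i * h y)) x))"
      by (rule sum.swap)
    also have "\<dots> = (\<Sum>j\<in>UNIV. v $ j * zmom (Suc n) (?h j) x)"
      unfolding zmom_Suc[OF int] sum_distrib_left
      by (intro sum.cong refl) (subst comm, rule refl)
    finally have *: "(\<Sum>i\<in>UNIV. x $ i * (zmom_vec n (?h i) x \<bullet> v)) = zmom_vec (Suc n) h x \<bullet> v"
      by (simp add: inner_eq_sum zmom_vec_nth mult.commute)
    have "(\<Sum>i\<in>UNIV. v $ i * zmom (Suc n) (?h i) x) = zmom_vec (Suc n) h x \<bullet> v"
      by (simp add: inner_eq_sum zmom_vec_nth mult.commute)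
    moreover have "(\<Sum>i\<in>UNIV. x $ i * ((real (Suc n) *\<^sub>R zmom_vec n (?h i) x) \<bullet> v))
        = real (Suc n) * (\<Sum>i\<in>UNIV. x $ i * (zmom_vec n (?h i) x \<bullet> v))"
      unfolding inner_scaleR_left sum_distrib_left by (rule sum.cong) (simp_all only: mult_ac)
    ultimately show "(\<Sum>i\<in>UNIV. x $ i * ((real (Suc n) *\<^sub>R zmom_vec n (?h i) x) \<bullet> v) + v $ i * zmom (Suc n) (?h i) x)
       = (real (Suc (Suc n)) *\<^sub>R zmom_vec (Suc n) h x) \<bullet> v"
      unfolding sum.distrib * inner_scaleR_left by (simp add: algebra_simps)
  qed
  finally show ?case unfolding eq .
qed

lemma continuous_on_zmom: "integrable \<sigma> h \<Longrightarrow> continuous_on T (zmom n h)"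
proof (cases n)
  case 0
  then show ?thesis by (auto simp: zmom_0[abs_def])
next
  case (Suc k)
  assume "integrable \<sigma> h"
  then have "continuous (at x) (zmom n h)" for x
    using has_derivative_continuous[OF has_derivative_zmom_Suc] Suc by blast
  then show ?thesis by (simp add: continuous_at_imp_continuous_on)
qed

lemma continuous_on_zmom_vec: "integrable \<sigma> h \<Longrightarrow> continuous_on T (zmom_vec n h)"
  unfolding zmom_vec_def by (intro continuous_intros continuous_on_zmom integrable_nth_mult)

lemma C1_grad_zmom:
  assumes "integrable \<sigma> h"
  shows "C1_grad (zmom (Suc n) h) (\<lambda>x. real (Suc n) *\<^sub>R zmom_vec n h x)"
proof -
  have "continuous_on S2 (\<lambda>x. real (Suc n) *\<^sub>R zmom_vec n h x)"
    by (intro continuous_intros continuous_on_zmom_vec assms)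
  then show ?thesis
    using has_derivative_at_withinI[OF has_derivative_zmom_Suc[OF assms]]
    by (simp add: C1_grad_def del: of_nat_Suc)
qed

text \<open>The recursion for the bilinear form. At degree 0 the form is the product of the two
  integrals, so symmetry and positivity, evident there, climb to all degrees.\<close>

lemma zmom_form_Suc:
  assumes "integrable \<sigma> f" "integrable \<sigma> h"
  shows "(\<integral>x. f x * zmom (Suc n) h x \<partial>\<sigma>)
      = (\<Sum>i\<in>UNIV. \<integral>x. (x $ i * f x) * zmom n (\<lambda>y. y $ i * h y) x \<partial>\<sigma>)"
proof -
  have int: "integrable \<sigma> (\<lambda>x. (x $ i * f x) * zmom n (\<lambda>y. y $ i * h y) x)" for i
    unfolding mult.commute[of _ "zmom _ _ _"] using assms
    by (intro integrable_\<sigma>_mult_continuous continuous_on_zmom integrable_nth_mult continuous_intros)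
  have "(\<integral>x. f x * zmom (Suc n) h x \<partial>\<sigma>)
      = (\<integral>x. (\<Sum>i\<in>UNIV. (x $ i * f x) * zmom n (\<lambda>y. y $ i * h y) x) \<partial>\<sigma>)"
    by (simp add: zmom_Suc[OF assms(2)] sum_distrib_left mult_ac del: Bochner_Integration.integral_sum)
  also have "\<dots> = (\<Sum>i\<in>UNIV. \<integral>x. (x $ i * f x) * zmom n (\<lambda>y. y $ i * h y) x \<partial>\<sigma>)"
    using int by (rule Bochner_Integration.integral_sum)
  finally show ?thesis .
qed

lemma zmom_symmetric:
  assumes "integrable \<sigma> f" "integrable \<sigma> h"
  shows "(\<integral>x. f x * zmom n h x \<partial>\<sigma>) = (\<integral>x. h x * zmom n f x \<partial>\<sigma>)"
  using assms
proof (induction n arbitrary: f h)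
  case 0
  then show ?case by (simp add: zmom_0)
next
  case (Suc n)
  show ?case
    unfolding zmom_form_Suc[OF Suc.prems] zmom_form_Suc[OF Suc.prems(2,1)]
    by (intro sum.cong Suc.IH integrable_nth_mult Suc.prems refl)
qed

lemma zmom_form_nonneg:
  assumes "integrable \<sigma> h"
  shows "0 \<le> (\<integral>x. h x * zmom n h x \<partial>\<sigma>)"
  using assms
proof (induction n arbitrary: h)
  case 0
  then show ?case by (simp add: zmom_0)
next
  case (Suc n)
  then show ?case
    by (auto simp: zmom_form_Suc intro!: sum_nonneg Suc.IH integrable_nth_mult)
qed

lemma C1_grad_power_inner: "C1_grad (\<lambda>y. (x \<bullet> y) ^ Suc n) (\<lambda>y. (real (Suc n) * (x \<bullet> y) ^ n) *\<^sub>R x)"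
  by (rule C1_grad_compose[OF C1_grad_inner, where g="\<lambda>s. s ^ Suc n" and g'="\<lambda>s. real (Suc n) * s ^ n"])
     (use DERIV_pow[of "Suc n"] in \<open>auto intro!: continuous_intros simp del: of_nat_Suc\<close>)

text \<open>The right side is the derivative of \<open>zmom (Suc n) f\<close> along
  \<open>cross3 e x\<close>. Since the kernel depends on \<open>x \<bullet> y\<close> alone,
  rotating \<open>x\<close> amounts to rotating the density, and integration by parts expresses this
  without loss of degree. The gain shows in \<open>green_potential_gradient_bound\<close>.\<close>

lemma zmom_rotation_derivative:
  assumes "C1_grad f F"
  shows "zmom (Suc n) (\<lambda>y. F y \<bullet> cross3 e y) x = real (Suc n) * (e \<bullet> cross3 x (zmom_vec n f x))"
proof -
  have f: "continuous_on S2 f" using assms by (rule C1_grad_continuous)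
  then have int: "integrable \<sigma> f" by (rule integrable_\<sigma>_continuous)
  from rotation_by_parts[OF C1_grad_power_inner assms, of x n e]
  have "zmom (Suc n) (\<lambda>y. F y \<bullet> cross3 e y) x
      = - (\<integral>y. f y * ((real (Suc n) * (x \<bullet> y) ^ n) *\<^sub>R x \<bullet> cross3 e y) \<partial>\<sigma>)"
    by (simp add: zmom_def)
  also have "(\<lambda>y. f y * ((real (Suc n) * (x \<bullet> y) ^ n) *\<^sub>R x \<bullet> cross3 e y))
     = (\<lambda>y. - (\<Sum>i\<in>UNIV. (real (Suc n) * cross3 e x $ i) * ((x \<bullet> y) ^ n * (y $ i * f y))))"
  proof
    fix y
    have "x \<bullet> cross3 e y = - (\<Sum>i\<in>UNIV. cross3 e x $ i * y $ i)"
      unfolding inner_3 sum_3 by (simp add: cross3_def algebra_simps)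
    then have "f y * ((real (Suc n) * (x \<bullet> y) ^ n) *\<^sub>R x \<bullet> cross3 e y)
       = - (real (Suc n) * (x \<bullet> y) ^ n * f y * (\<Sum>i\<in>UNIV. cross3 e x $ i * y $ i))"
      by simp
    then show "f y * ((real (Suc n) * (x \<bullet> y) ^ n) *\<^sub>R x \<bullet> cross3 e y)
       = - (\<Sum>i\<in>UNIV. (real (Suc n) * cross3 e x $ i) * ((x \<bullet> y) ^ n * (y $ i * f y)))"
      by (simp add: sum_distrib_left mult_ac)
  qed
  also have "- (\<integral>y. - (\<Sum>i\<in>UNIV. (real (Suc n) * cross3 e x $ i) * ((x \<bullet> y) ^ n * (y $ i * f y))) \<partial>\<sigma>)
     = (\<Sum>i\<in>UNIV. (real (Suc n) * cross3 e x $ i) * zmom n (\<lambda>y. y $ i * f y) x)"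
    unfolding zmom_def
    by (subst Bochner_Integration.integral_minus, subst Bochner_Integration.integral_sum)
       (auto intro!: integrable_zmom integrable_nth_mult int)
  also have "\<dots> = real (Suc n) * (cross3 e x \<bullet> zmom_vec n f x)"
    unfolding inner_eq_sum zmom_vec_nth sum_distrib_left by (simp add: mult_ac)
  also have "cross3 e x \<bullet> zmom_vec n f x = e \<bullet> cross3 x (zmom_vec n f x)"
    unfolding inner_3 by (simp add: cross3_def algebra_simps)
  finally show ?thesis .
qed

section \<open>Size of the kernels and the approximate identity\<close>

definition abs_mom :: "nat \<Rightarrow> real^3 \<Rightarrow> real"
  where "abs_mom n x = (\<integral>y. \<bar>x \<bullet> y\<bar> ^ n \<partial>\<sigma>)"

lemma abs_inner_S2_le: "x \<in> S2 \<Longrightarrow> y \<in> S2 \<Longrightarrow> \<bar>x \<bullet> y\<bar> \<le> 1"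
  using Cauchy_Schwarz_ineq2[of x y] by simp

lemma integrable_abs_power: "integrable \<sigma> (\<lambda>y. \<bar>x \<bullet> y\<bar> ^ n)"
  by (intro integrable_\<sigma>_continuous continuous_intros)

lemma integrable_power: "integrable \<sigma> (\<lambda>y. (x \<bullet> y) ^ n)"
  by (intro integrable_\<sigma>_continuous continuous_intros)

lemma zmom_one: "zmom n (\<lambda>y. 1) x = (\<integral>y. (x \<bullet> y) ^ n \<partial>\<sigma>)"
  by (simp add: zmom_def)

text \<open>The summands are the squared components of \<open>cross3 y x\<close>: Lagrange's
  identity.\<close>

lemma sum_rotation_squares:
  assumes "norm x = 1" "norm y = 1"
  shows "(\<Sum>i\<in>UNIV. (x \<bullet> cross3 (axis i 1) y)\<^sup>2) = 1 - (x \<bullet> y)\<^sup>2"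
proof -
  have "x \<bullet> x = 1" "y \<bullet> y = 1"
    using assms by (simp_all add: dot_square_norm)
  moreover have "(\<Sum>i\<in>UNIV. (x \<bullet> cross3 (axis i 1) y)\<^sup>2) = (x \<bullet> x) * (y \<bullet> y) - (x \<bullet> y)\<^sup>2"
    unfolding sum_3 inner_3
    by (simp add: cross3_def axis_def) (simp add: power2_eq_square algebra_simps)
  ultimately show ?thesis by simp
qed

text \<open>The Laplacian is the sum of the squares of the rotation derivatives about the axes; here
  it acts on the linear function \<open>x \<bullet> y\<close> of \<open>y\<close>, whose eigenvalue
  is -2.\<close>

lemma sum_rotation_double:
  "(\<Sum>i\<in>UNIV. cross3 x (axis i 1) \<bullet> cross3 (axis i 1) y) = - 2 * (x \<bullet> y)"
  unfolding sum_3 inner_3 by (simp add: cross3_def axis_def)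

lemma zmom_one_1: "zmom 1 (\<lambda>y. 1) x = 0"
proof -
  have "(\<integral>y. cross3 x (axis i 1) \<bullet> cross3 (axis i 1) y \<partial>\<sigma>) = 0" for i
    by (rule integral_rotation_derivative[OF C1_grad_inner])
  then have "0 = (\<Sum>i\<in>UNIV. \<integral>y. cross3 x (axis i 1) \<bullet> cross3 (axis i 1) y \<partial>\<sigma>)"
    by simp
  also have "\<dots> = (\<integral>y. (\<Sum>i\<in>UNIV. cross3 x (axis i 1) \<bullet> cross3 (axis i 1) y) \<partial>\<sigma>)"
    by (rule Bochner_Integration.integral_sum[symmetric]) (intro integrable_\<sigma>_continuous continuous_intros)
  also have "\<dots> = - 2 * zmom 1 (\<lambda>y. 1) x"
    by (simp add: sum_rotation_double zmom_one)
  finally show ?thesis by simp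
qed

text \<open>With \<open>t = x \<bullet> y\<close>, the Laplacian of \<open>t^(n+2) / (n+2)\<close>
  has integral 0. It is the sum over the axes of the rotation derivatives \<open>D i\<close> of
  \<open>t^(n+1)\<close> times the rotation derivative of \<open>t\<close>. The moments thus come
  out independent of \<open>x\<close> with no appeal to rotation invariance of \<sigma>.\<close>

lemma zmom_one_rec:
  assumes "x \<in> S2"
  shows "real (n + 3) * zmom (n + 2) (\<lambda>y. 1) x = real (n + 1) * zmom n (\<lambda>y. 1) x"
proof -
  define D where "D i y = (real (Suc n) * (x \<bullet> y) ^ n) * (x \<bullet> cross3 (axis i 1) y)\<^sup>2
    + (x \<bullet> y) ^ Suc n * (cross3 x (axis i 1) \<bullet> cross3 (axis i 1) y)" for i and y :: "real^3"
  have cD: "continuous_on S2 (D i)" for i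
    unfolding D_def by (intro continuous_intros)
  have "(\<integral>y. D i y \<partial>\<sigma>) = 0" for i
  proof -
    have "C1_grad (\<lambda>y. cross3 x (axis i 1) \<bullet> y) (\<lambda>y. cross3 x (axis i 1))"
      by (rule C1_grad_inner)
    from integral_rotation_derivative[OF C1_grad_mult[OF C1_grad_power_inner[of x n] this], of "axis i 1"]
    have "(\<integral>y. ((cross3 x (axis i 1) \<bullet> y) *\<^sub>R ((real (Suc n) * (x \<bullet> y) ^ n) *\<^sub>R x)
        + (x \<bullet> y) ^ Suc n *\<^sub>R cross3 x (axis i 1)) \<bullet> cross3 (axis i 1) y \<partial>\<sigma>) = 0" .
    moreover have "((cross3 x (axis i 1) \<bullet> y) *\<^sub>R ((real (Suc n) * (x \<bullet> y) ^ n) *\<^sub>R x)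
        + (x \<bullet> y) ^ Suc n *\<^sub>R cross3 x (axis i 1)) \<bullet> cross3 (axis i 1) y = D i y" for y
    proof -
      have "cross3 x (axis i 1) \<bullet> y = x \<bullet> cross3 (axis i 1) y"
        unfolding inner_3 by (simp add: cross3_def algebra_simps)
      then show ?thesis
        by (simp add: D_def inner_add_left power2_eq_square del: of_nat_Suc power_Suc)
    qed
    ultimately show ?thesis by simp
  qed
  then have "0 = (\<Sum>i\<in>UNIV. \<integral>y. D i y \<partial>\<sigma>)" by simp
  also have "\<dots> = (\<integral>y. (\<Sum>i\<in>UNIV. D i y) \<partial>\<sigma>)"
    by (rule Bochner_Integration.integral_sum[symmetric]) (intro integrable_\<sigma>_continuous cD)
  also have "\<dots> = (\<integral>y. real (n + 1) * (x \<bullet> y) ^ n - real (n + 3) * (x \<bullet> y) ^ (n + 2) \<partial>\<sigma>)"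
  proof (rule Bochner_Integration.integral_cong)
    fix y assume "y \<in> space \<sigma>"
    then have "(\<Sum>i\<in>UNIV. D i y) = (real (Suc n) * (x \<bullet> y) ^ n) * (1 - (x \<bullet> y)\<^sup>2)
        + (x \<bullet> y) ^ Suc n * (- 2 * (x \<bullet> y))"
      unfolding D_def sum.distrib sum_distrib_left[symmetric] sum_rotation_double
      using assms by (subst sum_rotation_squares) auto
    then show "(\<Sum>i\<in>UNIV. D i y) = real (n + 1) * (x \<bullet> y) ^ n - real (n + 3) * (x \<bullet> y) ^ (n + 2)"
      by (simp add: algebra_simps power2_eq_square)
  qed simp
  also have "\<dots> = real (n + 1) * zmom n (\<lambda>y. 1) x - real (n + 3) * zmom (n + 2) (\<lambda>y. 1) x"
    using integrable_power[of x n] integrable_power[of x "n + 2"]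
    unfolding zmom_one by (simp del: of_nat_add add_2_eq_Suc')
  finally show ?thesis by simp
qed

lemma zmom_one_even:
  assumes "x \<in> S2"
  shows "real (2 * k + 1) * zmom (2 * k) (\<lambda>y. 1) x = area"
proof (induction k)
  case 0
  then show ?case by (simp add: zmom_0)
next
  case (Suc k)
  then show ?case using zmom_one_rec[OF assms, of "2 * k"] by (simp add: algebra_simps)
qed

lemma abs_mom_even:
  assumes "x \<in> S2"
  shows "abs_mom (2 * k) x = area / real (2 * k + 1)"
proof -
  have "abs_mom (2 * k) x = zmom (2 * k) (\<lambda>y. 1) x"
    by (simp add: abs_mom_def zmom_one power_mult)
  then show ?thesis
    using zmom_one_even[OF assms, of k] by (simp add: field_simps)
qed

lemma abs_mom_mono:
  assumes "x \<in> S2" "k \<le> n"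
  shows "abs_mom n x \<le> abs_mom k x"
  unfolding abs_mom_def
proof (rule integral_mono)
  fix y assume "y \<in> space \<sigma>"
  then show "\<bar>x \<bullet> y\<bar> ^ n \<le> \<bar>x \<bullet> y\<bar> ^ k"
    using assms by (intro power_decreasing abs_inner_S2_le) auto
qed (rule integrable_abs_power)+

text \<open>The closed form covers even degrees; an odd degree is bounded by the even one below it,
  and the factor 2 absorbs the shift.\<close>

lemma abs_mom_le:
  assumes "x \<in> S2"
  shows "abs_mom n x \<le> 2 * area / real (n + 1)"
proof (cases "even n")
  case True
  then show ?thesis
    using abs_mom_even[OF assms, of "n div 2"] area_pos by (auto simp: divide_right_mono)
next
  case False
  then obtain k where n: "n = 2 * k + 1" by (auto elim: oddE)
  have "abs_mom n x \<le> abs_mom (2 * k) x"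
    by (rule abs_mom_mono) (use assms n in auto)
  also have "\<dots> = area / real (2 * k + 1)" by (rule abs_mom_even[OF assms])
  also have "\<dots> \<le> 2 * area / real (n + 1)"
    using area_pos by (simp add: n field_simps)
  finally show ?thesis .
qed

text \<open>One order better than \<open>abs_mom_le\<close>, because the weight
  \<open>1 - t^2\<close> vanishes at both points where \<open>\<bar>t\<bar> ^ n\<close>
  concentrates. The quadratic decay beats the factor \<open>n + 1\<close> in the approximate
  identity.\<close>

lemma abs_mom_drop:
  assumes "x \<in> S2" "0 < n"
  shows "abs_mom n x - abs_mom (n + 2) x \<le> 2 * area / (real n * real (n + 2))"
proof -
  define k where "k = n div 2"
  have k: "2 * k \<le> n" "n \<le> 2 * k + 1" unfolding k_def by auto
  have eq: "abs_mom m x - abs_mom (m + 2) x = (\<integral>y. \<bar>x \<bullet> y\<bar> ^ m * (1 - (x \<bullet> y)\<^sup>2) \<partial>\<sigma>)" for m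
  proof -
    have "\<bar>x \<bullet> y\<bar> ^ m * (1 - (x \<bullet> y)\<^sup>2) = \<bar>x \<bullet> y\<bar> ^ m - \<bar>x \<bullet> y\<bar> ^ (m + 2)" for y
      by (simp add: power_add right_diff_distrib power2_eq_square)
    then show ?thesis
      unfolding abs_mom_def by (simp add: integrable_abs_power del: power_add_numeral2 add_2_eq_Suc')
  qed
  have "abs_mom n x - abs_mom (n + 2) x \<le> abs_mom (2 * k) x - abs_mom (2 * k + 2) x"
    unfolding eq
  proof (rule integral_mono)
    fix y assume "y \<in> space \<sigma>"
    then have 1: "\<bar>x \<bullet> y\<bar> \<le> 1" using assms by (intro abs_inner_S2_le) auto
    then have "(x \<bullet> y)\<^sup>2 \<le> 1" by (simp add: abs_square_le_1)
    moreover have "\<bar>x \<bullet> y\<bar> ^ n \<le> \<bar>x \<bullet> y\<bar> ^ (2 * k)"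
      using 1 k by (intro power_decreasing) auto
    ultimately show "\<bar>x \<bullet> y\<bar> ^ n * (1 - (x \<bullet> y)\<^sup>2) \<le> \<bar>x \<bullet> y\<bar> ^ (2 * k) * (1 - (x \<bullet> y)\<^sup>2)"
      by (intro mult_right_mono) auto
  qed (intro integrable_\<sigma>_continuous continuous_intros)+
  also have "\<dots> = area / real (2 * k + 1) - area / real (2 * k + 3)"
    using abs_mom_even[OF assms(1), of k] abs_mom_even[OF assms(1), of "k + 1"] by (simp add: algebra_simps)
  also have "\<dots> = 2 * area / (real (2 * k + 1) * real (2 * k + 3))"
    by (simp add: field_simps)
  also have "\<dots> \<le> 2 * area / (real n * real (n + 2))"
  proof (rule divide_left_mono)
    show "real n * real (n + 2) \<le> real (2 * k + 1) * real (2 * k + 3)"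
      using k by (intro mult_mono) auto
  qed (use area_pos assms in auto)
  finally show ?thesis .
qed

lemma zmom_abs_le:
  assumes "integrable \<sigma> h"
  shows "\<bar>zmom n h x\<bar> \<le> (\<integral>y. \<bar>x \<bullet> y\<bar> ^ n * \<bar>h y\<bar> \<partial>\<sigma>)"
proof -
  have "\<bar>zmom n h x\<bar> \<le> (\<integral>y. \<bar>(x \<bullet> y) ^ n * h y\<bar> \<partial>\<sigma>)"
    unfolding zmom_def by (rule integral_abs_bound)
  then show ?thesis by (simp add: abs_mult power_abs)
qed

lemma zmom_bounded_le:
  assumes "integrable \<sigma> h" "x \<in> S2" "\<And>y. y \<in> S2 \<Longrightarrow> \<bar>h y\<bar> \<le> C"
  shows "\<bar>zmom n h x\<bar> \<le> 2 * area * C / real (n + 1)"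
proof -
  have C: "0 \<le> C" using assms(2,3) by (meson abs_ge_zero order_trans)
  have "\<bar>zmom n h x\<bar> \<le> (\<integral>y. \<bar>x \<bullet> y\<bar> ^ n * \<bar>h y\<bar> \<partial>\<sigma>)"
    by (rule zmom_abs_le[OF assms(1)])
  also have "\<dots> \<le> (\<integral>y. \<bar>x \<bullet> y\<bar> ^ n * C \<partial>\<sigma>)"
  proof (rule integral_mono)
    show "integrable \<sigma> (\<lambda>y. \<bar>x \<bullet> y\<bar> ^ n * \<bar>h y\<bar>)"
      by (intro integrable_\<sigma>_mult_continuous continuous_intros integrable_abs assms)
    show "integrable \<sigma> (\<lambda>y. \<bar>x \<bullet> y\<bar> ^ n * C)"
      by (intro integrable_\<sigma>_continuous continuous_intros)
  qed (auto intro!: mult_left_mono assms)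
  also have "\<dots> = C * abs_mom n x"
    unfolding abs_mom_def integral_mult_left_zero by (rule mult.commute)
  also have "\<dots> \<le> C * (2 * area / real (n + 1))"
    by (intro mult_left_mono abs_mom_le assms C)
  finally show ?thesis by (simp add: mult_ac)
qed

text \<open>Continuity at \<open>x\<close> in a form that is affine in \<open>x \<bullet> y\<close>,
  so that it can be integrated against powers of \<open>x \<bullet> y\<close>.\<close>

lemma modulus_at_point:
  assumes "continuous_on S2 u" "x \<in> S2" "0 < e"
  obtains C where "0 \<le> C" "\<And>y. y \<in> S2 \<Longrightarrow> \<bar>u y - u x\<bar> \<le> e + C * (1 - x \<bullet> y)"
proof -
  have "compact (u ` S2)"
    using assms(1) by (intro compact_continuous_image) auto
  then obtain B where B: "\<forall>y\<in>S2. \<bar>u y\<bar> \<le> B"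
    using compact_imp_bounded bounded_real by (metis imageI)
  then have B0: "0 \<le> B" using assms(2) by (meson abs_ge_zero order_trans)
  obtain d where d: "0 < d" "\<And>y. y \<in> S2 \<Longrightarrow> dist y x < d \<Longrightarrow> dist (u y) (u x) < e"
    using assms unfolding continuous_on_iff by meson
  \<comment> \<open>The squared distance is \<open>2 * (1 - x \<bullet> y)\<close>, so beyond
    distance \<open>d\<close> the term \<open>C * (1 - x \<bullet> y)\<close> exceeds the trivial
    bound \<open>2 * B\<close>.\<close>
  define C where "C = 4 * B / d\<^sup>2"
  have "\<bar>u y - u x\<bar> \<le> e + C * (1 - x \<bullet> y)" if y: "y \<in> S2" for y
  proof -
    have xy: "(dist y x)\<^sup>2 = 2 * (1 - x \<bullet> y)"
      using y assms(2)
      by (simp add: dist_norm power2_norm_eq_inner inner_diff_left inner_diff_right inner_commute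
          dot_square_norm[symmetric]) (simp add: dot_square_norm)
    then have nn: "0 \<le> 1 - x \<bullet> y" by (metis zero_le_mult_iff zero_le_power2 less_le_not_le zero_less_numeral)
    show ?thesis
    proof (cases "dist y x < d")
      case True
      have "0 \<le> C" unfolding C_def using B0 by simp
      then have "0 \<le> C * (1 - x \<bullet> y)" using nn by simp
      then show ?thesis using d(2)[OF y True] by (simp add: dist_real_def)
    next
      case False
      then have "d\<^sup>2 \<le> 2 * (1 - x \<bullet> y)"
        using xy d(1) by (metis less_imp_le linorder_not_less power_mono)
      then have "2 * B * d\<^sup>2 \<le> 2 * B * (2 * (1 - x \<bullet> y))"
        using B0 by (intro mult_left_mono) auto
      then have "2 * B \<le> C * (1 - x \<bullet> y)"
        using d(1) by (simp add: C_def field_simps)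
      moreover have "\<bar>u y - u x\<bar> \<le> 2 * B"
        using B y assms(2) by (smt (verit))
      ultimately show ?thesis using assms(3) by linarith
    qed
  qed
  moreover have "0 \<le> C" unfolding C_def using B0 by simp
  ultimately show thesis using that by blast
qed

text \<open>The total mass of the kernel used next, the same for every \<open>n\<close>. Odd moments
  of the constant vanish, so of the two summands the one of even degree carries the mass.\<close>

lemma zmom_one_consecutive:
  assumes "x \<in> S2"
  shows "real (n + 2) * zmom (n + 1) (\<lambda>y. 1) x + real (n + 1) * zmom n (\<lambda>y. 1) x = area"
proof (induction n)
  case 0
  then show ?case using zmom_one_1[of x] by (simp add: zmom_0)
next
  case (Suc n)
  then show ?case using zmom_one_rec[OF assms, of n] by (simp add: algebra_simps)
qed

text \<open>The kernel \<open>(n + 2) t\<^bsup>n+1\<^esup> + (n + 1) t\<^bsup>n\<^esup>\<close> with \<open>t = x \<bullet> y\<close> is a signed approximate identity: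
  each summand also concentrates at the antipode \<open>t = -1\<close>, where the two cancel.\<close>

lemma zmom_approx_identity:
  assumes "continuous_on S2 u" "x \<in> S2"
  shows "(\<lambda>n. real (n + 2) * zmom (n + 1) u x + real (n + 1) * zmom n u x) \<longlonglongrightarrow> area * u x"
proof -
  let ?T = "\<lambda>n. real (n + 2) * zmom (n + 1) u x + real (n + 1) * zmom n u x"
  have intu: "integrable \<sigma> u" by (rule integrable_\<sigma>_continuous) fact
  define k where "k n y = real (n + 2) * (x \<bullet> y) ^ (n + 1) + real (n + 1) * (x \<bullet> y) ^ n" for n y
  have ck: "continuous_on S2 (k n)" for n
    unfolding k_def by (intro continuous_intros)
  \<comment> \<open>After \<open>\<bar>x \<bullet> y\<bar> ^ n\<close> is factored out, the large
    coefficient \<open>n + 1\<close> comes with \<open>1 + x \<bullet> y\<close>, which is small at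
    the antipode: this is the cancellation.\<close>
  have kabs: "\<bar>k n y\<bar> = \<bar>x \<bullet> y\<bar> ^ n * \<bar>x \<bullet> y + real (n + 1) * (1 + x \<bullet> y)\<bar>" for n y
  proof -
    have "k n y = (x \<bullet> y) ^ n * (x \<bullet> y + real (n + 1) * (1 + x \<bullet> y))"
      by (simp add: k_def algebra_simps)
    then show ?thesis by (simp add: abs_mult power_abs)
  qed
  have diff: "?T n - area * u x = (\<integral>y. k n y * (u y - u x) \<partial>\<sigma>)" for n
  proof -
    have "(\<integral>y. k n y * (u y - u x) \<partial>\<sigma>)
       = (\<integral>y. real (n + 2) * ((x \<bullet> y) ^ (n + 1) * u y) + real (n + 1) * ((x \<bullet> y) ^ n * u y)
          - u x * (real (n + 2) * (x \<bullet> y) ^ (n + 1) + real (n + 1) * (x \<bullet> y) ^ n) \<partial>\<sigma>)"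
      by (rule Bochner_Integration.integral_cong) (simp_all add: k_def algebra_simps)
    also have "\<dots> = ?T n - u x * (real (n + 2) * zmom (n + 1) (\<lambda>y. 1) x + real (n + 1) * zmom n (\<lambda>y. 1) x)"
      using integrable_zmom[OF intu, of x n] integrable_zmom[OF intu, of x "n+1"]
        integrable_power[of x n] integrable_power[of x "n+1"]
      unfolding zmom_one by (simp add: zmom_def del: power_Suc add_2_eq_Suc')
    finally show ?thesis unfolding zmom_one_consecutive[OF assms(2)] by (simp add: mult.commute)
  qed
  \<comment> \<open>The part with \<open>e\<close> costs the absolute mass of the kernel, at most
    \<open>4 * area\<close>. In the part with \<open>C\<close>, the factor \<open>1 - t\<close>
    tames the pole \<open>t = 1\<close> and the cancellation tames \<open>t = -1\<close>; together
    they give \<open>1 - t^2\<close>, hence \<open>abs_mom_drop\<close>.\<close>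
  have bound: "\<bar>?T n - area * u x\<bar> \<le> 4 * area * e + C * (4 * area / real (n + 1) + real (n + 1) * (2 * area / (real n * real (n + 2))))"
    if e: "0 < e" and C: "0 \<le> C" "\<And>y. y \<in> S2 \<Longrightarrow> \<bar>u y - u x\<bar> \<le> e + C * (1 - x \<bullet> y)" and n: "0 < n" for n e C
  proof -
    have "\<bar>?T n - area * u x\<bar> \<le> (\<integral>y. \<bar>k n y * (u y - u x)\<bar> \<partial>\<sigma>)"
      unfolding diff by (rule integral_abs_bound)
    also have "\<dots> \<le> (\<integral>y. e * (real (n + 2) * \<bar>x \<bullet> y\<bar> ^ (n + 1) + real (n + 1) * \<bar>x \<bullet> y\<bar> ^ n)
       + C * (2 * \<bar>x \<bullet> y\<bar> ^ n + real (n + 1) * (\<bar>x \<bullet> y\<bar> ^ n - \<bar>x \<bullet> y\<bar> ^ (n + 2))) \<partial>\<sigma>)"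
    proof (rule integral_mono)
      show "integrable \<sigma> (\<lambda>y. \<bar>k n y * (u y - u x)\<bar>)"
        by (intro integrable_\<sigma>_continuous continuous_intros ck assms)
    next
      fix y assume "y \<in> space \<sigma>"
      then have y: "y \<in> S2" by simp
      let ?t = "x \<bullet> y"
      have t: "\<bar>?t\<bar> \<le> 1" using abs_inner_S2_le[OF assms(2) y] .
      have "\<bar>k n y * (u y - u x)\<bar> \<le> \<bar>k n y\<bar> * (e + C * (1 - ?t))"
        unfolding abs_mult by (intro mult_left_mono C y) auto
      also have "\<dots> = e * \<bar>k n y\<bar> + C * (\<bar>k n y\<bar> * (1 - ?t))"
        by (simp add: algebra_simps)
      also have "\<dots> \<le> e * (real (n + 2) * \<bar>?t\<bar> ^ (n + 1) + real (n + 1) * \<bar>?t\<bar> ^ n)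
         + C * (2 * \<bar>?t\<bar> ^ n + real (n + 1) * (\<bar>?t\<bar> ^ n - \<bar>?t\<bar> ^ (n + 2)))"
      proof (intro add_mono mult_left_mono)
        have "\<bar>k n y\<bar> \<le> \<bar>real (n + 2) * ?t ^ (n + 1)\<bar> + \<bar>real (n + 1) * ?t ^ n\<bar>"
          unfolding k_def by (rule abs_triangle_ineq)
        then show "\<bar>k n y\<bar> \<le> real (n + 2) * \<bar>?t\<bar> ^ (n + 1) + real (n + 1) * \<bar>?t\<bar> ^ n"
          by (simp add: abs_mult power_abs)
        have "\<bar>?t + real (n + 1) * (1 + ?t)\<bar> \<le> \<bar>?t\<bar> + \<bar>real (n + 1) * (1 + ?t)\<bar>"
          by (rule abs_triangle_ineq)
        also have "\<dots> \<le> 1 + real (n + 1) * (1 + ?t)"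
          using t by (simp add: abs_mult)
        finally have "\<bar>?t + real (n + 1) * (1 + ?t)\<bar> * (1 - ?t) \<le> (1 + real (n + 1) * (1 + ?t)) * (1 - ?t)"
          using t by (intro mult_right_mono) auto
        also have "\<dots> = (1 - ?t) + real (n + 1) * (1 - ?t\<^sup>2)"
          by (simp add: algebra_simps power2_eq_square)
        also have "\<dots> \<le> 2 + real (n + 1) * (1 - ?t\<^sup>2)" using t by simp
        finally have "\<bar>?t\<bar> ^ n * (\<bar>?t + real (n + 1) * (1 + ?t)\<bar> * (1 - ?t)) \<le> \<bar>?t\<bar> ^ n * (2 + real (n + 1) * (1 - ?t\<^sup>2))"
          by (intro mult_left_mono) auto
        then show "\<bar>k n y\<bar> * (1 - ?t) \<le> 2 * \<bar>?t\<bar> ^ n + real (n + 1) * (\<bar>?t\<bar> ^ n - \<bar>?t\<bar> ^ (n + 2))"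
          unfolding kabs by (simp only: power_add power2_abs) (simp add: algebra_simps)
      qed (use e C in auto)
      finally show "\<bar>k n y * (u y - u x)\<bar> \<le> e * (real (n + 2) * \<bar>?t\<bar> ^ (n + 1) + real (n + 1) * \<bar>?t\<bar> ^ n)
         + C * (2 * \<bar>?t\<bar> ^ n + real (n + 1) * (\<bar>?t\<bar> ^ n - \<bar>?t\<bar> ^ (n + 2)))" .
    qed (intro integrable_\<sigma>_continuous continuous_intros)
    also have "\<dots> = e * (real (n + 2) * abs_mom (n + 1) x + real (n + 1) * abs_mom n x)
       + C * (2 * abs_mom n x + real (n + 1) * (abs_mom n x - abs_mom (n + 2) x))"
      using integrable_abs_power[of x n] integrable_abs_power[of x "n+1"] integrable_abs_power[of x "n+2"]
      by (simp add: abs_mom_def del: power_Suc add_2_eq_Suc')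
    also have "\<dots> \<le> e * (4 * area) + C * (4 * area / real (n + 1) + real (n + 1) * (2 * area / (real n * real (n + 2))))"
    proof (intro add_mono mult_left_mono)
      have "real (n + 2) * abs_mom (n + 1) x \<le> real (n + 2) * (2 * area / real (n + 1 + 1))"
        by (intro mult_left_mono abs_mom_le assms) auto
      moreover have "real (n + 1) * abs_mom n x \<le> real (n + 1) * (2 * area / real (n + 1))"
        by (intro mult_left_mono abs_mom_le assms) auto
      ultimately show "real (n + 2) * abs_mom (n + 1) x + real (n + 1) * abs_mom n x \<le> 4 * area"
        by simp
      show "2 * abs_mom n x \<le> 4 * area / real (n + 1)"
        using abs_mom_le[OF assms(2), of n] by simp
      show "abs_mom n x - abs_mom (n + 2) x \<le> 2 * area / (real n * real (n + 2))"
        by (rule abs_mom_drop[OF assms(2) n])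
    qed (use e C in auto)
    finally show ?thesis by (simp add: mult_ac)
  qed
  have "(\<lambda>n. ?T n - area * u x) \<longlonglongrightarrow> 0"
  proof (rule LIMSEQ_I)
    fix r :: real assume r: "0 < r"
    define e where "e = r / (8 * area)"
    have e: "0 < e" "4 * area * e = r / 2" using r area_pos by (auto simp: e_def)
    obtain C where C: "0 \<le> C" "\<And>y. y \<in> S2 \<Longrightarrow> \<bar>u y - u x\<bar> \<le> e + C * (1 - x \<bullet> y)"
      using modulus_at_point[OF assms e(1)] by blast
    have "(\<lambda>n. C * (4 * area / real (n + 1) + real (n + 1) * (2 * area / (real n * real (n + 2))))) \<longlonglongrightarrow> 0"
      by real_asymp
    then have "\<forall>\<^sub>F n in sequentially. C * (4 * area / real (n + 1) + real (n + 1) * (2 * area / (real n * real (n + 2)))) < r / 2"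
      by (rule order_tendstoD) (use r in auto)
    then have "\<forall>\<^sub>F n in sequentially. \<bar>?T n - area * u x\<bar> < r"
      using eventually_gt_at_top[of 0]
    proof eventually_elim
      case (elim n)
      then show ?case using bound[OF e(1) C elim(2)] e(2) by linarith
    qed
    then show "\<exists>no. \<forall>n\<ge>no. norm (?T n - area * u x - 0) < r"
      by (simp add: eventually_sequentially)
  qed
  then show ?thesis by (simp add: LIM_zero_iff)
qed

section \<open>Weak solutions of Poisson's equation\<close>

text \<open>Closure of polynomials under partial derivatives feeds the recursion of
  \<open>Ck_on\<close>; all test fields in the weak formulation will be polynomial.\<close>

lemma real_polynomial_function_gradient:
  fixes f :: "'a::euclidean_space \<Rightarrow> real"
  assumes "real_polynomial_function f"
  shows "\<exists>F. (\<forall>x. (f has_derivative (\<lambda>h. F x \<bullet> h)) (at x)) \<and>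
    (\<forall>b\<in>Basis. real_polynomial_function (\<lambda>x. F x \<bullet> b))"
  using assms
proof induction
  case (linear f)
  have "f h = adjoint f 1 \<bullet> h" for h
    using adjoint_works[OF bounded_linear.linear[OF linear], of h 1] by (simp add: inner_commute)
  then have "f = (\<lambda>h. adjoint f 1 \<bullet> h)" by blast
  then have "(f has_derivative (\<lambda>h. adjoint f 1 \<bullet> h)) (at x)" for x
    using bounded_linear_imp_has_derivative[OF linear, of "at x"] by metis
  then show ?case by (intro exI[of _ "\<lambda>x. adjoint f 1"]) auto
next
  case (const c)
  show ?case by (intro exI[of _ "\<lambda>x. 0"]) auto
next
  case (add f g)
  then obtain F G where
    "\<forall>x. (f has_derivative (\<lambda>h. F x \<bullet> h)) (at x)" "\<forall>x. (g has_derivative (\<lambda>h. G x \<bullet> h)) (at x)"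
    "\<forall>b\<in>Basis. real_polynomial_function (\<lambda>x. F x \<bullet> b)" "\<forall>b\<in>Basis. real_polynomial_function (\<lambda>x. G x \<bullet> b)"
    by blast
  then show ?case
    by (intro exI[of _ "\<lambda>x. F x + G x"]) (auto simp: inner_add_left intro!: has_derivative_add)
next
  case (mult f g)
  then obtain F G where
    FG: "\<And>x. (f has_derivative (\<lambda>h. F x \<bullet> h)) (at x)" "\<And>x. (g has_derivative (\<lambda>h. G x \<bullet> h)) (at x)"
    "\<And>b. b \<in> Basis \<Longrightarrow> real_polynomial_function (\<lambda>x. F x \<bullet> b)"
    "\<And>b. b \<in> Basis \<Longrightarrow> real_polynomial_function (\<lambda>x. G x \<bullet> b)"
    by blast
  let ?H = "\<lambda>x. f x *\<^sub>R G x + g x *\<^sub>R F x"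
  have 1: "((\<lambda>x. f x * g x) has_derivative (\<lambda>h. ?H x \<bullet> h)) (at x)" for x
    using has_derivative_mult[OF FG(1,2), of x] by (simp add: inner_add_left mult.commute)
  have 2: "real_polynomial_function (\<lambda>x. ?H x \<bullet> b)" if "b \<in> Basis" for b
    unfolding inner_add_left inner_scaleR_left
    by (intro real_polynomial_function.intros(3,4) mult.hyps FG that)
  show ?case by (intro exI[of _ ?H] conjI allI ballI 1 2)
qed

lemma Ck_on_polynomial: "real_polynomial_function f \<Longrightarrow> Ck_on k M f"
proof (induction k arbitrary: f)
  case 0
  then show ?case
    by (simp add: continuous_on_polymonial_function real_polynomial_function_eq)
next
  case (Suc k)
  obtain F where F: "\<And>x. (f has_derivative (\<lambda>h. F x \<bullet> h)) (at x)"
      "\<And>b. b \<in> Basis \<Longrightarrow> real_polynomial_function (\<lambda>x. F x \<bullet> b)"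
    using real_polynomial_function_gradient[OF Suc.prems] by blast
  show ?case
    unfolding Ck_on.simps
    by (intro exI[of _ F] conjI ballI has_derivative_at_withinI[OF F(1)] Suc.IH F(2))
qed

lemma smooth_on_polynomial: "real_polynomial_function f \<Longrightarrow> smooth_on M f"
  by (simp add: smooth_on_def Ck_on_polynomial)

section \<open>Surface gradients\<close>

lemma great_circle_in_S2:
  assumes "norm x = 1" "norm \<tau> = 1" "\<tau> \<bullet> x = (0::real)"
  shows "norm (cos s *\<^sub>R x + sin s *\<^sub>R \<tau>) = 1"
proof -
  have "(cos s *\<^sub>R x + sin s *\<^sub>R \<tau>) \<bullet> (cos s *\<^sub>R x + sin s *\<^sub>R \<tau>) = (cos s)\<^sup>2 * (x \<bullet> x) + (sin s)\<^sup>2 * (\<tau> \<bullet> \<tau>)"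
    using assms(3) by (simp add: inner_add_left inner_add_right inner_commute power2_eq_square)
  also have "\<dots> = 1" using assms by (simp add: dot_square_norm)
  finally show ?thesis by (simp add: norm_eq_sqrt_inner)
qed

lemma great_circle_vector_derivative:
  "((\<lambda>s. cos s *\<^sub>R x + sin s *\<^sub>R \<tau>) has_vector_derivative (cos s *\<^sub>R \<tau> - sin s *\<^sub>R x)) (at s within T)"
  by (auto intro!: derivative_eq_intros has_vector_derivative_scaleR simp: algebra_simps)

text \<open>This makes the \<open>THE\<close> in \<open>sgrad\<close> meaningful. The great circle
  leaving \<open>x\<close> in the direction of \<open>w - w'\<close> separates two tangent
  candidates.\<close>

lemma has_sgrad_unique:
  assumes "x \<in> S2" "has_sgrad f x w" "has_sgrad f x w'"
  shows "w = w'"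
proof (rule ccontr)
  assume "w \<noteq> w'"
  define d where "d = w - w'"
  define \<tau> where "\<tau> = (1 / norm d) *\<^sub>R d"
  have d: "d \<noteq> 0" "d \<bullet> x = 0" using \<open>w \<noteq> w'\<close> assms by (auto simp: d_def has_sgrad_def inner_diff_left)
  then have \<tau>: "norm \<tau> = 1" "\<tau> \<bullet> x = 0" by (auto simp: \<tau>_def)
  let ?c = "\<lambda>s. cos s *\<^sub>R x + sin s *\<^sub>R \<tau>"
  have c: "range ?c \<subseteq> S2" using great_circle_in_S2[OF _ \<tau>] assms(1) by auto
  have "((\<lambda>s. f (?c s)) has_real_derivative v \<bullet> \<tau>) (at 0)" if "has_sgrad f x v" for v
    using has_derivative_along_curve[of f v ?c 0 _ UNIV, OF _ great_circle_vector_derivative c] that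
    by (simp add: has_sgrad_def)
  then have "w \<bullet> \<tau> = w' \<bullet> \<tau>" using assms DERIV_unique by blast
  then have "d \<bullet> \<tau> = 0" by (simp add: d_def inner_diff_left)
  then show False using d by (simp add: \<tau>_def)
qed

lemma has_sgrad_tangential:
  assumes "x \<in> S2" "(f has_derivative (\<lambda>h. w \<bullet> h)) (at x within S2)"
  shows "has_sgrad f x (w - (w \<bullet> x) *\<^sub>R x)"
proof -
  have xx: "x \<bullet> x = 1" using assms(1) by (simp add: dot_square_norm)
  \<comment> \<open>The function \<open>y \<bullet> y\<close> is constant on the sphere, so
    subtracting a multiple of it changes only the normal component of the gradient.\<close>
  have "((\<lambda>y. f y - (w \<bullet> x) / 2 * (y \<bullet> y) + (w \<bullet> x) / 2) has_derivative (\<lambda>h. (w - (w \<bullet> x) *\<^sub>R x) \<bullet> h)) (at x within S2)"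
    using assms(2) by (auto intro!: derivative_eq_intros simp: inner_commute inner_diff_right algebra_simps)
  then have "(f has_derivative (\<lambda>h. (w - (w \<bullet> x) *\<^sub>R x) \<bullet> h)) (at x within S2)"
    by (rule has_derivative_transform[OF assms(1), rotated]) (simp add: dot_square_norm)
  then show ?thesis using xx by (simp add: has_sgrad_def inner_diff_left)
qed

lemma sgrad_eq: "x \<in> S2 \<Longrightarrow> has_sgrad f x w \<Longrightarrow> sgrad f x = w"
  unfolding sgrad_def using has_sgrad_unique by (intro the_equality) blast+

lemma sgrad_tangential:
  "x \<in> S2 \<Longrightarrow> (f has_derivative (\<lambda>h. w \<bullet> h)) (at x within S2) \<Longrightarrow> sgrad f x = w - (w \<bullet> x) *\<^sub>R x"
  by (intro sgrad_eq has_sgrad_tangential)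

section \<open>Divergences of the polynomial test fields\<close>

lemma sdiv_eq:
  assumes "x \<in> S2" "\<And>j. ((\<lambda>y. X y $ j) has_derivative (\<lambda>h. G j \<bullet> h)) (at x)"
  shows "sdiv X x = (\<Sum>j\<in>UNIV. G j $ j - (G j \<bullet> x) * x $ j)"
  unfolding sdiv_def
  by (intro sum.cong refl) (simp add: sgrad_tangential[OF assms(1) has_derivative_at_withinI[OF assms(2)]])

lemma real_polynomial_function_inner_const: "real_polynomial_function (\<lambda>x. y \<bullet> x)"
  by (intro real_polynomial_function.intros(1) bounded_linear_inner_right)

lemma real_polynomial_function_nth: "real_polynomial_function (\<lambda>x::real^'n. x $ i)"
  by (intro real_polynomial_function.intros(1) bounded_linear_vec_nth)

lemmas polynomial_intros = real_polynomial_function_inner_const real_polynomial_function_nth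
  real_polynomial_function_power real_polynomial_function_diff
  real_polynomial_function.intros(2-4)

lemma has_derivative_inner_power:
  "((\<lambda>x. (y \<bullet> x) ^ n) has_derivative (\<lambda>h. (real n * (y \<bullet> x) ^ (n - 1)) *\<^sub>R y \<bullet> h)) (at x)"
  by (auto intro!: derivative_eq_intros)

lemma has_derivative_nth: "((\<lambda>x::real^'n. x $ i) has_derivative (\<lambda>h. axis i 1 \<bullet> h)) (at x)"
  using bounded_linear_imp_has_derivative[OF bounded_linear_vec_nth, of i "at x"] by (simp add: inner_axis')

lemma has_derivative_mult_grad:
  assumes "(f has_derivative (\<lambda>h. F \<bullet> h)) (at x)" "(g has_derivative (\<lambda>h. G \<bullet> h)) (at x)"
  shows "((\<lambda>x. f x * g x) has_derivative (\<lambda>h. (f x *\<^sub>R G + g x *\<^sub>R F) \<bullet> h)) (at x)"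
  using has_derivative_mult[OF assms] by (simp add: inner_add_left mult.commute)

lemma has_derivative_diff_grad:
  assumes "(f has_derivative (\<lambda>h. F \<bullet> h)) (at x)" "(g has_derivative (\<lambda>h. G \<bullet> h)) (at x)"
  shows "((\<lambda>x. f x - g x) has_derivative (\<lambda>h. (F - G) \<bullet> h)) (at x)"
  using has_derivative_diff[OF assms] by (simp add: inner_diff_left)

text \<open>The field is the surface gradient of \<open>(y \<bullet> x) ^ (n + 1) / (n + 1)\<close>,
  so the right side is the Laplacian of that function.\<close>

lemma sdiv_tangential_gradient:
  assumes "x \<in> S2" "y \<in> S2"
  shows "sdiv (\<lambda>x. (y \<bullet> x) ^ n *\<^sub>R (y - (y \<bullet> x) *\<^sub>R x)) x
    = real n * (y \<bullet> x) ^ (n - 1) - real (n + 2) * (y \<bullet> x) ^ (n + 1)"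
proof -
  let ?t = "y \<bullet> x"
  have d: "((\<lambda>x. ((y \<bullet> x) ^ n *\<^sub>R (y - (y \<bullet> x) *\<^sub>R x)) $ j) has_derivative
    (\<lambda>h. ((?t ^ n) *\<^sub>R (0 - (?t *\<^sub>R axis j 1 + x $ j *\<^sub>R y))
      + (y $ j - ?t * x $ j) *\<^sub>R ((real n * ?t ^ (n - 1)) *\<^sub>R y)) \<bullet> h)) (at x)" for j
    unfolding vector_scaleR_component vector_minus_component real_scaleR_def
    by (intro has_derivative_mult_grad has_derivative_diff_grad has_derivative_inner_power has_derivative_nth)
      (auto intro!: derivative_eq_intros)
  have xx: "x \<bullet> x = 1" and yy: "y \<bullet> y = 1" using assms by (simp_all add: dot_square_norm)
  have xx': "(\<Sum>j\<in>UNIV. x $ j * x $ j) = 1" and yy': "(\<Sum>j\<in>UNIV. y $ j * y $ j) = 1"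
    and xy': "(\<Sum>j\<in>UNIV. y $ j * x $ j) = ?t"
    using xx yy by (simp_all add: inner_eq_sum)
  have "sdiv (\<lambda>x. (y \<bullet> x) ^ n *\<^sub>R (y - (y \<bullet> x) *\<^sub>R x)) x =
    (\<Sum>j\<in>UNIV. (- (?t ^ n) * (?t + x $ j * y $ j) + (y $ j - ?t * x $ j) * (real n * ?t ^ (n - 1)) * y $ j)
     - (- (?t ^ n) * (2 * ?t * x $ j) + (y $ j - ?t * x $ j) * (real n * ?t ^ (n - 1)) * ?t) * x $ j)"
    unfolding sdiv_eq[OF assms(1) d]
    by (intro sum.cong refl) (simp add: inner_diff_left inner_add_left inner_axis' algebra_simps)
  also have "\<dots> = (\<Sum>j\<in>UNIV. - (?t ^ n) * ?t - (?t ^ n) * (y $ j * x $ j)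
      + (real n * ?t ^ (n - 1)) * (y $ j * y $ j) - 2 * (real n * ?t ^ (n - 1) * ?t) * (y $ j * x $ j)
      + 2 * (?t ^ n * ?t) * (x $ j * x $ j) + (real n * ?t ^ (n - 1) * ?t * ?t) * (x $ j * x $ j))"
    by (intro sum.cong refl) (simp add: algebra_simps)
  also have "\<dots> = - 2 * (?t ^ n * ?t) + (real n * ?t ^ (n - 1)) - (real n * ?t ^ (n - 1)) * (?t * ?t)"
    unfolding sum.distrib sum_subtractf sum_distrib_left[symmetric] xx' yy' xy'
    by (simp add: algebra_simps)
  \<comment> \<open>For \<open>n = 0\<close> the cut-off difference \<open>n - 1\<close> is
    harmless, since its power carries the factor \<open>real n\<close>.\<close>
  also have "\<dots> = real n * ?t ^ (n - 1) - real (n + 2) * ?t ^ (n + 1)"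
    by (cases n) (simp_all add: algebra_simps)
  finally show ?thesis .
qed

text \<open>The product rule for \<open>(y \<bullet> x) ^ n\<close> times the surface gradient of
  the coordinate \<open>x $ i\<close>, whose Laplacian is \<open>- 2 * x $ i\<close>.\<close>

lemma sdiv_tangential_axis:
  assumes "x \<in> S2"
  shows "sdiv (\<lambda>x. (y \<bullet> x) ^ n *\<^sub>R (axis i 1 - (x $ i) *\<^sub>R x)) x
    = real n * (y \<bullet> x) ^ (n - 1) * (y $ i - (y \<bullet> x) * x $ i) - 2 * (y \<bullet> x) ^ n * x $ i"
proof -
  let ?t = "y \<bullet> x"
  let ?e = "axis i 1 :: real^3"
  have d: "((\<lambda>x. ((y \<bullet> x) ^ n *\<^sub>R (?e - (x $ i) *\<^sub>R x)) $ j) has_derivative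
    (\<lambda>h. ((?t ^ n) *\<^sub>R (0 - (x $ i *\<^sub>R axis j 1 + x $ j *\<^sub>R ?e))
      + (?e $ j - x $ i * x $ j) *\<^sub>R ((real n * ?t ^ (n - 1)) *\<^sub>R y)) \<bullet> h)) (at x)" for j
    unfolding vector_scaleR_component vector_minus_component real_scaleR_def
    by (intro has_derivative_mult_grad has_derivative_diff_grad has_derivative_inner_power has_derivative_nth)
      (auto intro!: derivative_eq_intros)
  have xx: "x \<bullet> x = 1" using assms by (simp_all add: dot_square_norm)
  have xx': "(\<Sum>j\<in>UNIV. x $ j * x $ j) = 1" and xy': "(\<Sum>j\<in>UNIV. y $ j * x $ j) = ?t"
    and ey: "(\<Sum>j\<in>UNIV. ?e $ j * y $ j) = y $ i" and ex: "(\<Sum>j\<in>UNIV. ?e $ j * x $ j) = x $ i"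
    using xx by (simp_all add: inner_eq_sum[symmetric] inner_axis')
  have "sdiv (\<lambda>x. (y \<bullet> x) ^ n *\<^sub>R (?e - (x $ i) *\<^sub>R x)) x =
    (\<Sum>j\<in>UNIV. (- (?t ^ n) * (x $ i + x $ j * ?e $ j) + (?e $ j - x $ i * x $ j) * (real n * ?t ^ (n - 1)) * y $ j)
     - (- (?t ^ n) * (2 * x $ i * x $ j) + (?e $ j - x $ i * x $ j) * (real n * ?t ^ (n - 1)) * ?t) * x $ j)"
    unfolding sdiv_eq[OF assms(1) d]
    by (intro sum.cong refl) (simp add: inner_diff_left inner_add_left inner_axis' algebra_simps)
  also have "\<dots> = (\<Sum>j\<in>UNIV. - (?t ^ n) * x $ i - (?t ^ n) * (?e $ j * x $ j)
      + (real n * ?t ^ (n - 1)) * (?e $ j * y $ j) - (real n * ?t ^ (n - 1) * x $ i) * (y $ j * x $ j)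
      + 2 * (?t ^ n * x $ i) * (x $ j * x $ j) - (real n * ?t ^ (n - 1) * ?t) * (?e $ j * x $ j)
      + (real n * ?t ^ (n - 1) * ?t * x $ i) * (x $ j * x $ j))"
    by (intro sum.cong refl) (simp add: algebra_simps)
  also have "\<dots> = real n * ?t ^ (n - 1) * (y $ i - ?t * x $ i) - 2 * ?t ^ n * x $ i"
    unfolding sum.distrib sum_subtractf sum_distrib_left[symmetric] xx' xy' ey ex
    by (simp add: algebra_simps)
  finally show ?thesis .
qed

lemma smooth_tangent_field_polynomial:
  assumes "\<And>j. real_polynomial_function (\<lambda>x. X x $ j)" "\<And>x. x \<in> S2 \<Longrightarrow> X x \<bullet> x = 0"
  shows "smooth_tangent_field X"
  using assms by (auto simp: smooth_tangent_field_def intro!: smooth_on_polynomial)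

lemma smooth_tangential_gradient:
  "smooth_tangent_field (\<lambda>x. (y \<bullet> x) ^ n *\<^sub>R (y - (y \<bullet> x) *\<^sub>R x))"
  by (rule smooth_tangent_field_polynomial)
     (simp_all add: polynomial_intros inner_diff_left dot_square_norm)

lemma smooth_tangential_axis:
  "smooth_tangent_field (\<lambda>x. (y \<bullet> x) ^ n *\<^sub>R (axis i 1 - (x $ i) *\<^sub>R x))"
  by (rule smooth_tangent_field_polynomial)
     (simp_all add: polynomial_intros inner_diff_left inner_axis' dot_square_norm)

text \<open>Green's second identity with \<open>(y \<bullet> x) ^ (n + 1)\<close> as test function.
  The weak Laplacian is built from weak derivatives of the components of the weak gradient, so two
  integrations by parts are done separately: \<open>?X n\<close> tests \<open>u\<close> against
  \<open>F\<close>, and \<open>?Y i\<close> tests the component \<open>F x $ i\<close> against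
  \<open>H i\<close>.\<close>

lemma weak_laplacian_zmom:
  assumes u: "integrable \<sigma> u" and v: "integrable \<sigma> v" and lap: "has_weak_laplacian u (\<lambda>x. - v x)" and y: "y \<in> S2"
  shows "real ((n + 1) * (n + 2)) * zmom (n + 1) u y - real ((n + 1) * n) * zmom (n - 1) u y
    = zmom (n + 1) v y"
proof -
  obtain F H where F: "has_weak_grad u F" and H: "\<And>i. has_weak_grad (\<lambda>x. F x $ i) (H i)"
    and vH: "AE x in \<sigma>. - v x = (\<Sum>i\<in>UNIV. H i x $ i)"
    using lap unfolding has_weak_laplacian_def by blast
  have intF: "integrable \<sigma> F" and Fx: "AE x in \<sigma>. F x \<bullet> x = 0"
    using F by (auto simp: has_weak_grad_def)
  have intH: "integrable \<sigma> (H i)" and Hx: "AE x in \<sigma>. H i x \<bullet> x = 0" for i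
    using H by (auto simp: has_weak_grad_def)
  have meas: "F \<in> borel_measurable \<sigma>" "H i \<in> borel_measurable \<sigma>" "v \<in> borel_measurable \<sigma>" for i
    using intF intH v by auto
  have intFi: "integrable \<sigma> (\<lambda>x. F x $ i)" for i
    using integrable_inner_left[of "axis i 1" \<sigma> F] intF by (simp add: inner_axis)
  have intHi: "integrable \<sigma> (\<lambda>x. H i x $ j)" for i j
    using integrable_inner_left[of "axis j 1" \<sigma> "H i"] intH by (simp add: inner_axis)
  let ?X = "\<lambda>n x. (y \<bullet> x) ^ n *\<^sub>R (y - (y \<bullet> x) *\<^sub>R x)"
  let ?Y = "\<lambda>i x. (y \<bullet> x) ^ (n + 1) *\<^sub>R (axis i 1 - (x $ i) *\<^sub>R x)"
  have mX: "?X n \<in> borel_measurable \<sigma>" "?Y i \<in> borel_measurable \<sigma>" for i n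
    by (intro continuous_on_measurable_\<sigma> continuous_intros)+
  have c: "continuous_on S2 (\<lambda>x. (y \<bullet> x) ^ k)" "continuous_on S2 (\<lambda>x. c * (y \<bullet> x) ^ k)"
    "continuous_on S2 (\<lambda>x. c * (y \<bullet> x) ^ k * x $ i)"
    "continuous_on S2 (\<lambda>x. c * (y \<bullet> x) ^ k * (y $ i - (y \<bullet> x) * x $ i))" for k i and c :: real
    by (intro continuous_intros)+
  have "(\<integral>x. u x * sdiv (?X n) x \<partial>\<sigma>) = - (\<integral>x. F x \<bullet> ?X n x \<partial>\<sigma>)"
    using F smooth_tangential_gradient unfolding has_weak_grad_def by blast
  also have "(\<integral>x. F x \<bullet> ?X n x \<partial>\<sigma>) = (\<integral>x. (y \<bullet> x) ^ n * (F x \<bullet> y) \<partial>\<sigma>)"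
  proof (rule integral_cong_AE)
    show "AE x in \<sigma>. F x \<bullet> ?X n x = (y \<bullet> x) ^ n * (F x \<bullet> y)"
      using Fx by eventually_elim (simp add: inner_diff_right)
    show "(\<lambda>x. F x \<bullet> ?X n x) \<in> borel_measurable \<sigma>"
      by (intro borel_measurable_inner meas mX)
    show "(\<lambda>x. (y \<bullet> x) ^ n * (F x \<bullet> y)) \<in> borel_measurable \<sigma>"
      by (intro borel_measurable_times borel_measurable_inner meas continuous_on_measurable_\<sigma>[OF c(1)]
          borel_measurable_const)
  qed
  finally have 1: "(\<integral>x. u x * sdiv (?X n) x \<partial>\<sigma>) = - (\<integral>x. (y \<bullet> x) ^ n * (F x \<bullet> y) \<partial>\<sigma>)" .
  have "(\<integral>x. u x * sdiv (?X n) x \<partial>\<sigma>)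
     = (\<integral>x. real n * ((y \<bullet> x) ^ (n - 1) * u x) - real (n + 2) * ((y \<bullet> x) ^ (n + 1) * u x) \<partial>\<sigma>)"
    by (rule Bochner_Integration.integral_cong)
       (use y in \<open>simp_all add: sdiv_tangential_gradient right_diff_distrib mult_ac\<close>)
  also have "\<dots> = real n * zmom (n - 1) u y - real (n + 2) * zmom (n + 1) u y"
    using integrable_zmom[OF u, of y "n - 1"] integrable_zmom[OF u, of y "n + 1"]
    by (simp add: zmom_def del: power_Suc)
  finally have 2: "real n * zmom (n - 1) u y - real (n + 2) * zmom (n + 1) u y
      = - (\<integral>x. (y \<bullet> x) ^ n * (F x \<bullet> y) \<partial>\<sigma>)"
    using 1 by simp
  have Hi: "(\<integral>x. F x $ i * sdiv (?Y i) x \<partial>\<sigma>) = - (\<integral>x. (y \<bullet> x) ^ (n + 1) * H i x $ i \<partial>\<sigma>)" for i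
  proof -
    have "(\<integral>x. F x $ i * sdiv (?Y i) x \<partial>\<sigma>) = - (\<integral>x. H i x \<bullet> ?Y i x \<partial>\<sigma>)"
      using H[of i] smooth_tangential_axis unfolding has_weak_grad_def by blast
    also have "(\<integral>x. H i x \<bullet> ?Y i x \<partial>\<sigma>) = (\<integral>x. (y \<bullet> x) ^ (n + 1) * H i x $ i \<partial>\<sigma>)"
    proof (rule integral_cong_AE)
      show "AE x in \<sigma>. H i x \<bullet> ?Y i x = (y \<bullet> x) ^ (n + 1) * H i x $ i"
        using Hx[of i] by eventually_elim (simp add: inner_diff_right inner_axis)
      show "(\<lambda>x. H i x \<bullet> ?Y i x) \<in> borel_measurable \<sigma>"
        by (intro borel_measurable_inner meas mX)
      show "(\<lambda>x. (y \<bullet> x) ^ (n + 1) * H i x $ i) \<in> borel_measurable \<sigma>"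
        by (intro borel_measurable_times continuous_on_measurable_\<sigma>[OF c(1)]
          borel_measurable_integrable[OF intHi])
    qed
    finally show ?thesis .
  qed
  have intL: "integrable \<sigma> (\<lambda>x. (real (n + 1) * (y \<bullet> x) ^ n * (y $ i - (y \<bullet> x) * x $ i)) * F x $ i)"
    "integrable \<sigma> (\<lambda>x. (2 * (y \<bullet> x) ^ (n + 1) * x $ i) * F x $ i)" for i
    by (intro integrable_\<sigma>_mult_continuous[OF _ intFi] c)+
  have "(\<Sum>i\<in>UNIV. \<integral>x. F x $ i * sdiv (?Y i) x \<partial>\<sigma>)
     = (\<Sum>i\<in>UNIV. \<integral>x. (real (n + 1) * (y \<bullet> x) ^ n * (y $ i - (y \<bullet> x) * x $ i)) * F x $ i
         - (2 * (y \<bullet> x) ^ (n + 1) * x $ i) * F x $ i \<partial>\<sigma>)"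
    by (intro sum.cong Bochner_Integration.integral_cong refl)
      (simp_all add: sdiv_tangential_axis right_diff_distrib[where a="F _ $ _"] mult_ac del: of_nat_Suc power_Suc)
  also have "\<dots> = (\<integral>x. (\<Sum>i\<in>UNIV. (real (n + 1) * (y \<bullet> x) ^ n * (y $ i - (y \<bullet> x) * x $ i)) * F x $ i
         - (2 * (y \<bullet> x) ^ (n + 1) * x $ i) * F x $ i) \<partial>\<sigma>)"
    by (rule Bochner_Integration.integral_sum[symmetric])
       (intro Bochner_Integration.integrable_diff intL)
  \<comment> \<open>All terms containing \<open>F x $ i * x $ i\<close>, among them the curvature
    term with the factor 2, sum to a multiple of \<open>F x \<bullet> x\<close> and vanish.\<close>
  also have "\<dots> = (\<integral>x. real (n + 1) * ((y \<bullet> x) ^ n * (F x \<bullet> y)) \<partial>\<sigma>)"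
  proof (rule integral_cong_AE)
    show "AE x in \<sigma>. (\<Sum>i\<in>UNIV. (real (n + 1) * (y \<bullet> x) ^ n * (y $ i - (y \<bullet> x) * x $ i)) * F x $ i
         - (2 * (y \<bullet> x) ^ (n + 1) * x $ i) * F x $ i) = real (n + 1) * ((y \<bullet> x) ^ n * (F x \<bullet> y))"
      using Fx
    proof eventually_elim
      case (elim x)
      have "(\<Sum>i\<in>UNIV. (real (n + 1) * (y \<bullet> x) ^ n * (y $ i - (y \<bullet> x) * x $ i)) * F x $ i
         - (2 * (y \<bullet> x) ^ (n + 1) * x $ i) * F x $ i)
        = (\<Sum>i\<in>UNIV. real (n + 1) * (y \<bullet> x) ^ n * (F x $ i * y $ i)
           - (real (n + 1) * (y \<bullet> x) ^ n * (y \<bullet> x) + 2 * (y \<bullet> x) ^ (n + 1)) * (F x $ i * x $ i))"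
        by (intro sum.cong refl) (simp add: algebra_simps)
      then show ?case
        unfolding sum_subtractf sum_distrib_left[symmetric] inner_eq_sum[symmetric] elim by simp
    qed
    show "(\<lambda>x. \<Sum>i\<in>UNIV. (real (n + 1) * (y \<bullet> x) ^ n * (y $ i - (y \<bullet> x) * x $ i)) * F x $ i
         - (2 * (y \<bullet> x) ^ (n + 1) * x $ i) * F x $ i) \<in> borel_measurable \<sigma>"
      by (intro borel_measurable_sum borel_measurable_diff borel_measurable_integrable intL)
    show "(\<lambda>x. real (n + 1) * ((y \<bullet> x) ^ n * (F x \<bullet> y))) \<in> borel_measurable \<sigma>"
      by (intro borel_measurable_times borel_measurable_inner meas continuous_on_measurable_\<sigma>[OF c(1)]
          borel_measurable_const)
  qed
  finally have "real (n + 1) * (\<integral>x. (y \<bullet> x) ^ n * (F x \<bullet> y) \<partial>\<sigma>) = (\<Sum>i\<in>UNIV. - (\<integral>x. (y \<bullet> x) ^ (n + 1) * H i x $ i \<partial>\<sigma>))"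
    unfolding Hi by (simp del: of_nat_add)
  also have "\<dots> = - (\<integral>x. (\<Sum>i\<in>UNIV. (y \<bullet> x) ^ (n + 1) * H i x $ i) \<partial>\<sigma>)"
    unfolding sum_negf
    by (subst Bochner_Integration.integral_sum) (auto intro!: integrable_\<sigma>_mult_continuous[OF c(1) intHi] simp del: power_Suc)
  also have "(\<integral>x. (\<Sum>i\<in>UNIV. (y \<bullet> x) ^ (n + 1) * H i x $ i) \<partial>\<sigma>) = (\<integral>x. - ((y \<bullet> x) ^ (n + 1) * v x) \<partial>\<sigma>)"
  proof (rule integral_cong_AE)
    show "AE x in \<sigma>. (\<Sum>i\<in>UNIV. (y \<bullet> x) ^ (n + 1) * H i x $ i) = - ((y \<bullet> x) ^ (n + 1) * v x)"
      using vH
    proof eventually_elim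
      case (elim x)
      show ?case unfolding sum_distrib_left[symmetric] elim[symmetric] by simp
    qed
    show "(\<lambda>x. \<Sum>i\<in>UNIV. (y \<bullet> x) ^ (n + 1) * H i x $ i) \<in> borel_measurable \<sigma>"
      by (intro borel_measurable_sum borel_measurable_times continuous_on_measurable_\<sigma>[OF c(1)]
          borel_measurable_integrable[OF intHi])
    show "(\<lambda>x. - ((y \<bullet> x) ^ (n + 1) * v x)) \<in> borel_measurable \<sigma>"
      by (intro borel_measurable_uminus borel_measurable_times continuous_on_measurable_\<sigma>[OF c(1)] meas)
  qed
  finally have 3: "real (n + 1) * (\<integral>x. (y \<bullet> x) ^ n * (F x \<bullet> y) \<partial>\<sigma>) = zmom (n + 1) v y"
    by (simp add: zmom_def)
  have "real ((n + 1) * (n + 2)) * zmom (n + 1) u y - real ((n + 1) * n) * zmom (n - 1) u y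
     = real (n + 1) * - (real n * zmom (n - 1) u y - real (n + 2) * zmom (n + 1) u y)"
    by (simp add: algebra_simps)
  then show ?thesis unfolding 2 using 3 by simp
qed

text \<open>The partial sums of \<open>- ln (1 - t) = \<Sum>t\<^bsup>n\<^esup> / n\<close>, up to a constant factor the Green's function of the
  sphere. The equations for the single powers telescope.\<close>

lemma green_partial_sum:
  assumes u: "integrable \<sigma> u" and v: "integrable \<sigma> v" and lap: "has_weak_laplacian u (\<lambda>x. - v x)"
    and mean: "(\<integral>x. u x \<partial>\<sigma>) = 0" and y: "y \<in> S2"
  shows "(\<Sum>k<N. zmom (Suc k) v y / real (Suc k)) = real (N + 1) * zmom N u y + real N * zmom (N - 1) u y"
proof (induction N)
  case 0
  \<comment> \<open>The telescoping starts at the mean of \<open>u\<close>; the term with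
    \<open>N - 1\<close> has coefficient 0 here.\<close>
  then show ?case using mean by (simp add: zmom_0)
next
  case (Suc N)
  have "zmom (Suc N) v y / real (Suc N) = real (N + 2) * zmom (N + 1) u y - real N * zmom (N - 1) u y"
    using weak_laplacian_zmom[OF u v lap y, of N] by (simp add: field_simps)
  then show ?case using Suc by (simp add: algebra_simps)
qed

text \<open>Green's formula: the partial sum with \<open>N + 1\<close> terms is exactly the
  approximate identity of index \<open>N\<close> applied to \<open>u\<close>. Pointwise convergence
  thus needs only continuity of \<open>u\<close>, although \<open>v\<close> is merely
  integrable.\<close>

lemma green_representation:
  assumes u: "continuous_on S2 u" and v: "integrable \<sigma> v" and lap: "has_weak_laplacian u (\<lambda>x. - v x)"
    and mean: "(\<integral>x. u x \<partial>\<sigma>) = 0" and y: "y \<in> S2"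
  shows "(\<lambda>k. zmom (Suc k) v y / real (Suc k)) sums (area * u y)"
proof -
  have "(\<lambda>N. \<Sum>k<Suc N. zmom (Suc k) v y / real (Suc k)) \<longlonglongrightarrow> area * u y"
    using zmom_approx_identity[OF u y]
    unfolding green_partial_sum[OF integrable_\<sigma>_continuous[OF u] v lap mean y] by (simp add: algebra_simps)
  then show ?thesis unfolding sums_def by (rule LIMSEQ_imp_Suc)
qed

section \<open>Potentials\<close>

text \<open>Splitting at the level \<open>M\<close>. With \<open>M\<close> adapted to the situation
  this replaces Hoelder's inequality.\<close>

lemma le_truncation_powr:
  fixes a M p :: real
  assumes "1 < p" "0 < M"
  shows "\<bar>a\<bar> \<le> M + M powr (1 - p) * \<bar>a\<bar> powr p"
proof (cases "\<bar>a\<bar> \<le> M")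
  case False
  then have "\<bar>a\<bar> powr (1 - p) \<le> M powr (1 - p)"
    using assms by (intro powr_mono2') auto
  then have "\<bar>a\<bar> powr (1 - p) * \<bar>a\<bar> powr p \<le> M powr (1 - p) * \<bar>a\<bar> powr p"
    by (intro mult_right_mono) auto
  moreover have "\<bar>a\<bar> powr (1 - p) * \<bar>a\<bar> powr p = \<bar>a\<bar>"
    using False assms by (simp add: powr_add[symmetric])
  ultimately show ?thesis using assms by simp
qed (simp add: add_increasing2)

lemma in_Lp_integrable:
  fixes h :: "real^3 \<Rightarrow> real"
  assumes "in_Lp p h" "1 < p"
  shows "integrable \<sigma> h"
proof (rule Bochner_Integration.integrable_bound)
  show "integrable \<sigma> (\<lambda>x. 1 + \<bar>h x\<bar> powr p)"
    using assms(1) by (simp add: in_Lp_def S.integrable_const)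
  show "AE x in \<sigma>. norm (h x) \<le> norm (1 + \<bar>h x\<bar> powr p)"
    using le_truncation_powr[OF assms(2), of 1] by (intro AE_I2) simp
qed (use assms in \<open>simp add: in_Lp_def\<close>)

text \<open>The exponent \<open>1 / p - 1\<close> is the one Hoelder's inequality would give for the
  conjugate norm of \<open>(x \<bullet> y) ^ n\<close>.\<close>

lemma abs_moment_Lp_le:
  fixes h :: "real^3 \<Rightarrow> real"
  assumes h: "in_Lp p h" and p: "1 < p" and d: "0 < d" "(\<integral>x. \<bar>h x\<bar> powr p \<partial>\<sigma>) \<le> d powr p" and x: "x \<in> S2"
  shows "(\<integral>y. \<bar>x \<bullet> y\<bar> ^ n * \<bar>h y\<bar> \<partial>\<sigma>) \<le> (2 * area + 1) * d * real (n + 1) powr (1 / p - 1)"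
proof -
  \<comment> \<open>This level balances the two contributions \<open>M / (n + 1)\<close> and
    \<open>M powr (1 - p) * d powr p\<close>: both equal
    \<open>d * (n + 1) powr (1 / p - 1)\<close>.\<close>
  define M where "M = real (n + 1) powr (1 / p) * d"
  have M: "0 < M" using d by (simp add: M_def)
  have inth: "integrable \<sigma> h" and inthp: "integrable \<sigma> (\<lambda>x. \<bar>h x\<bar> powr p)"
    using in_Lp_integrable[OF h p] h by (auto simp: in_Lp_def)
  have "(\<integral>y. \<bar>x \<bullet> y\<bar> ^ n * \<bar>h y\<bar> \<partial>\<sigma>) \<le> (\<integral>y. M * \<bar>x \<bullet> y\<bar> ^ n + M powr (1 - p) * \<bar>h y\<bar> powr p \<partial>\<sigma>)"
  proof (rule integral_mono)
    show "integrable \<sigma> (\<lambda>y. \<bar>x \<bullet> y\<bar> ^ n * \<bar>h y\<bar>)"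
      by (intro integrable_\<sigma>_mult_continuous continuous_intros integrable_abs inth)
    show "integrable \<sigma> (\<lambda>y. M * \<bar>x \<bullet> y\<bar> ^ n + M powr (1 - p) * \<bar>h y\<bar> powr p)"
      using integrable_abs_power inthp by (intro Bochner_Integration.integrable_add integrable_mult_right) auto
    fix y assume "y \<in> space \<sigma>"
    then have t: "\<bar>x \<bullet> y\<bar> ^ n \<le> 1" using abs_inner_S2_le[OF x] by (intro power_le_one) auto
    have "\<bar>x \<bullet> y\<bar> ^ n * \<bar>h y\<bar> \<le> \<bar>x \<bullet> y\<bar> ^ n * (M + M powr (1 - p) * \<bar>h y\<bar> powr p)"
      by (intro mult_left_mono le_truncation_powr p M) auto
    also have "\<dots> = M * \<bar>x \<bullet> y\<bar> ^ n + \<bar>x \<bullet> y\<bar> ^ n * (M powr (1 - p) * \<bar>h y\<bar> powr p)"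
      by (simp add: algebra_simps)
    also have "\<dots> \<le> M * \<bar>x \<bullet> y\<bar> ^ n + 1 * (M powr (1 - p) * \<bar>h y\<bar> powr p)"
      using t by (intro add_mono mult_right_mono) auto
    finally show "\<bar>x \<bullet> y\<bar> ^ n * \<bar>h y\<bar> \<le> M * \<bar>x \<bullet> y\<bar> ^ n + M powr (1 - p) * \<bar>h y\<bar> powr p" by simp
  qed
  also have "\<dots> = M * abs_mom n x + M powr (1 - p) * (\<integral>x. \<bar>h x\<bar> powr p \<partial>\<sigma>)"
    using integrable_abs_power[of x n] inthp
    by (subst Bochner_Integration.integral_add) (auto simp: abs_mom_def intro!: integrable_mult_right)
  also have "\<dots> \<le> M * (2 * area / real (n + 1)) + M powr (1 - p) * d powr p"
    using d M abs_mom_le[OF x, of n] by (intro add_mono mult_left_mono) auto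
  also have "M * (2 * area / real (n + 1)) = 2 * area * d * real (n + 1) powr (1 / p - 1)"
    by (simp add: M_def powr_diff)
  also have "M powr (1 - p) * d powr p = d * real (n + 1) powr (1 / p - 1)"
  proof -
    have "M powr (1 - p) = real (n + 1) powr (1 / p * (1 - p)) * d powr (1 - p)"
      unfolding M_def using d by (simp add: powr_mult powr_powr)
    moreover have "1 / p * (1 - p) = 1 / p - 1" using p by (simp add: field_simps)
    moreover have "d powr (1 - p) * d powr p = d" using d by (simp add: powr_add[symmetric])
    ultimately show ?thesis by simp
  qed
  finally show ?thesis by (simp add: algebra_simps)
qed

text \<open>Decay of the term of degree \<open>Suc k\<close> for an \<open>L^p\<close> density: the
  rate of \<open>abs_moment_Lp_le\<close> times the logarithmic weight. The negative exponent
  \<open>1 / p - 1\<close> is what makes it summable.\<close>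

definition green_const :: "real \<Rightarrow> nat \<Rightarrow> real"
  where "green_const p k = real (k + 2) powr (1 / p - 1) / real (Suc k)"

lemma summable_green_const:
  assumes "1 < p"
  shows "summable (green_const p)"
proof (rule summable_comparison_test')
  have "1 / p - 2 < - 1" using assms by (simp add: field_simps)
  then have "summable (\<lambda>n. of_nat n powr (1 / p - 2) :: real)" by (simp add: summable_real_powr_iff)
  then show "summable (\<lambda>k. real (Suc k) powr (1 / p - 2))" by (subst (asm) summable_Suc_iff[symmetric])
  fix k :: nat
  have "1 / p - 1 < 0" using assms by (simp add: field_simps)
  then have "real (k + 2) powr (1 / p - 1) \<le> real (Suc k) powr (1 / p - 1)"
    by (intro powr_mono2') auto
  then have "green_const p k \<le> real (Suc k) powr (1 / p - 1) / real (Suc k)"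
    unfolding green_const_def by (intro divide_right_mono) auto
  also have "\<dots> = real (Suc k) powr (1 / p - 1 - 1)"
    by (subst powr_diff) simp
  finally show "norm (green_const p k) \<le> real (Suc k) powr (1 / p - 2)"
    by (simp add: green_const_def)
qed

text \<open>The potential of \<open>v\<close> in a form that needs neither an exponent nor weak derivatives.\<close>

definition green_potential :: "(real^3 \<Rightarrow> real) \<Rightarrow> (real^3 \<Rightarrow> real) \<Rightarrow> bool"
  where "green_potential v u \<longleftrightarrow> continuous_on S2 u \<and> integrable \<sigma> v \<and>
    (\<forall>x\<in>S2. (\<lambda>k. zmom (Suc k) v x / real (Suc k)) sums (area * u x)) \<and>
    (\<exists>b. summable b \<and> (\<forall>k. \<forall>x\<in>S2. \<bar>zmom (Suc k) v x / real (Suc k)\<bar> \<le> b k))"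

lemma zmom_Lp_le:
  fixes h :: "real^3 \<Rightarrow> real"
  assumes h: "in_Lp p h" and p: "1 < p" and d: "0 < d" "(\<integral>x. \<bar>h x\<bar> powr p \<partial>\<sigma>) \<le> d powr p" and x: "x \<in> S2"
  shows "\<bar>zmom (Suc k) h x / real (Suc k)\<bar> \<le> (2 * area + 1) * d * green_const p k"
proof -
  have "\<bar>zmom (Suc k) h x\<bar> \<le> (2 * area + 1) * d * real (Suc k + 1) powr (1 / p - 1)"
    by (rule order_trans[OF zmom_abs_le[OF in_Lp_integrable[OF h p]] abs_moment_Lp_le[OF assms]])
  then show ?thesis
    by (simp add: green_const_def abs_divide divide_right_mono)
qed

lemma Lp_norm_powr:
  assumes "0 < p"
  shows "Lp_norm p h powr p = (\<integral>x. \<bar>h x\<bar> powr p \<partial>\<sigma>)"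
  using assms by (simp add: Lp_norm_def powr_powr)

lemma Lp_norm_nonneg: "0 \<le> Lp_norm p h"
  by (simp add: Lp_norm_def)

lemma Lp_norm_less_powr:
  assumes "0 < p" "Lp_norm p h < d"
  shows "(\<integral>x. \<bar>h x\<bar> powr p \<partial>\<sigma>) \<le> d powr p"
  unfolding Lp_norm_powr[OF assms(1), symmetric]
  using assms Lp_norm_nonneg[of p h] by (intro powr_mono2) auto

text \<open>The passage from the weak formulation to the series. A solution may carry a different
  exponent \<open>q\<close> at each time; here \<zeta> and all solutions land in one common notion
  and can be subtracted.\<close>

lemma is_G_green_potential:
  assumes "is_G q v u" "1 < q"
  shows "green_potential v u"
proof -
  have v: "in_Lp q v" using assms by (simp add: is_G_def in_Lp0_def)
  \<comment> \<open>The summand 1 keeps \<open>d\<close> positive when \<open>v\<close> vanishes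
    almost everywhere.\<close>
  define d where "d = Lp_norm q v + 1"
  have d: "0 < d" "(\<integral>x. \<bar>v x\<bar> powr q \<partial>\<sigma>) \<le> d powr q"
    using Lp_norm_nonneg[of q v] assms by (auto simp: d_def intro!: Lp_norm_less_powr)
  show ?thesis
    unfolding green_potential_def
  proof (intro conjI ballI)
    show "integrable \<sigma> v" using v assms by (intro in_Lp_integrable)
    then show "(\<lambda>k. zmom (Suc k) v x / real (Suc k)) sums (area * u x)" if "x \<in> S2" for x
      using assms that by (intro green_representation) (auto simp: is_G_def)
    show "\<exists>b. summable b \<and> (\<forall>k. \<forall>x\<in>S2. \<bar>zmom (Suc k) v x / real (Suc k)\<bar> \<le> b k)"
      using zmom_Lp_le[OF v assms(2) d] summable_mult[OF summable_green_const[OF assms(2)]] by blast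
  qed (use assms in \<open>auto simp: is_G_def\<close>)
qed

lemma green_potential_diff:
  assumes "green_potential v u" "green_potential v' u'"
  shows "green_potential (\<lambda>x. v x - v' x) (\<lambda>x. u x - u' x)"
proof -
  obtain b b' where b: "summable b" "\<And>k x. x \<in> S2 \<Longrightarrow> \<bar>zmom (Suc k) v x / real (Suc k)\<bar> \<le> b k"
    and b': "summable b'" "\<And>k x. x \<in> S2 \<Longrightarrow> \<bar>zmom (Suc k) v' x / real (Suc k)\<bar> \<le> b' k"
    using assms unfolding green_potential_def by blast
  have int: "integrable \<sigma> v" "integrable \<sigma> v'" using assms by (auto simp: green_potential_def)
  have eq: "zmom (Suc k) (\<lambda>x. v x - v' x) x / real (Suc k) = zmom (Suc k) v x / real (Suc k) - zmom (Suc k) v' x / real (Suc k)" for k x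
    by (simp add: zmom_diff int diff_divide_distrib)
  show ?thesis
    unfolding green_potential_def eq
  proof (intro conjI ballI)
    show "\<exists>b. summable b \<and> (\<forall>k. \<forall>x\<in>S2. \<bar>zmom (Suc k) v x / real (Suc k) - zmom (Suc k) v' x / real (Suc k)\<bar> \<le> b k)"
      using summable_add[OF b(1) b'(1)] b(2) b'(2)
      by (intro exI[of _ "\<lambda>k. b k + b' k"]) (auto intro!: order_trans[OF abs_triangle_ineq4] add_mono simp del: of_nat_Suc)
    show "(\<lambda>k. zmom (Suc k) v x / real (Suc k) - zmom (Suc k) v' x / real (Suc k)) sums (area * (u x - u' x))" if "x \<in> S2" for x
      unfolding right_diff_distrib using assms that by (intro sums_diff) (auto simp: green_potential_def)
  qed (use assms in \<open>auto simp: green_potential_def intro!: continuous_intros\<close>)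
qed

text \<open>The sup norm of a potential is controlled by the \<open>L^p\<close> norm of its density
  for every \<open>p > 1\<close>. So the initial energy of a perturbation can be estimated with its
  density only in \<open>L^1\<close>.\<close>

lemma green_potential_Lp_bound:
  fixes v :: "real^3 \<Rightarrow> real"
  assumes pot: "green_potential v u" and v: "in_Lp p v" and p: "1 < p"
    and d: "0 < d" "(\<integral>x. \<bar>v x\<bar> powr p \<partial>\<sigma>) \<le> d powr p" and x: "x \<in> S2"
  shows "area * \<bar>u x\<bar> \<le> (2 * area + 1) * d * suminf (green_const p)"
proof -
  have s: "(\<lambda>k. zmom (Suc k) v x / real (Suc k)) sums (area * u x)"
    using pot x by (simp add: green_potential_def)
  note c = summable_mult[OF summable_green_const[OF p], of "(2 * area + 1) * d"]
  note le = zmom_Lp_le[OF v p d x]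
  have s': "summable (\<lambda>k. \<bar>zmom (Suc k) v x / real (Suc k)\<bar>)"
    by (rule summable_comparison_test'[OF c]) (use le in simp)
  have "area * \<bar>u x\<bar> = \<bar>\<Sum>k. zmom (Suc k) v x / real (Suc k)\<bar>"
    unfolding sums_unique[OF s, symmetric] abs_mult using area_pos by simp
  also have "\<dots> \<le> (\<Sum>k. \<bar>zmom (Suc k) v x / real (Suc k)\<bar>)"
    by (rule summable_rabs[OF s'])
  also have "\<dots> \<le> (\<Sum>k. (2 * area + 1) * d * green_const p k)"
    by (rule suminf_le[OF le s' c])
  also have "\<dots> = (2 * area + 1) * d * suminf (green_const p)"
    by (rule suminf_mult[OF summable_green_const[OF p]])
  finally show ?thesis .
qed

lemma sum_abs_majorant:
  fixes f b :: "nat \<Rightarrow> real"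
  assumes "summable b" "\<And>k. \<bar>f k\<bar> \<le> b k"
  shows "\<bar>\<Sum>k<N. f k\<bar> \<le> suminf b"
proof -
  have "\<bar>\<Sum>k<N. f k\<bar> \<le> (\<Sum>k<N. b k)"
    by (rule order_trans[OF sum_abs sum_mono]) (use assms in auto)
  also have "\<dots> \<le> suminf b"
    using assms by (intro sum_le_suminf) (auto intro: order_trans[OF abs_ge_zero])
  finally show ?thesis .
qed

lemma sums_integral_majorized:
  fixes f :: "nat \<Rightarrow> real^3 \<Rightarrow> real"
  assumes c: "\<And>k. continuous_on S2 (f k)" and s: "\<And>x. x \<in> S2 \<Longrightarrow> (\<lambda>k. f k x) sums F x"
    and b: "summable b" "\<And>k x. x \<in> S2 \<Longrightarrow> \<bar>f k x\<bar> \<le> b k" and h: "integrable \<sigma> h"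
  shows "(\<lambda>k. \<integral>x. f k x * h x \<partial>\<sigma>) sums (\<integral>x. F x * h x \<partial>\<sigma>)"
proof -
  have int: "integrable \<sigma> (\<lambda>x. f k x * h x)" for k
    by (intro integrable_\<sigma>_mult_continuous c h)
  have lim: "(\<lambda>N. (\<Sum>k<N. f k x) * h x) \<longlonglongrightarrow> F x * h x" if "x \<in> S2" for x
    using s[OF that] unfolding sums_def by (rule tendsto_mult_right)
  have "(\<lambda>N. \<integral>x. (\<Sum>k<N. f k x) * h x \<partial>\<sigma>) \<longlonglongrightarrow> (\<integral>x. F x * h x \<partial>\<sigma>)"
  proof (rule integral_dominated_convergence[where w="\<lambda>x. suminf b * \<bar>h x\<bar>"])
    have meas: "(\<lambda>x. (\<Sum>k<N. f k x) * h x) \<in> borel_measurable \<sigma>" for N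
      using int by (intro borel_measurable_times borel_measurable_integrable[OF h] borel_measurable_sum
          continuous_on_measurable_\<sigma> c)
    then show "(\<lambda>x. (\<Sum>k<N. f k x) * h x) \<in> borel_measurable \<sigma>" for N .
    show "(\<lambda>x. F x * h x) \<in> borel_measurable \<sigma>"
      by (rule borel_measurable_LIMSEQ_real[OF _ meas]) (use lim in simp)
    show "integrable \<sigma> (\<lambda>x. suminf b * \<bar>h x\<bar>)" using h by simp
    show "AE x in \<sigma>. (\<lambda>N. (\<Sum>k<N. f k x) * h x) \<longlonglongrightarrow> F x * h x"
      using lim by (intro AE_I2) simp
    show "AE x in \<sigma>. norm ((\<Sum>k<N. f k x) * h x) \<le> suminf b * \<bar>h x\<bar>" for N
      using sum_abs_majorant[OF b(1) b(2)] by (intro AE_I2) (simp add: abs_mult mult_right_mono)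
  qed
  moreover have "(\<integral>x. (\<Sum>k<N. f k x) * h x \<partial>\<sigma>) = (\<Sum>k<N. \<integral>x. f k x * h x \<partial>\<sigma>)" for N
    unfolding sum_distrib_right by (rule Bochner_Integration.integral_sum) (rule int)
  ultimately show ?thesis unfolding sums_def by simp
qed

lemma green_potential_pairing:
  assumes "green_potential v u" "integrable \<sigma> h"
  shows "(\<lambda>k. (\<integral>x. h x * zmom (Suc k) v x \<partial>\<sigma>) / real (Suc k)) sums (area * (\<integral>x. u x * h x \<partial>\<sigma>))"
proof -
  obtain b where b: "summable b" "\<And>k x. x \<in> S2 \<Longrightarrow> \<bar>zmom (Suc k) v x / real (Suc k)\<bar> \<le> b k"
    using assms unfolding green_potential_def by blast
  have v: "integrable \<sigma> v" using assms by (simp add: green_potential_def)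
  have "(\<lambda>k. \<integral>x. (zmom (Suc k) v x / real (Suc k)) * h x \<partial>\<sigma>) sums (\<integral>x. (area * u x) * h x \<partial>\<sigma>)"
    using assms b v
    by (intro sums_integral_majorized[where b=b] continuous_intros continuous_on_zmom) (auto simp: green_potential_def)
  moreover have "(\<integral>x. (zmom (Suc k) v x / real (Suc k)) * h x \<partial>\<sigma>) = (\<integral>x. h x * zmom (Suc k) v x \<partial>\<sigma>) / real (Suc k)" for k
    by (simp add: mult.commute del: of_nat_Suc)
  ultimately show ?thesis by (simp add: mult.assoc del: of_nat_Suc)
qed

lemma green_potential_symmetric:
  assumes "green_potential v u" "green_potential v' u'"
  shows "(\<integral>x. u x * v' x \<partial>\<sigma>) = (\<integral>x. u' x * v x \<partial>\<sigma>)"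
proof -
  have int: "integrable \<sigma> v" "integrable \<sigma> v'" using assms by (auto simp: green_potential_def)
  have "area * (\<integral>x. u x * v' x \<partial>\<sigma>) = area * (\<integral>x. u' x * v x \<partial>\<sigma>)"
    using green_potential_pairing[OF assms(1) int(2)] green_potential_pairing[OF assms(2) int(1)]
    unfolding zmom_symmetric[OF int(2,1)] by (rule sums_unique2)
  then show ?thesis using area_pos by simp
qed

text \<open>All terms of the energy series are nonnegative, so each is dominated by the sum: small
  energy forces every moment form to be small.\<close>

lemma green_potential_energy_ge:
  assumes "green_potential v u"
  shows "(\<integral>x. v x * zmom (Suc k) v x \<partial>\<sigma>) \<le> area * real (Suc k) * (\<integral>x. u x * v x \<partial>\<sigma>)"
proof -
  have int: "integrable \<sigma> v" using assms by (auto simp: green_potential_def)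
  note s = green_potential_pairing[OF assms int]
  have "(\<integral>x. v x * zmom (Suc k) v x \<partial>\<sigma>) / real (Suc k) = (\<Sum>j\<in>{k}. (\<integral>x. v x * zmom (Suc j) v x \<partial>\<sigma>) / real (Suc j))"
    by simp
  also have "\<dots> \<le> (\<Sum>j. (\<integral>x. v x * zmom (Suc j) v x \<partial>\<sigma>) / real (Suc j))"
    using zmom_form_nonneg[OF int] by (intro sum_le_suminf sums_summable[OF s]) auto
  also have "\<dots> = area * (\<integral>x. u x * v x \<partial>\<sigma>)" using sums_unique[OF s] by simp
  finally show ?thesis by (simp add: field_simps)
qed

section \<open>Differentiating the series of a potential\<close>

lemma cross3_inner_cycle: "cross3 a b \<bullet> c = a \<bullet> cross3 b c"
  unfolding inner_3 by (simp add: cross3_def algebra_simps)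

lemma cross3_cross3_orthonormal:
  assumes "e \<bullet> x = 0" "norm e = 1"
  shows "cross3 e (cross3 e x) = - x"
proof -
  have e: "e$1 * x$1 + e$2 * x$2 + e$3 * x$3 = 0" "e$1 * e$1 + e$2 * e$2 + e$3 * e$3 = 1"
    using assms by (simp_all add: inner_3[symmetric] dot_square_norm)
  show ?thesis
    unfolding vec_eq_iff forall_3 using e by (simp add: cross3_def) (intro conjI; algebra)
qed

text \<open>The rate for bounded densities: one factor is the weight of the series, the other comes
  from \<open>abs_mom_le\<close> at degree \<open>Suc k\<close>.\<close>

definition quad_const :: "nat \<Rightarrow> real"
  where "quad_const k = 1 / (real (Suc k) * real (k + 2))"

lemma summable_quad_const: "summable quad_const"
proof (rule summable_comparison_test')
  show "summable (\<lambda>k. 1 / real (Suc k) ^ 2)"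
    using inverse_squares_sums by (rule sums_summable[THEN summable_cong[THEN iffD1, rotated]]) simp
  show "norm (quad_const k) \<le> 1 / real (Suc k) ^ 2" for k
    by (simp add: quad_const_def power2_eq_square frac_le)
qed

lemma zmom_bounded_quad:
  assumes "integrable \<sigma> h" "x \<in> S2" "\<And>y. y \<in> S2 \<Longrightarrow> \<bar>h y\<bar> \<le> C"
  shows "\<bar>zmom (Suc k) h x / real (Suc k)\<bar> \<le> 2 * area * C * quad_const k"
proof -
  have "\<bar>zmom (Suc k) h x\<bar> / real (Suc k) \<le> (2 * area * C / real (Suc k + 1)) / real (Suc k)"
    by (intro divide_right_mono zmom_bounded_le assms) auto
  then show ?thesis by (simp add: abs_divide quad_const_def mult.commute del: of_nat_Suc)
qed

lemma continuous_on_S2_bounded: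
  fixes f :: "real^3 \<Rightarrow> 'a::real_normed_vector"
  assumes "continuous_on S2 f"
  obtains C where "0 \<le> C" "\<And>x. x \<in> S2 \<Longrightarrow> norm (f x) \<le> C"
proof -
  have "bounded (f ` S2)"
    using assms by (intro compact_imp_bounded compact_continuous_image) auto
  then obtain C where "\<forall>x\<in>S2. norm (f x) \<le> C" unfolding bounded_iff by auto
  then show thesis using that[of "max 0 C"] by (auto simp: le_max_iff_disj)
qed

text \<open>Estimating \<open>zmom_vec k z\<close> directly yields only order \<open>1 / k\<close>.
  By \<open>zmom_rotation_derivative\<close> the quantity is a moment of degree \<open>Suc k\<close>
  of a rotation derivative of \<open>z\<close>, divided by \<open>Suc k\<close>, and this is
  summable.\<close>

lemma green_potential_gradient_bound:
  assumes "C1_grad z F" "norm e = 1" "x \<in> S2" and C: "\<And>x. x \<in> S2 \<Longrightarrow> norm (F x) \<le> C"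
  shows "\<bar>e \<bullet> cross3 x (zmom_vec k z x)\<bar> \<le> 2 * area * C * quad_const k"
proof -
  have cF: "continuous_on S2 F" using assms(1) by (simp add: C1_grad_def)
  have "\<bar>F y \<bullet> cross3 e y\<bar> \<le> C" if y: "y \<in> S2" for y
  proof -
    have "norm (cross3 e y) \<le> 1"
      using norm_cross_dot[of e y] assms(2) y by (simp add: power_le_one_iff abs_square_le_1[symmetric])
        (metis le_add_same_cancel1 power2_eq_square power_one abs_norm_cancel abs_square_le_1 zero_le_power2)
    then have "norm (F y) * norm (cross3 e y) \<le> C * 1"
      using C[OF y] by (intro mult_mono) (auto intro: order_trans[OF norm_ge_zero])
    then show ?thesis using Cauchy_Schwarz_ineq2[of "F y" "cross3 e y"] by simp
  qed
  then have "\<bar>zmom (Suc k) (\<lambda>y. F y \<bullet> cross3 e y) x / real (Suc k)\<bar> \<le> 2 * area * C * quad_const k"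
    using assms(3) by (intro zmom_bounded_quad integrable_\<sigma>_continuous continuous_intros cF)
  then show ?thesis unfolding zmom_rotation_derivative[OF assms(1)] by simp
qed

text \<open>A potential that is merely differentiable at \<open>x\<close> can be differentiated term by term there: the
  differentiated series along the great circle through \<open>x\<close> with axis \<open>e\<close> converges uniformly, because
  rotating the argument of the kernel amounts to rotating the vorticity.\<close>

lemma green_potential_gradient_unit:
  assumes pot: "green_potential z u" and z: "C1_grad z F" and u: "has_sgrad u x w" and x: "x \<in> S2"
    and e: "norm e = 1" "e \<bullet> x = 0"
  shows "(\<lambda>k. e \<bullet> cross3 x (zmom_vec k z x)) sums (area * (w \<bullet> cross3 e x))"
proof -
  have cF: "continuous_on S2 F" using z by (simp add: C1_grad_def)
  obtain C where C: "\<And>x. x \<in> S2 \<Longrightarrow> norm (F x) \<le> C"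
    using continuous_on_S2_bounded[OF cF] by blast
  have intz: "integrable \<sigma> z" using pot by (simp add: green_potential_def)
  define \<tau> where "\<tau> = cross3 e x"
  have \<tau>: "norm \<tau> = 1" "\<tau> \<bullet> x = 0" "cross3 e \<tau> = - x"
    using norm_cross_dot[of e x] e x cross3_cross3_orthonormal[OF e(2,1)]
    by (simp_all add: \<tau>_def dot_cross_self)
  define c where "c s = cos s *\<^sub>R x + sin s *\<^sub>R \<tau>" for s :: real
  have cS: "c s \<in> S2" for s
    using great_circle_in_S2[OF _ \<tau>(1,2)] x by (simp add: c_def)
  \<comment> \<open>The great circle is the orbit of \<open>x\<close> under rotation about
    \<open>e\<close>, so the same rotation field is tangent to it at every parameter and the bound
    is uniform in \<open>s\<close>.\<close>
  have c': "(c has_vector_derivative cross3 e (c s)) (at s within T)" for s T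
  proof -
    have "cross3 e (c s) = cos s *\<^sub>R \<tau> - sin s *\<^sub>R x"
      unfolding c_def by (simp add: cross_add_right cross_mult_right \<tau>(3)) (simp add: \<tau>_def)
    then show ?thesis unfolding c_def[abs_def] by (simp add: great_circle_vector_derivative)
  qed
  have c0: "c 0 = x" by (simp add: c_def)
  let ?f = "\<lambda>k s. zmom (Suc k) z (c s) / real (Suc k)"
  let ?f' = "\<lambda>k s. e \<bullet> cross3 (c s) (zmom_vec k z (c s))"
  have sum: "(\<lambda>k. ?f k s) sums (area * u (c s))" for s
    using pot cS by (simp add: green_potential_def)
  have der: "(?f k has_real_derivative ?f' k s) (at s)" for k s
  proof -
    have "((\<lambda>s. zmom (Suc k) z (c s)) has_real_derivative (real (Suc k) *\<^sub>R zmom_vec k z (c s)) \<bullet> cross3 e (c s)) (at s)"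
      by (rule has_derivative_along_curve[OF has_derivative_at_withinI[OF has_derivative_zmom_Suc[OF intz]] c'])
         (use cS in auto)
    then have "(?f k has_real_derivative ((real (Suc k) *\<^sub>R zmom_vec k z (c s)) \<bullet> cross3 e (c s)) / real (Suc k)) (at s)"
      by (rule DERIV_cdivide)
    moreover have "((real (Suc k) *\<^sub>R zmom_vec k z (c s)) \<bullet> cross3 e (c s)) / real (Suc k) = ?f' k s"
      by (simp add: cross3_inner_cycle[symmetric] inner_commute)
    ultimately show ?thesis by simp
  qed
  have bound: "norm (?f' k s) \<le> 2 * area * C * quad_const k" for k s
    using green_potential_gradient_bound[OF z e(1) cS C] by simp
  have "uniformly_convergent_on UNIV (\<lambda>n s. \<Sum>i<n. ?f' i s)"
    by (rule Weierstrass_m_test'[OF bound summable_mult[OF summable_quad_const]])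
  then have "((\<lambda>s. \<Sum>k. ?f k s) has_field_derivative (\<Sum>k. ?f' k 0)) (at 0)"
    using der sums_summable[OF sum] by (intro has_field_derivative_series'[of UNIV]) auto
  then have 1: "((\<lambda>s. area * u (c s)) has_real_derivative (\<Sum>k. ?f' k 0)) (at 0)"
    using sums_unique[OF sum] by simp
  have "((\<lambda>s. u (c s)) has_real_derivative w \<bullet> cross3 e (c 0)) (at 0)"
    by (rule has_derivative_along_curve[OF _ c']) (use u cS c0 in \<open>auto simp: has_sgrad_def\<close>)
  then have "((\<lambda>s. area * u (c s)) has_real_derivative area * (w \<bullet> cross3 e (c 0))) (at 0)"
    by (rule DERIV_cmult)
  with 1 have "(\<Sum>k. ?f' k 0) = area * (w \<bullet> cross3 e x)"
    unfolding c0 by (rule DERIV_unique)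
  moreover have "summable (\<lambda>k. ?f' k 0)"
    by (rule summable_comparison_test'[OF summable_mult[OF summable_quad_const, of "2 * area * C"]]) (rule bound)
  ultimately show ?thesis using c0 summable_sums by metis
qed

text \<open>Both sides are linear in \<open>e\<close> and ignore its component along
  \<open>x\<close>, which reduces the claim to unit axes orthogonal to \<open>x\<close>.\<close>

lemma green_potential_gradient:
  assumes pot: "green_potential z u" and z: "C1_grad z F" and u: "has_sgrad u x w" and x: "x \<in> S2"
  shows "(\<lambda>k. e \<bullet> cross3 x (zmom_vec k z x)) sums (area * (w \<bullet> cross3 e x))"
proof -
  define d where "d = e - (e \<bullet> x) *\<^sub>R x"
  have d: "d \<bullet> x = 0" using x by (simp add: d_def inner_diff_left dot_square_norm)
  have e: "e = d + (e \<bullet> x) *\<^sub>R x" by (simp add: d_def)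
  have eq: "e \<bullet> cross3 x v = d \<bullet> cross3 x v" "cross3 e x = cross3 d x" for v
    by (subst e; simp add: inner_add_left dot_cross_self cross_add_left cross_mult_left)+
  show ?thesis
  proof (cases "d = 0")
    case True
    then show ?thesis by (simp add: eq)
  next
    case False
    let ?e = "(1 / norm d) *\<^sub>R d"
    have "(\<lambda>k. ?e \<bullet> cross3 x (zmom_vec k z x)) sums (area * (w \<bullet> cross3 ?e x))"
      by (rule green_potential_gradient_unit[OF pot z u x]) (use False d in auto)
    then have "(\<lambda>k. norm d * (?e \<bullet> cross3 x (zmom_vec k z x))) sums (norm d * (area * (w \<bullet> cross3 ?e x)))"
      by (rule sums_mult)
    then show ?thesis using False by (simp add: eq cross_mult_left mult.left_commute)
  qed
qed

section \<open>Conservation laws\<close>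

text \<open>The vector field is a gradient, so its derivative is symmetric and has zero trace
  against the skew maps \<open>cross3 (axis i 1)\<close>. Geometrically, the transport field
  \<open>cross3 x (zmom_vec k h x)\<close> is incompressible on the sphere.\<close>

lemma zmom_vec_divergence_free:
  assumes h: "integrable \<sigma> h"
  shows "\<exists>D. (\<forall>i. C1_grad (\<lambda>x. zmom_vec k h x $ i) (D i)) \<and>
    (\<forall>x. (\<Sum>i\<in>UNIV. D i x \<bullet> cross3 (axis i 1) x) = 0)"
proof (cases k)
  case 0
  then have "C1_grad (\<lambda>x. zmom_vec k h x $ i) (\<lambda>x. 0)" for i
    by (simp add: zmom_vec_nth zmom_0 C1_grad_const)
  then show ?thesis by (intro exI[of _ "\<lambda>i x. 0"]) simp
next
  case (Suc j)
  let ?D = "\<lambda>i x. real (Suc j) *\<^sub>R zmom_vec j (\<lambda>y. y $ i * h y) x"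
  have "C1_grad (\<lambda>x. zmom_vec k h x $ i) (?D i)" for i
    unfolding zmom_vec_nth Suc by (intro C1_grad_zmom integrable_nth_mult h)
  moreover have "(\<Sum>i\<in>UNIV. ?D i x \<bullet> cross3 (axis i 1) x) = 0" for x
  proof -
    have sym: "zmom j (\<lambda>y. y $ a * (y $ b * h y)) x = zmom j (\<lambda>y. y $ b * (y $ a * h y)) x" for a b
      by (rule zmom_cong) (rule mult.left_commute)
    show ?thesis
      unfolding sum_3 inner_3
      by (simp add: cross3_def axis_def zmom_vec_nth sym[of 2 1] sym[of 3 1] sym[of 3 2])
  qed
  ultimately show ?thesis by (intro exI[of _ ?D] conjI allI)
qed

text \<open>Writes transport as a combination of the three coordinate rotation fields, to which
  \<open>rotation_by_parts\<close> applies.\<close>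

lemma inner_cross3_expand: "b \<bullet> cross3 x v = - (\<Sum>i\<in>UNIV. v $ i * (b \<bullet> cross3 (axis i 1) x))"
  unfolding sum_3 inner_3 by (simp add: cross3_def axis_def algebra_simps)

text \<open>After expansion in rotation fields with coefficients \<open>zmom_vec k h x $ i\<close>,
  integration by parts differentiates \<open>a\<close> and the coefficients; the latter
  contributions cancel because the transport is incompressible.\<close>

lemma transport_antisymmetric:
  assumes a: "C1_grad a A" and b: "C1_grad b B" and h: "integrable \<sigma> h"
  shows "(\<integral>x. a x * (B x \<bullet> cross3 x (zmom_vec k h x)) \<partial>\<sigma>)
      = - (\<integral>x. b x * (A x \<bullet> cross3 x (zmom_vec k h x)) \<partial>\<sigma>)"
proof -
  obtain D where D': "\<forall>i. C1_grad (\<lambda>x. zmom_vec k h x $ i) (D i)"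
    and D0': "\<forall>x. (\<Sum>i\<in>UNIV. D i x \<bullet> cross3 (axis i 1) x) = 0"
    using zmom_vec_divergence_free[OF h, of k] by (elim exE conjE)
  note D = D'[rule_format] and D0 = D0'[rule_format]
  define R where "R i x = cross3 (axis i 1) x" for i and x :: "real^3"
  let ?V = "zmom_vec k h"
  have c: "continuous_on S2 a" "continuous_on S2 A" "continuous_on S2 b" "continuous_on S2 B"
    "continuous_on S2 (D i)" for i
    using a b D[of i] C1_grad_continuous[OF a] C1_grad_continuous[OF b] by (simp_all add: C1_grad_def)
  have cV: "continuous_on S2 ?V" by (rule continuous_on_zmom_vec[OF h])
  have cR: "continuous_on S2 (R i)" for i unfolding R_def by (rule continuous_on_cross3)
  have "(\<integral>x. a x * (B x \<bullet> cross3 x (?V x)) \<partial>\<sigma>)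
      = - (\<integral>x. (\<Sum>i\<in>UNIV. (a x * ?V x $ i) * (B x \<bullet> R i x)) \<partial>\<sigma>)"
    unfolding Bochner_Integration.integral_minus[symmetric]
    by (intro Bochner_Integration.integral_cong refl)
       (simp add: inner_cross3_expand[of _ _ "?V _"] R_def sum_distrib_left mult_ac)
  also have "\<dots> = - (\<Sum>i\<in>UNIV. \<integral>x. (a x * ?V x $ i) * (B x \<bullet> R i x) \<partial>\<sigma>)"
    by (subst Bochner_Integration.integral_sum)
       (auto intro!: integrable_\<sigma>_continuous continuous_intros c cV cR)
  also have "\<dots> = (\<Sum>i\<in>UNIV. \<integral>x. b x * ((?V x $ i *\<^sub>R A x + a x *\<^sub>R D i x) \<bullet> R i x) \<partial>\<sigma>)"
    unfolding R_def using rotation_by_parts[OF C1_grad_mult[OF a D] b] by (simp add: sum_negf)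
  also have "\<dots> = (\<integral>x. (\<Sum>i\<in>UNIV. b x * ((?V x $ i *\<^sub>R A x + a x *\<^sub>R D i x) \<bullet> R i x)) \<partial>\<sigma>)"
    by (rule Bochner_Integration.integral_sum[symmetric])
       (intro integrable_\<sigma>_continuous continuous_intros c cV cR)
  also have "\<dots> = (\<integral>x. - (b x * (A x \<bullet> cross3 x (?V x))) \<partial>\<sigma>)"
  proof (intro Bochner_Integration.integral_cong refl)
    fix x
    have "(\<Sum>i\<in>UNIV. b x * ((?V x $ i *\<^sub>R A x + a x *\<^sub>R D i x) \<bullet> R i x))
      = b x * (\<Sum>i\<in>UNIV. ?V x $ i * (A x \<bullet> R i x)) + b x * a x * (\<Sum>i\<in>UNIV. D i x \<bullet> R i x)"
      by (simp add: inner_add_left distrib_left sum.distrib sum_distrib_left mult_ac)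
    then show "(\<Sum>i\<in>UNIV. b x * ((?V x $ i *\<^sub>R A x + a x *\<^sub>R D i x) \<bullet> R i x)) = - (b x * (A x \<bullet> cross3 x (?V x)))"
      unfolding R_def D0 inner_cross3_expand[of _ _ "?V x"] by simp
  qed
  finally show ?thesis by simp
qed

lemma inner_cross3_rotate: "v \<bullet> cross3 p x = p \<bullet> cross3 x v"
  unfolding inner_3 by (simp add: cross3_def algebra_simps)

text \<open>The operator with kernel \<open>(x \<bullet> y) ^ Suc k\<close> is symmetric and
  commutes with rotation derivatives, while these are antisymmetric. Passing once through all three
  properties shows that the integral equals its own negative.\<close>

lemma angular_momentum_term_zero:
  assumes z: "C1_grad z F"
  shows "(\<integral>x. z x * (P \<bullet> cross3 x (zmom_vec k z x)) \<partial>\<sigma>) = 0"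
proof -
  have c: "continuous_on S2 z" "continuous_on S2 F" using z C1_grad_continuous by (auto simp: C1_grad_def)
  have int: "integrable \<sigma> z" "integrable \<sigma> (\<lambda>y. F y \<bullet> cross3 P y)"
    by (intro integrable_\<sigma>_continuous continuous_intros c)+
  let ?I = "\<integral>x. z x * (P \<bullet> cross3 x (zmom_vec k z x)) \<partial>\<sigma>"
  have "real (Suc k) * ?I = (\<integral>x. z x * zmom (Suc k) (\<lambda>y. F y \<bullet> cross3 P y) x \<partial>\<sigma>)"
    unfolding zmom_rotation_derivative[OF z]
    by (subst Bochner_Integration.integral_mult_right_zero[symmetric])
       (intro Bochner_Integration.integral_cong refl, simp del: of_nat_Suc)
  also have "\<dots> = (\<integral>x. (F x \<bullet> cross3 P x) * zmom (Suc k) z x \<partial>\<sigma>)"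
    by (rule zmom_symmetric[OF int])
  also have "\<dots> = (\<integral>x. zmom (Suc k) z x * (F x \<bullet> cross3 P x) \<partial>\<sigma>)"
    by (simp add: mult.commute)
  also have "\<dots> = - (\<integral>x. z x * ((real (Suc k) *\<^sub>R zmom_vec k z x) \<bullet> cross3 P x) \<partial>\<sigma>)"
    by (rule rotation_by_parts[OF C1_grad_zmom[OF int(1)] z])
  also have "(\<integral>x. z x * ((real (Suc k) *\<^sub>R zmom_vec k z x) \<bullet> cross3 P x) \<partial>\<sigma>) = real (Suc k) * ?I"
    by (subst Bochner_Integration.integral_mult_right_zero[symmetric], intro Bochner_Integration.integral_cong refl)
       (simp add: inner_cross3_rotate[of _ P] cross_mult_right del: of_nat_Suc)
  finally show ?thesis by simp
qed

text \<open>The vorticity equation at one instant; \<open>r\<close> is the time derivative of the vorticity \<open>z\<close>.\<close>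

locale vorticity_rate =
  fixes z u r :: "real^3 \<Rightarrow> real" and F w :: "real^3 \<Rightarrow> real^3"
  assumes z: "C1_grad z F" and pot: "green_potential z u"
    and w: "\<And>x. x \<in> S2 \<Longrightarrow> has_sgrad u x (w x)"
    and r: "\<And>x. x \<in> S2 \<Longrightarrow> r x = w x \<bullet> cross3 (F x) x"
    and r_cont: "continuous_on S2 r"
begin

lemma cz: "continuous_on S2 z" and cF: "continuous_on S2 F" and cu: "continuous_on S2 u"
  and intz: "integrable \<sigma> z"
  using z pot C1_grad_continuous by (auto simp: C1_grad_def green_potential_def)

lemma cV: "continuous_on S2 (zmom_vec k z)"
  by (rule continuous_on_zmom_vec[OF intz])

abbreviation rterm :: "nat \<Rightarrow> real^3 \<Rightarrow> real"
  where "rterm k x \<equiv> F x \<bullet> cross3 x (zmom_vec k z x)"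

text \<open>The axis in \<open>green_potential_gradient\<close> is taken to be the vorticity
  gradient \<open>F x\<close>, which gives the transport term itself as a pointwise series.\<close>

lemma rterm_sums: "x \<in> S2 \<Longrightarrow> (\<lambda>k. rterm k x) sums (area * r x)"
  using green_potential_gradient[OF pot z w, of x "F x"] by (simp add: r)

lemma rterm_bound:
  obtains b where "summable b" "\<And>k x. x \<in> S2 \<Longrightarrow> \<bar>rterm k x\<bar> \<le> b k"
proof -
  obtain C where C: "0 \<le> C" "\<And>x. x \<in> S2 \<Longrightarrow> norm (F x) \<le> C"
    using continuous_on_S2_bounded[OF cF] by blast
  have "\<bar>rterm k x\<bar> \<le> C * (2 * area * C * quad_const k)" if x: "x \<in> S2" for k x
  proof (cases "F x = 0")
    case True
    then show ?thesis using C area_pos by (simp add: quad_const_def)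
  next
    case False
    define e where "e = (1 / norm (F x)) *\<^sub>R F x"
    have e: "norm e = 1" "F x = norm (F x) *\<^sub>R e" using False by (auto simp: e_def)
    have "\<bar>rterm k x\<bar> = norm (F x) * \<bar>e \<bullet> cross3 x (zmom_vec k z x)\<bar>"
      by (subst e(2)) (simp add: abs_mult)
    also have "\<dots> \<le> C * (2 * area * C * quad_const k)"
      using green_potential_gradient_bound[OF z e(1) x C(2)] C x by (intro mult_mono) auto
    finally show ?thesis .
  qed
  then show thesis
    using that[OF summable_mult[OF summable_mult[OF summable_quad_const]]] by blast
qed

lemma crterm: "continuous_on S2 (rterm k)"
  by (intro continuous_intros continuous_on_cross cF cV)

lemma rate_pairing_sums:
  assumes "continuous_on S2 h"
  shows "(\<lambda>k. \<integral>x. h x * rterm k x \<partial>\<sigma>) sums (area * (\<integral>x. h x * r x \<partial>\<sigma>))"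
proof -
  obtain b where b: "summable b" "\<And>k x. x \<in> S2 \<Longrightarrow> \<bar>rterm k x\<bar> \<le> b k" using rterm_bound by blast
  have "(\<lambda>k. \<integral>x. rterm k x * h x \<partial>\<sigma>) sums (\<integral>x. area * r x * h x \<partial>\<sigma>)"
    by (rule sums_integral_majorized[OF crterm rterm_sums b integrable_\<sigma>_continuous[OF assms]])
  moreover have "(\<integral>x. area * r x * h x \<partial>\<sigma>) = area * (\<integral>x. h x * r x \<partial>\<sigma>)"
    unfolding Bochner_Integration.integral_mult_right_zero[symmetric] by (simp only: mult_ac)
  ultimately show ?thesis by (simp only: mult.commute[of "h _"])
qed

lemma rate_pairing_zero:
  assumes "continuous_on S2 h" "\<And>k. (\<integral>x. h x * rterm k x \<partial>\<sigma>) = 0"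
  shows "(\<integral>x. h x * r x \<partial>\<sigma>) = 0"
proof -
  have "(\<lambda>k. 0) sums (area * (\<integral>x. h x * r x \<partial>\<sigma>))"
    using rate_pairing_sums[OF assms(1)] by (simp add: assms(2))
  then have "area * (\<integral>x. h x * r x \<partial>\<sigma>) = 0" using sums_unique by fastforce
  then show ?thesis using area_pos by simp
qed

text \<open>Multiplying the transport of \<open>z\<close> by \<open>f' (z x)\<close> gives the
  transport of \<open>f (z x)\<close>, and transport integrates to 0 against the constant 1.\<close>

lemma casimir_rate:
  assumes "\<And>s. (f has_real_derivative f' s) (at s)" "continuous_on UNIV f'"
  shows "(\<integral>x. f' (z x) * r x \<partial>\<sigma>) = 0"
proof (rule rate_pairing_zero)
  show "continuous_on S2 (\<lambda>x. f' (z x))"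
    by (rule continuous_on_compose2[OF assms(2) cz]) simp
  show "(\<integral>x. f' (z x) * rterm k x \<partial>\<sigma>) = 0" for k
    using transport_antisymmetric[OF C1_grad_const[of 1] C1_grad_compose[OF z assms] intz, of k] by simp
qed

lemma momentum_rate: "(\<integral>x. (P \<bullet> x) * r x \<partial>\<sigma>) = 0"
proof (rule rate_pairing_zero)
  show "(\<integral>x. (P \<bullet> x) * rterm k x \<partial>\<sigma>) = 0" for k
    using transport_antisymmetric[OF C1_grad_inner z intz, of P k] angular_momentum_term_zero[OF z, of P k]
    by simp
qed (intro continuous_intros)

text \<open>The potential \<open>u\<close> has a gradient at each point, but its continuity is not
  known, so \<open>transport_antisymmetric\<close> cannot be used with \<open>u\<close> itself.
  Truncating the potential and the transport at the same degree gives a triple product in which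
  \<open>A N x\<close> occurs twice, hence exactly 0 for each \<open>N\<close>; the limit is taken
  by domination.\<close>

lemma energy_rate: "(\<integral>x. u x * r x \<partial>\<sigma>) = 0"
proof -
  obtain b where b: "summable b" "\<And>k x. x \<in> S2 \<Longrightarrow> \<bar>rterm k x\<bar> \<le> b k" using rterm_bound by blast
  obtain b' where b': "summable b'" "\<And>k x. x \<in> S2 \<Longrightarrow> \<bar>zmom (Suc k) z x / real (Suc k)\<bar> \<le> b' k"
    using pot unfolding green_potential_def by blast
  define U where "U N x = (\<Sum>k<N. 1 / real (Suc k) * zmom (Suc k) z x)" for N x
  define A where "A N x = (\<Sum>k<N. zmom_vec k z x)" for N x
  define R where "R N x = (\<Sum>k<N. rterm k x)" for N x
  have U: "C1_grad (U N) (A N)" for N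
  proof -
    have "C1_grad (\<lambda>x. \<Sum>k<N. 1 / real (Suc k) * zmom (Suc k) z x)
      (\<lambda>x. \<Sum>k<N. (1 / real (Suc k)) *\<^sub>R (real (Suc k) *\<^sub>R zmom_vec k z x))"
      by (intro C1_grad_sum C1_grad_cmult C1_grad_zmom intz)
    then show ?thesis unfolding U_def[abs_def] A_def[abs_def] by simp
  qed
  have cR: "continuous_on S2 (R N)" and cA: "continuous_on S2 (A N)" for N
    unfolding R_def A_def by (intro continuous_intros crterm cV)+
  have cU: "continuous_on S2 (U N)" for N using U by (rule C1_grad_continuous)
  have cross_sum: "(\<Sum>k<N. v \<bullet> cross3 x (zmom_vec k z x)) = v \<bullet> cross3 x (A N x)" for v x N
    unfolding A_def inner_sum_right[symmetric]
    by (induction N) (simp_all add: cross_add_right inner_add_right)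
  have zero: "(\<integral>x. U N x * R N x \<partial>\<sigma>) = 0" for N
  proof -
    have "(\<integral>x. U N x * R N x \<partial>\<sigma>) = (\<Sum>k<N. \<integral>x. U N x * rterm k x \<partial>\<sigma>)"
      unfolding R_def sum_distrib_left
      by (rule Bochner_Integration.integral_sum) (intro integrable_\<sigma>_continuous continuous_intros crterm cU)
    also have "\<dots> = - (\<Sum>k<N. \<integral>x. z x * (A N x \<bullet> cross3 x (zmom_vec k z x)) \<partial>\<sigma>)"
      using transport_antisymmetric[OF U z intz] by (simp add: sum_negf)
    also have "(\<Sum>k<N. \<integral>x. z x * (A N x \<bullet> cross3 x (zmom_vec k z x)) \<partial>\<sigma>)
        = (\<integral>x. (\<Sum>k<N. z x * (A N x \<bullet> cross3 x (zmom_vec k z x))) \<partial>\<sigma>)"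
      by (rule Bochner_Integration.integral_sum[symmetric])
         (intro integrable_\<sigma>_continuous continuous_intros continuous_on_cross cz cA cV)
    also have "\<dots> = 0"
      unfolding sum_distrib_left[symmetric] cross_sum by (simp add: dot_cross_self)
    finally show ?thesis by simp
  qed
  have "(\<lambda>N. \<integral>x. U N x * R N x \<partial>\<sigma>) \<longlonglongrightarrow> (\<integral>x. (area * u x) * (area * r x) \<partial>\<sigma>)"
  proof (rule integral_dominated_convergence[where w="\<lambda>x. suminf b' * suminf b"])
    show "(\<lambda>x. (area * u x) * (area * r x)) \<in> borel_measurable \<sigma>"
      by (intro continuous_on_measurable_\<sigma> continuous_intros cu r_cont)
    show "(\<lambda>x. U N x * R N x) \<in> borel_measurable \<sigma>" for N
      by (intro continuous_on_measurable_\<sigma> continuous_intros cU cR)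
    show "AE x in \<sigma>. (\<lambda>N. U N x * R N x) \<longlonglongrightarrow> (area * u x) * (area * r x)"
    proof (rule AE_I2)
      fix x assume "x \<in> space \<sigma>"
      then have x: "x \<in> S2" by simp
      have "(\<lambda>N. R N x) \<longlonglongrightarrow> area * r x"
        using rterm_sums[OF x] by (simp add: sums_def R_def)
      moreover have "(\<lambda>N. U N x) \<longlonglongrightarrow> area * u x"
        using pot x by (simp add: green_potential_def sums_def U_def)
      ultimately show "(\<lambda>N. U N x * R N x) \<longlonglongrightarrow> (area * u x) * (area * r x)"
        by (intro tendsto_mult)
    qed
    show "AE x in \<sigma>. norm (U N x * R N x) \<le> suminf b' * suminf b" for N
    proof (rule AE_I2)
      fix x assume "x \<in> space \<sigma>"
      then have x: "x \<in> S2" by simp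
      have "\<bar>U N x\<bar> \<le> suminf b'"
        unfolding U_def using b'(2)[OF x] by (intro sum_abs_majorant[OF b'(1)]) simp
      moreover have "\<bar>R N x\<bar> \<le> suminf b"
        unfolding R_def using b(2)[OF x] by (intro sum_abs_majorant[OF b(1)])
      ultimately show "norm (U N x * R N x) \<le> suminf b' * suminf b"
        by (simp add: abs_mult mult_mono)
    qed
  qed (rule S.integrable_const)
  then have "(\<integral>x. (area * u x) * (area * r x) \<partial>\<sigma>) = 0"
    unfolding zero by (simp add: LIMSEQ_const_iff)
  moreover have "(\<integral>x. (area * u x) * (area * r x) \<partial>\<sigma>) = area * area * (\<integral>x. u x * r x \<partial>\<sigma>)"
    unfolding Bochner_Integration.integral_mult_right_zero[symmetric] by (simp only: mult_ac)
  ultimately have "area * area * (\<integral>x. u x * r x \<partial>\<sigma>) = 0" by simp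
  then show ?thesis using area_pos by simp
qed

end

section \<open>Conserved quantities of a smooth solution\<close>

lemma has_real_derivative_integral_\<sigma>:
  fixes \<Phi> :: "real \<Rightarrow> real^3 \<Rightarrow> real"
  assumes d: "\<And>t x. x \<in> S2 \<Longrightarrow> ((\<lambda>s. \<Phi> s x) has_real_derivative \<Phi>' t x) (at t)"
    and c': "continuous_on (UNIV \<times> S2) (\<lambda>(t, x). \<Phi>' t x)" and c: "\<And>t. continuous_on S2 (\<Phi> t)"
  shows "((\<lambda>t. \<integral>x. \<Phi> t x \<partial>\<sigma>) has_real_derivative (\<integral>x. \<Phi>' t x \<partial>\<sigma>)) (at t)"
proof -
  let ?s = spherical_coords
  have cp: "continuous_on (UNIV \<times> coord_box) (\<lambda>(t, z). sin (fst z) * \<Phi>' t (?s z))"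
  proof -
    have "continuous_on (UNIV \<times> coord_box) (\<lambda>z. (fst z, ?s (snd z)))"
      by (intro continuous_intros continuous_on_compose2[OF continuous_on_spherical_coords[of UNIV]]) auto
    then have "continuous_on (UNIV \<times> coord_box) (\<lambda>z. (\<lambda>(t, x). \<Phi>' t x) (fst z, ?s (snd z)))"
      by (rule continuous_on_compose2[OF c']) auto
    then have "continuous_on (UNIV \<times> coord_box) (\<lambda>z. sin (fst (snd z)) * \<Phi>' (fst z) (?s (snd z)))"
      by (intro continuous_intros) simp
    then show ?thesis by (simp add: case_prod_unfold)
  qed
  have c't: "continuous_on S2 (\<Phi>' t)" for t
  proof -
    have "continuous_on S2 (\<lambda>x. (\<lambda>(t, x). \<Phi>' t x) (t, x))"
      by (rule continuous_on_compose2[OF c']) (auto intro!: continuous_intros)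
    then show ?thesis by simp
  qed
  have "((\<lambda>t. integral coord_box (\<lambda>z. sin (fst z) * \<Phi> t (?s z))) has_field_derivative
      integral coord_box (\<lambda>z. sin (fst z) * \<Phi>' t (?s z))) (at t within UNIV)"
  proof (rule leibniz_rule_field_derivative[OF _ _ cp])
    show "((\<lambda>t. sin (fst z) * \<Phi> t (?s z)) has_field_derivative sin (fst z) * \<Phi>' t (?s z)) (at t within UNIV)" for t z
      by (intro DERIV_cmult) (simp add: d)
    show "(\<lambda>z. sin (fst z) * \<Phi> t (?s z)) integrable_on coord_box" for t
      by (intro integrable_continuous continuous_intros continuous_on_compose2[OF c continuous_on_spherical_coords]) auto
  qed auto
  then show ?thesis
    by (simp add: integral_\<sigma>_continuous[OF c] integral_\<sigma>_continuous[OF c't])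
qed

lemma has_real_derivative_zero_quadratic:
  fixes R :: "real \<Rightarrow> real"
  assumes "\<And>s. \<bar>s - t\<bar> \<le> 1 \<Longrightarrow> \<bar>R s\<bar> \<le> K * \<bar>s - t\<bar> ^ 2"
  shows "(R has_real_derivative 0) (at t)"
proof -
  have R0: "R t = 0" using assms[of t] by simp
  have lim: "((\<lambda>s. K * \<bar>s - t\<bar>) \<longlongrightarrow> 0) (at t)"
    by (rule tendsto_eq_intros refl | simp)+
  have "((\<lambda>s. (R s - R t) / (s - t)) \<longlongrightarrow> 0) (at t)"
  proof (rule Lim_null_comparison[OF _ lim])
    have "\<forall>\<^sub>F s in at t. dist s t < 1 \<and> s \<noteq> t"
      by (intro eventually_conj eventually_at_ball'[where A="UNIV", simplified] )
         (auto simp: eventually_at intro!: exI[of _ 1])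
    then show "\<forall>\<^sub>F s in at t. norm ((R s - R t) / (s - t)) \<le> K * \<bar>s - t\<bar>"
    proof eventually_elim
      case (elim s)
      then have "\<bar>R s\<bar> \<le> K * \<bar>s - t\<bar> * \<bar>s - t\<bar>" using assms[of s] by (simp add: dist_real_def power2_eq_square)
      then have "\<bar>R s\<bar> / \<bar>s - t\<bar> \<le> K * \<bar>s - t\<bar> * \<bar>s - t\<bar> / \<bar>s - t\<bar>"
        by (rule divide_right_mono) simp
      then show ?case using elim R0 by (simp add: abs_divide)
    qed
  qed
  then show ?thesis by (simp add: has_field_derivative_iff)
qed

text \<open>Linear control in the sup norm; for the energy this makes the remainder quadratic in the
  time increment.\<close>

lemma green_potential_sup_bound:
  assumes pot: "green_potential v u" and C: "\<And>y. y \<in> S2 \<Longrightarrow> \<bar>v y\<bar> \<le> C" and x: "x \<in> S2"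
  shows "\<bar>u x\<bar> \<le> 2 * C * suminf quad_const"
proof -
  have s: "(\<lambda>k. zmom (Suc k) v x / real (Suc k)) sums (area * u x)" and int: "integrable \<sigma> v"
    using pot x by (simp_all add: green_potential_def)
  note c = summable_mult[OF summable_quad_const, of "2 * area * C"]
  have "\<bar>\<Sum>k<N. zmom (Suc k) v x / real (Suc k)\<bar> \<le> (\<Sum>k. 2 * area * C * quad_const k)" for N
    by (rule sum_abs_majorant[OF c zmom_bounded_quad[OF int x C]])
  then have "\<bar>area * u x\<bar> \<le> (\<Sum>k. 2 * area * C * quad_const k)"
    using s unfolding sums_def by (intro LIMSEQ_le_const2[OF tendsto_rabs]) auto
  also have "(\<Sum>k. 2 * area * C * quad_const k) = 2 * area * C * suminf quad_const"
    by (rule suminf_mult[OF summable_quad_const])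
  finally have "area * \<bar>u x\<bar> \<le> area * (2 * C * suminf quad_const)"
    using area_pos by (simp add: abs_mult mult_ac)
  then show ?thesis using area_pos by (simp only: mult_le_cancel_left_pos)
qed

text \<open>What is kept of a smooth solution: one continuous derivative of the vorticity in time
  and space. About the dependence of the potential on time nothing is assumed.\<close>

locale smooth_flow =
  fixes Z \<psi> Zt :: "real \<Rightarrow> real^3 \<Rightarrow> real" and Zx w :: "real \<Rightarrow> real^3 \<Rightarrow> real^3"
  assumes Zt: "\<And>t x. x \<in> S2 \<Longrightarrow> ((\<lambda>s. Z s x) has_real_derivative Zt t x) (at t)"
    and Zx: "\<And>t. C1_grad (Z t) (Zx t)"
    and Z_cont: "continuous_on (UNIV \<times> S2) (\<lambda>(t, x). Z t x)"
    and Zt_cont: "continuous_on (UNIV \<times> S2) (\<lambda>(t, x). Zt t x)"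
    and pot: "\<And>t. green_potential (Z t) (\<psi> t)"
    and w: "\<And>t x. x \<in> S2 \<Longrightarrow> has_sgrad (\<psi> t) x (w t x)"
    and euler: "\<And>t x. x \<in> S2 \<Longrightarrow> Zt t x = w t x \<bullet> cross3 (Zx t x) x"
begin

lemma Zt_cont_slice: "continuous_on S2 (Zt t)"
proof -
  have "continuous_on S2 (\<lambda>x. (\<lambda>(t, x). Zt t x) (t, x))"
    by (rule continuous_on_compose2[OF Zt_cont]) (auto intro!: continuous_intros)
  then show ?thesis by simp
qed

lemma Z_cont_slice: "continuous_on S2 (Z t)"
  using Zx by (rule C1_grad_continuous)

lemma psi_cont: "continuous_on S2 (\<psi> t)"
  using pot[of t] by (simp add: green_potential_def)

lemma rate: "vorticity_rate (Z t) (\<psi> t) (Zt t) (Zx t) (w t)"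
  using Zx pot w euler Zt_cont_slice by unfold_locales auto

lemma casimir_conserved_smooth:
  assumes f: "\<And>s. (f has_real_derivative f' s) (at s)" and f': "continuous_on UNIV f'"
  shows "(\<integral>x. f (Z t x) \<partial>\<sigma>) = (\<integral>x. f (Z s x) \<partial>\<sigma>)"
proof -
  have "((\<lambda>t. \<integral>x. f (Z t x) \<partial>\<sigma>) has_real_derivative (\<integral>x. f' (Z t x) * Zt t x \<partial>\<sigma>)) (at t)" for t
  proof (rule has_real_derivative_integral_\<sigma>)
    show "((\<lambda>s. f (Z s x)) has_real_derivative f' (Z t x) * Zt t x) (at t)" if "x \<in> S2" for t x
      by (rule DERIV_chain2[OF f Zt[OF that]])
    have "continuous_on (UNIV \<times> S2) (\<lambda>z. f' ((\<lambda>(t, x). Z t x) z) * (\<lambda>(t, x). Zt t x) z)"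
      by (intro continuous_intros continuous_on_compose2[OF f' Z_cont] Zt_cont) auto
    then show "continuous_on (UNIV \<times> S2) (\<lambda>(t, x). f' (Z t x) * Zt t x)"
      by (simp add: case_prod_unfold)
    have "continuous_on UNIV f" using f DERIV_continuous_on by blast
    then show "continuous_on S2 (\<lambda>x. f (Z t x))" for t
      by (rule continuous_on_compose2[OF _ Z_cont_slice]) auto
  qed
  then have "\<forall>t. ((\<lambda>t. \<integral>x. f (Z t x) \<partial>\<sigma>) has_real_derivative 0) (at t)"
    using vorticity_rate.casimir_rate[OF rate f f'] by simp
  then show ?thesis by (rule DERIV_isconst_all)
qed

text \<open>The functions needed later (truncations, their residual powers, the convex
  \<open>F\<close>) are merely continuous. At two fixed times the vorticity takes values in a
  compact interval, where polynomials approximate uniformly.\<close>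

lemma casimir_conserved:
  fixes f :: "real \<Rightarrow> real"
  assumes f: "continuous_on UNIV f"
  shows "(\<integral>x. f (Z t x) \<partial>\<sigma>) = (\<integral>x. f (Z s x) \<partial>\<sigma>)"
proof -
  obtain Ct where Ct: "\<And>x. x \<in> S2 \<Longrightarrow> norm (Z t x) \<le> Ct"
    using continuous_on_S2_bounded[OF Z_cont_slice] by blast
  obtain Cs where Cs: "\<And>x. x \<in> S2 \<Longrightarrow> norm (Z s x) \<le> Cs"
    using continuous_on_S2_bounded[OF Z_cont_slice] by blast
  define C where "C = max Ct Cs"
  have C: "x \<in> S2 \<Longrightarrow> Z t x \<in> {-C..C}" "x \<in> S2 \<Longrightarrow> Z s x \<in> {-C..C}" for x
    using Ct[of x] Cs[of x] by (auto simp: C_def abs_le_iff)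
  have "\<bar>(\<integral>x. f (Z t x) \<partial>\<sigma>) - (\<integral>x. f (Z s x) \<partial>\<sigma>)\<bar> \<le> e" if e: "0 < e" for e
  proof -
    define e' where "e' = e / (2 * area)"
    have e': "0 < e'" using e area_pos by (simp add: e'_def)
    obtain q where q: "real_polynomial_function q" "\<And>x. x \<in> {-C..C} \<Longrightarrow> \<bar>f x - q x\<bar> < e'"
      using Stone_Weierstrass_real_polynomial_function[of "{-C..C}" f e'] e' continuous_on_subset[OF f] by auto
    obtain q' where q': "real_polynomial_function q'" "\<And>x. (q has_real_derivative q' x) (at x)"
      using has_real_derivative_polynomial_function[OF q(1)] by blast
    have cq: "continuous_on UNIV q" "continuous_on UNIV q'"
      using q(1) q'(1) by (simp_all add: continuous_on_polymonial_function real_polynomial_function_eq)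
    have close: "\<bar>(\<integral>x. f (Z r x) \<partial>\<sigma>) - (\<integral>x. q (Z r x) \<partial>\<sigma>)\<bar> \<le> e / 2" if r: "\<And>x. x \<in> S2 \<Longrightarrow> Z r x \<in> {-C..C}" for r
    proof -
      have int: "integrable \<sigma> (\<lambda>x. f (Z r x))" "integrable \<sigma> (\<lambda>x. q (Z r x))"
        by (intro integrable_\<sigma>_continuous continuous_on_compose2[OF f Z_cont_slice]
            continuous_on_compose2[OF cq(1) Z_cont_slice]; simp)+
      have "\<bar>\<integral>x. f (Z r x) - q (Z r x) \<partial>\<sigma>\<bar> \<le> (\<integral>x. \<bar>f (Z r x) - q (Z r x)\<bar> \<partial>\<sigma>)"
        by (rule integral_abs_bound)
      also have "\<dots> \<le> (\<integral>x. e' \<partial>\<sigma>)"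
        by (rule integral_mono) (use int q(2) r in \<open>auto intro!: less_imp_le\<close>)
      also have "\<dots> = e / 2" using area_pos by (simp add: e'_def)
      finally show ?thesis using int by simp
    qed
    show ?thesis
      using close[OF C(1)] close[OF C(2)] casimir_conserved_smooth[OF q'(2) cq(2), of t s] by linarith
  qed
  then have "\<bar>(\<integral>x. f (Z t x) \<partial>\<sigma>) - (\<integral>x. f (Z s x) \<partial>\<sigma>)\<bar> \<le> 0"
    by (rule field_le_epsilon[of _ 0, simplified])
  then show ?thesis by simp
qed

lemma integral_mult_rate:
  assumes h: "continuous_on S2 h"
  shows "((\<lambda>t. \<integral>x. h x * Z t x \<partial>\<sigma>) has_real_derivative (\<integral>x. h x * Zt t x \<partial>\<sigma>)) (at t)"
proof (rule has_real_derivative_integral_\<sigma>)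
  show "((\<lambda>s. h x * Z s x) has_real_derivative h x * Zt t x) (at t)" if "x \<in> S2" for t x
    by (rule DERIV_cmult[OF Zt[OF that]])
  have "continuous_on (UNIV \<times> S2) (\<lambda>z. h (snd z) * (\<lambda>(t, x). Zt t x) z)"
    by (intro continuous_intros continuous_on_compose2[OF h] Zt_cont) auto
  then show "continuous_on (UNIV \<times> S2) (\<lambda>(t, x). h x * Zt t x)"
    by (simp add: case_prod_unfold)
qed (intro continuous_intros h Z_cont_slice)

lemma momentum_conserved: "(\<integral>x. (P \<bullet> x) * Z t x \<partial>\<sigma>) = (\<integral>x. (P \<bullet> x) * Z s x \<partial>\<sigma>)"
proof -
  have "\<forall>t. ((\<lambda>t. \<integral>x. (P \<bullet> x) * Z t x \<partial>\<sigma>) has_real_derivative 0) (at t)"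
    using integral_mult_rate[of "\<lambda>x. P \<bullet> x"] vorticity_rate.momentum_rate[OF rate, of P]
    by (simp add: continuous_on_inner)
  then show ?thesis by (rule DERIV_isconst_all)
qed

lemma energy_has_derivative_0: "((\<lambda>t. \<integral>x. \<psi> t x * Z t x \<partial>\<sigma>) has_real_derivative 0) (at t)"
proof -
  define L where "L s = (\<integral>x. \<psi> t x * Z s x \<partial>\<sigma>)" for s
  define R where "R s = (\<integral>x. (\<psi> s x - \<psi> t x) * (Z s x - Z t x) \<partial>\<sigma>)" for s
  have int: "integrable \<sigma> (\<lambda>x. \<psi> a x * Z b x)" for a b
    by (intro integrable_\<sigma>_continuous continuous_intros psi_cont Z_cont_slice)
  have sym: "(\<integral>x. \<psi> s x * Z t x \<partial>\<sigma>) = L s" for s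
    unfolding L_def by (rule green_potential_symmetric[OF pot pot])
  have E: "(\<integral>x. \<psi> s x * Z s x \<partial>\<sigma>) = 2 * L s - L t + R s" for s
  proof -
    have "R s = (\<integral>x. \<psi> s x * Z s x - \<psi> s x * Z t x - \<psi> t x * Z s x + \<psi> t x * Z t x \<partial>\<sigma>)"
      unfolding R_def by (simp add: algebra_simps)
    also have "\<dots> = (\<integral>x. \<psi> s x * Z s x \<partial>\<sigma>) - (\<integral>x. \<psi> s x * Z t x \<partial>\<sigma>) - (\<integral>x. \<psi> t x * Z s x \<partial>\<sigma>)
        + (\<integral>x. \<psi> t x * Z t x \<partial>\<sigma>)"
      using int by simp
    also have "\<dots> = (\<integral>x. \<psi> s x * Z s x \<partial>\<sigma>) - L s - L s + L t"
      by (simp only: sym L_def[symmetric])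
    finally show ?thesis by simp
  qed
  have "compact ({t - 1..t + 1} \<times> S2)" by (intro compact_Times) auto
  then have "compact ((\<lambda>(t, x). Zt t x) ` ({t - 1..t + 1} \<times> S2))"
    by (intro compact_continuous_image continuous_on_subset[OF Zt_cont]) auto
  then have "bounded ((\<lambda>(t, x). Zt t x) ` ({t - 1..t + 1} \<times> S2))"
    by (rule compact_imp_bounded)
  then obtain K where K': "\<forall>y\<in>(\<lambda>(t, x). Zt t x) ` ({t - 1..t + 1} \<times> S2). norm y \<le> K"
    unfolding bounded_iff by (elim exE)
  have K: "\<bar>Zt s x\<bar> \<le> K" if "s \<in> {t - 1..t + 1}" "x \<in> S2" for s x
    using K'[rule_format, OF imageI[OF SigmaI[OF that]]] by simp
  have Lip: "\<bar>Z s x - Z t x\<bar> \<le> K * \<bar>s - t\<bar>" if s: "\<bar>s - t\<bar> \<le> 1" and x: "x \<in> S2" for s x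
  proof -
    have "norm (Z s x - Z t x) \<le> K * norm (s - t)"
    proof (rule field_differentiable_bound[of "{t - 1..t + 1}"])
      show "((\<lambda>s. Z s x) has_field_derivative Zt r x) (at r within {t - 1..t + 1})" for r
        using Zt[OF x] by (rule has_field_derivative_at_within)
    qed (use K x s in auto)
    then show ?thesis by simp
  qed
  have "\<bar>R s\<bar> \<le> (area * (2 * K * suminf quad_const) * K) * \<bar>s - t\<bar> ^ 2" if s: "\<bar>s - t\<bar> \<le> 1" for s
  proof -
    have "\<bar>R s\<bar> \<le> (\<integral>x. \<bar>(\<psi> s x - \<psi> t x) * (Z s x - Z t x)\<bar> \<partial>\<sigma>)"
      unfolding R_def by (rule integral_abs_bound)
    also have "\<dots> \<le> (\<integral>x. (2 * (K * \<bar>s - t\<bar>) * suminf quad_const) * (K * \<bar>s - t\<bar>) \<partial>\<sigma>)"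
    proof (rule integral_mono)
      show "integrable \<sigma> (\<lambda>x. \<bar>(\<psi> s x - \<psi> t x) * (Z s x - Z t x)\<bar>)"
        by (intro integrable_\<sigma>_continuous continuous_intros psi_cont Z_cont_slice)
      fix x assume "x \<in> space \<sigma>"
      then have x: "x \<in> S2" by simp
      have \<psi>: "\<bar>\<psi> s x - \<psi> t x\<bar> \<le> 2 * (K * \<bar>s - t\<bar>) * suminf quad_const"
        by (rule green_potential_sup_bound[OF green_potential_diff[OF pot pot] Lip[OF s] x])
      show "\<bar>(\<psi> s x - \<psi> t x) * (Z s x - Z t x)\<bar> \<le> (2 * (K * \<bar>s - t\<bar>) * suminf quad_const) * (K * \<bar>s - t\<bar>)"
        unfolding abs_mult
        by (rule mult_mono[OF \<psi> Lip[OF s x] order_trans[OF abs_ge_zero \<psi>] abs_ge_zero])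
    qed simp
    also have "\<dots> = (area * (2 * K * suminf quad_const) * K) * \<bar>s - t\<bar> ^ 2"
      unfolding power2_eq_square by (simp only: lebesgue_integral_const space_\<sigma> real_scaleR_def mult_ac)
    finally show ?thesis .
  qed
  then have R: "(R has_real_derivative 0) (at t)" by (rule has_real_derivative_zero_quadratic)
  have "(L has_real_derivative 0) (at t)"
    unfolding L_def using integral_mult_rate[OF psi_cont, of t t] vorticity_rate.energy_rate[OF rate, of t] by simp
  then have "((\<lambda>s. 2 * L s - L t + R s) has_real_derivative (2 * 0 - 0 + 0)) (at t)"
    by (intro DERIV_add DERIV_diff DERIV_cmult DERIV_const R)
  then show ?thesis unfolding E by simp
qed

lemma energy_conserved: "(\<integral>x. \<psi> t x * Z t x \<partial>\<sigma>) = (\<integral>x. \<psi> s x * Z s x \<partial>\<sigma>)"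
  using energy_has_derivative_0 by (intro DERIV_isconst_all) auto

end

lemma smooth_euler_solution_flow:
  assumes "smooth_euler_solution Z"
  obtains \<psi> Zt Zx w where "smooth_flow Z \<psi> Zt Zx w"
proof -
  have smooth: "smooth_on (UNIV \<times> S2) (\<lambda>(t, x). Z t x)"
    using assms by (simp add: smooth_euler_solution_def)
  obtain \<psi> where G: "\<And>t. \<exists>q>1. is_G q (Z t) (\<psi> t)"
    and eu: "\<And>t x. x \<in> S2 \<Longrightarrow> (\<exists>w. has_sgrad (\<psi> t) x w) \<and>
        deriv (\<lambda>s. Z s x) t + sgrad_perp (\<psi> t) x \<bullet> sgrad (Z t) x = 0"
    using assms unfolding smooth_euler_solution_def by blast
  have "Ck_on (Suc 0) (UNIV \<times> S2) (\<lambda>(t, x). Z t x)" using smooth unfolding smooth_on_def by blast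
  then obtain F where F': "\<forall>z\<in>UNIV \<times> S2. ((\<lambda>(t, x). Z t x) has_derivative (\<lambda>h. F z \<bullet> h)) (at z within UNIV \<times> S2)"
    and cFb: "\<forall>b\<in>Basis. continuous_on (UNIV \<times> S2) (\<lambda>z. F z \<bullet> b)"
    unfolding Ck_on.simps by (elim exE conjE)
  note F = F'[rule_format]
  have cF: "continuous_on (UNIV \<times> S2) F"
    using cFb by (subst continuous_on_componentwise) blast
  define Zt where "Zt t x = fst (F (t, x))" for t x
  define Zx where "Zx t x = snd (F (t, x))" for t x
  define w where "w t x = sgrad (\<psi> t) x" for t x
  have Zt: "((\<lambda>s. Z s x) has_real_derivative Zt t x) (at t)" if x: "x \<in> S2" for t x
  proof -
    have "((\<lambda>s. (s, x)) has_derivative (\<lambda>h. (h, 0))) (at t within UNIV)"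
      by (auto intro!: derivative_eq_intros)
    then have "((\<lambda>s. (\<lambda>(t, x). Z t x) (s, x)) has_derivative (\<lambda>h. F (t, x) \<bullet> (h, 0))) (at t within UNIV)"
      by (rule has_derivative_in_compose) (rule has_derivative_subset[OF F], use x in auto)
    then show ?thesis by (simp add: has_field_derivative_def Zt_def inner_prod_def mult.commute[of _ "fst _"] cong: if_cong)
  qed
  have Zx: "((Z t) has_derivative (\<lambda>h. Zx t x \<bullet> h)) (at x within S2)" if x: "x \<in> S2" for t x
  proof -
    have "((\<lambda>x. (t, x)) has_derivative (\<lambda>h. (0, h))) (at x within S2)"
      by (auto intro!: derivative_eq_intros)
    then have "((\<lambda>x. (\<lambda>(t, x). Z t x) (t, x)) has_derivative (\<lambda>h. F (t, x) \<bullet> (0, h))) (at x within S2)"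
      by (rule has_derivative_in_compose) (rule has_derivative_subset[OF F], use x in auto)
    then show ?thesis by (simp add: Zx_def inner_prod_def)
  qed
  have ws: "has_sgrad (\<psi> t) x (w t x)" if x: "x \<in> S2" for t x
  proof -
    obtain v where v: "has_sgrad (\<psi> t) x v" using eu[OF x, of t] by (elim conjE exE)
    then show ?thesis unfolding w_def sgrad_eq[OF x v] .
  qed
  have "smooth_flow Z \<psi> Zt Zx w"
  proof
    show "continuous_on (UNIV \<times> S2) (\<lambda>(t, x). Z t x)"
      by (rule has_derivative_continuous_on[OF F])
    show "continuous_on (UNIV \<times> S2) (\<lambda>(t, x). Zt t x)"
      using continuous_on_fst[OF cF] by (simp add: Zt_def case_prod_unfold)
    have "continuous_on S2 (\<lambda>x. F (t, x))" for t
      by (rule continuous_on_compose2[OF cF]) (auto intro!: continuous_intros)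
    then show "C1_grad (Z t) (Zx t)" for t
      using Zx unfolding C1_grad_def Zx_def by (auto intro!: continuous_intros)
    show "green_potential (Z t) (\<psi> t)" for t using G is_G_green_potential by blast
    show "Zt t x = w t x \<bullet> cross3 (Zx t x) x" if x: "x \<in> S2" for t x
    proof -
      have "Zt t x = - (cross3 (w t x) x \<bullet> (Zx t x - (Zx t x \<bullet> x) *\<^sub>R x))"
        using eu[OF x, of t] DERIV_imp_deriv[OF Zt[OF x]] sgrad_tangential[OF x Zx[OF x]]
        by (simp add: sgrad_perp_def w_def)
      \<comment> \<open>The normal part of \<open>Zx\<close> drops out because
        \<open>cross3 (w t x) x\<close> is tangent; what remains is a permutation of the triple
        product.\<close>
      also have "\<dots> = w t x \<bullet> cross3 (Zx t x) x"
        unfolding inner_diff_right inner_scaleR_right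
        by (simp add: dot_cross_self) (simp add: inner_3 cross3_def algebra_simps)
      finally show ?thesis .
    qed
  qed (fact Zt ws)+
  then show thesis using that by blast
qed

section \<open>From weak to strong convergence\<close>

text \<open>Subadditivity up to a factor 2, as for every nonnegative quadratic form; the recursion
  reduces it to \<open>(a + b)^2 \<le> 2 * a^2 + 2 * b^2\<close> at degree 0.\<close>

lemma zmom_form_add_le:
  assumes "integrable \<sigma> f" "integrable \<sigma> g"
  shows "(\<integral>x. (f x + g x) * zmom n (\<lambda>y. f y + g y) x \<partial>\<sigma>)
    \<le> 2 * (\<integral>x. f x * zmom n f x \<partial>\<sigma>) + 2 * (\<integral>x. g x * zmom n g x \<partial>\<sigma>)"
  using assms
proof (induction n arbitrary: f g)
  case 0
  have "(a + b)\<^sup>2 \<le> 2 * a\<^sup>2 + 2 * b\<^sup>2" for a b :: real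
    using zero_le_power2[of "a - b"] by (simp add: power2_eq_square algebra_simps)
  then show ?case using 0 by (simp add: zmom_0 power2_eq_square)
next
  case (Suc n)
  have "(\<integral>x. (f x + g x) * zmom (Suc n) (\<lambda>y. f y + g y) x \<partial>\<sigma>)
     = (\<Sum>i\<in>UNIV. \<integral>x. (x $ i * f x + x $ i * g x) * zmom n (\<lambda>y. y $ i * f y + y $ i * g y) x \<partial>\<sigma>)"
    using Suc.prems by (subst zmom_form_Suc) (simp_all only: Bochner_Integration.integrable_add distrib_left)
  also have "\<dots> \<le> (\<Sum>i\<in>UNIV. 2 * (\<integral>x. (x $ i * f x) * zmom n (\<lambda>y. y $ i * f y) x \<partial>\<sigma>)
       + 2 * (\<integral>x. (x $ i * g x) * zmom n (\<lambda>y. y $ i * g y) x \<partial>\<sigma>))"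
    by (intro sum_mono Suc.IH integrable_nth_mult Suc.prems)
  also have "\<dots> = 2 * (\<integral>x. f x * zmom (Suc n) f x \<partial>\<sigma>) + 2 * (\<integral>x. g x * zmom (Suc n) g x \<partial>\<sigma>)"
    unfolding zmom_form_Suc[OF Suc.prems(1,1)] zmom_form_Suc[OF Suc.prems(2,2)]
    by (simp only: sum.distrib sum_distrib_left)
  finally show ?case .
qed

text \<open>The form with kernel \<open>(x \<bullet> y)\<^sup>n\<close> is the sum of the squares of all moments of degree \<open>n\<close>.\<close>

lemma polynomial_moments_tendsto_0:
  fixes w :: "nat \<Rightarrow> real^3 \<Rightarrow> real"
  assumes w: "\<And>k. integrable \<sigma> (w k)"
    and lim: "\<And>n. (\<lambda>k. \<integral>x. w k x * zmom n (w k) x \<partial>\<sigma>) \<longlonglongrightarrow> 0"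
    and q: "real_polynomial_function q"
  shows "(\<lambda>k. \<integral>x. q x * w k x \<partial>\<sigma>) \<longlonglongrightarrow> 0"
proof -
  define form where "form n h = (\<lambda>k. \<integral>x. (h x * w k x) * zmom n (\<lambda>y. h y * w k y) x \<partial>\<sigma>)" for n h
  \<comment> \<open>The induction over polynomials needs the stronger statement that the forms of
    all degrees of \<open>h * w k\<close> vanish in the limit, because multiplication by a
    coordinate uses up one degree.\<close>
  define good where "good h \<longleftrightarrow> continuous_on S2 h \<and> (\<forall>n. form n h \<longlonglongrightarrow> 0)" for h
  have int: "integrable \<sigma> (\<lambda>x. h x * w k x)" if "continuous_on S2 h" for h k
    by (rule integrable_\<sigma>_mult_continuous[OF that w])
  have nonneg: "0 \<le> form n h k" if "continuous_on S2 h" for n h k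
    unfolding form_def by (rule zmom_form_nonneg[OF int[OF that]])
  have squeeze: "good h" if "continuous_on S2 h" "\<And>n. (\<lambda>k. b n k) \<longlonglongrightarrow> 0" "\<And>n k. form n h k \<le> b n k" for h b
    unfolding good_def
  proof (intro conjI allI)
    show "form n h \<longlonglongrightarrow> 0" for n
      by (rule tendsto_sandwich[OF _ _ tendsto_const that(2)[of n]]) (use nonneg[OF that(1)] that(3) in auto)
  qed (rule that(1))
  \<comment> \<open>The form of degree \<open>Suc n\<close> is the sum over the coordinates of
    nonnegative forms of degree \<open>n\<close>, so it dominates each of them.\<close>
  have good_nth: "good (\<lambda>x. x $ i * h x)" if "good h" for h i
  proof (rule squeeze[of _ "\<lambda>n. form (Suc n) h"])
    have ch: "continuous_on S2 h" using that by (simp add: good_def)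
    then show c: "continuous_on S2 (\<lambda>x. x $ i * h x)" for i by (intro continuous_intros)
    show "(\<lambda>k. form (Suc n) h k) \<longlonglongrightarrow> 0" for n using that by (simp add: good_def)
    have "form (Suc n) h k = (\<Sum>i\<in>UNIV. form n (\<lambda>x. x $ i * h x) k)" for n k
      unfolding form_def zmom_form_Suc[OF int[OF ch] int[OF ch]] by (simp only: mult.assoc)
    then show "form n (\<lambda>x. x $ i * h x) k \<le> form (Suc n) h k" for n k
      using member_le_sum[of i UNIV "\<lambda>i. form n (\<lambda>x. x $ i * h x) k"] nonneg[OF c] by simp
  qed
  have good_add: "good (\<lambda>x. f x + h x)" if "good f" "good h" for f h
  proof (rule squeeze[of _ "\<lambda>n k. 2 * form n f k + 2 * form n h k"])
    have c: "continuous_on S2 f" "continuous_on S2 h" using that by (auto simp: good_def)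
    then show "continuous_on S2 (\<lambda>x. f x + h x)" by (intro continuous_intros)
    show "(\<lambda>k. 2 * form n f k + 2 * form n h k) \<longlonglongrightarrow> 0" for n
      using that unfolding good_def by (auto intro!: tendsto_eq_intros)
    show "form n (\<lambda>x. f x + h x) k \<le> 2 * form n f k + 2 * form n h k" for n k
      using zmom_form_add_le[OF int[OF c(1), of k] int[OF c(2), of k], of n]
      unfolding form_def by (simp only: distrib_right)
  qed
  have good_cmult: "good (\<lambda>x. c * h x)" if "good h" for c h
  proof (rule squeeze[of _ "\<lambda>n k. c\<^sup>2 * form n h k"])
    show "continuous_on S2 (\<lambda>x. c * h x)" using that by (auto simp: good_def intro!: continuous_intros)
    show "(\<lambda>k. c\<^sup>2 * form n h k) \<longlonglongrightarrow> 0" for n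
      using that unfolding good_def by (auto intro!: tendsto_eq_intros)
    have "form n (\<lambda>x. c * h x) k = c\<^sup>2 * form n h k" for n k
      unfolding form_def power2_eq_square mult.assoc zmom_cmult
      by (subst Bochner_Integration.integral_mult_right_zero[symmetric])+ (simp only: mult_ac)
    then show "form n (\<lambda>x. c * h x) k \<le> c\<^sup>2 * form n h k" for n k by simp
  qed
  have good_zero: "good (\<lambda>x. 0)"
    by (simp add: good_def form_def)
  have good_sum: "good (\<lambda>x. \<Sum>i\<in>I. f i x)" if "finite I" "\<And>i. i \<in> I \<Longrightarrow> good (f i)" for I :: "3 set" and f
    using that by (induction I rule: finite_induct) (auto intro: good_add good_zero)
  have "good h \<Longrightarrow> good (\<lambda>x. q x * h x)" for h
    using q
  proof (induction q arbitrary: h)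
    case (linear f)
    have f: "f x * h x = (\<Sum>i\<in>UNIV. f (axis i 1) * (x $ i * h x))" for x
    proof -
      have lf: "linear f" using linear(1) by (rule bounded_linear.linear)
      have "f x = f (\<Sum>i\<in>UNIV. x $ i *\<^sub>R axis i 1)"
        by (simp add: basis_expansion scalar_mult_eq_scaleR[symmetric])
      also have "\<dots> = (\<Sum>i\<in>UNIV. x $ i * f (axis i 1))"
        using lf by (simp add: linear_sum linear_scale)
      finally have fx: "f x = (\<Sum>i\<in>UNIV. x $ i * f (axis i 1))" .
      show ?thesis unfolding fx sum_distrib_right by (simp only: mult_ac)
    qed
    show ?case unfolding f by (intro good_sum good_cmult good_nth linear) auto
  next
    case (const c)
    then show ?case by (rule good_cmult)
  next
    case (add f g)
    then show ?case by (simp add: distrib_right good_add)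
  next
    case (mult f g)
    then show ?case by (simp add: mult.assoc)
  qed
  moreover have "good (\<lambda>x. 1)" using lim by (simp add: good_def form_def)
  ultimately have "good (\<lambda>x. q x * 1)" by blast
  \<comment> \<open>The form of degree 0 is the square of the pairing to be estimated.\<close>
  then have "form 0 q \<longlonglongrightarrow> 0" by (simp add: good_def)
  then have "(\<lambda>k. (\<integral>x. q x * w k x \<partial>\<sigma>)\<^sup>2) \<longlonglongrightarrow> 0"
    by (simp add: form_def zmom_0 power2_eq_square)
  then have "(\<lambda>k. sqrt ((\<integral>x. q x * w k x \<partial>\<sigma>)\<^sup>2)) \<longlonglongrightarrow> sqrt 0"
    by (rule tendsto_real_sqrt)
  then show ?thesis by (simp add: tendsto_rabs_zero_iff)
qed

section \<open>Truncation and elementary inequalities for powers\<close>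

definition trunc :: "real \<Rightarrow> real \<Rightarrow> real"
  where "trunc M a = max (- M) (min M a)"

text \<open>A primitive of \<open>trunc M\<close> (the Huber function), written without case distinctions.\<close>

definition huber :: "real \<Rightarrow> real \<Rightarrow> real"
  where "huber M a = trunc M a * a - (trunc M a)\<^sup>2 / 2"

lemma trunc_abs_le: "0 \<le> M \<Longrightarrow> \<bar>trunc M a\<bar> \<le> M"
  by (auto simp: trunc_def)

lemma trunc_residual_lipschitz: "\<bar>(a - trunc M a) - (b - trunc M b)\<bar> \<le> \<bar>a - b\<bar>"
  by (auto simp: trunc_def max_def min_def)

lemma trunc_residual_le: "0 \<le> M \<Longrightarrow> \<bar>a - trunc M a\<bar> \<le> \<bar>a\<bar>"
  by (auto simp: trunc_def)

lemma continuous_on_trunc: "continuous_on T (trunc M)"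
  unfolding trunc_def[abs_def] by (intro continuous_intros)

lemma continuous_on_huber: "continuous_on T (huber M)"
  unfolding huber_def[abs_def] by (intro continuous_intros continuous_on_trunc) auto

lemma borel_measurable_trunc [measurable]: "trunc M \<in> borel_measurable borel"
  by (rule borel_measurable_continuous_onI[OF continuous_on_trunc])

lemma borel_measurable_huber [measurable]: "huber M \<in> borel_measurable borel"
  by (rule borel_measurable_continuous_onI[OF continuous_on_huber])

text \<open>The function \<open>huber M\<close> is convex and its derivative \<open>trunc M\<close>
  is 1-Lipschitz, so its Bregman divergence dominates half the squared difference of
  derivatives.\<close>

lemma huber_bregman:
  assumes "0 \<le> M"
  shows "(trunc M a - trunc M b)\<^sup>2 / 2 \<le> huber M a - huber M b - trunc M b * (a - b)"
proof -
  \<comment> \<open>This product is exactly the difference of the two sides. It can be nonzero only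
    when \<open>a\<close> is cut off, and then \<open>trunc M a\<close> is an extreme value of
    \<open>trunc M\<close>, which fixes the sign.\<close>
  have "0 \<le> (trunc M a - trunc M b) * (a - trunc M a)"
  proof (rule linorder_cases[of a "trunc M a"])
    assume "a < trunc M a"
    then have "trunc M a = - M" using assms by (auto simp: trunc_def max_def min_def split: if_splits)
    then have "trunc M a - trunc M b \<le> 0" by (simp add: trunc_def)
    then show ?thesis using \<open>a < trunc M a\<close> by (intro mult_nonpos_nonpos) auto
  next
    assume "trunc M a < a"
    then have "trunc M a = M" using assms by (auto simp: trunc_def max_def min_def split: if_splits)
    then have "0 \<le> trunc M a - trunc M b" using assms by (simp add: trunc_def)
    then show ?thesis using \<open>trunc M a < a\<close> by (intro mult_nonneg_nonneg) auto
  qed simp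
  then show ?thesis by (simp add: huber_def power2_eq_square field_simps)
qed

lemma huber_lipschitz:
  assumes "0 \<le> M"
  shows "\<bar>huber M a - huber M b\<bar> \<le> M * \<bar>a - b\<bar>"
proof -
  have *: "huber M b - huber M a \<le> M * \<bar>a - b\<bar>" for a b
  proof -
    have "- (trunc M b * (a - b)) \<le> \<bar>trunc M b\<bar> * \<bar>a - b\<bar>"
      by (metis abs_ge_minus_self abs_mult)
    also have "\<dots> \<le> M * \<bar>a - b\<bar>" using trunc_abs_le[OF assms] by (intro mult_right_mono) auto
    finally show ?thesis using huber_bregman[OF assms, of a b] zero_le_power2[of "trunc M a - trunc M b"] by linarith
  qed
  show ?thesis using *[of a b] *[of b a] by (simp add: abs_le_iff abs_minus_commute)
qed

lemma abs_powr_sum3_le: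
  fixes a b c p :: real
  assumes "0 \<le> p"
  shows "\<bar>a + b + c\<bar> powr p \<le> 3 powr p * (\<bar>a\<bar> powr p + \<bar>b\<bar> powr p + \<bar>c\<bar> powr p)"
proof -
  define m where "m = max \<bar>a\<bar> (max \<bar>b\<bar> \<bar>c\<bar>)"
  have m: "\<bar>a + b + c\<bar> \<le> 3 * m" "0 \<le> m" unfolding m_def by linarith+
  then have "\<bar>a + b + c\<bar> powr p \<le> (3 * m) powr p" using assms by (intro powr_mono2) auto
  also have "\<dots> = 3 powr p * m powr p" using m by (simp add: powr_mult)
  also have "m powr p \<le> \<bar>a\<bar> powr p + \<bar>b\<bar> powr p + \<bar>c\<bar> powr p"
    unfolding m_def max_def by (auto simp: add_increasing add_increasing2)
  finally show ?thesis by simp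
qed

lemma abs_powr_add_le:
  fixes a b p :: real
  assumes "0 \<le> p"
  shows "\<bar>a + b\<bar> powr p \<le> 3 powr p * (\<bar>a\<bar> powr p + \<bar>b\<bar> powr p)"
  using abs_powr_sum3_le[OF assms, of a b 0] by simp

text \<open>Turns \<open>L^2\<close> smallness of bounded functions into \<open>L^p\<close>
  smallness for any \<open>p\<close>. For \<open>p < 2\<close> the square is too weak near 0, hence
  the additive \<eta>; the threshold is \<open>\<bar>a\<bar> = \<eta> powr (1 / p)\<close>.\<close>

lemma abs_powr_le_square:
  fixes a p M \<eta> :: real
  assumes "0 < p" "0 < \<eta>" "\<bar>a\<bar> \<le> M"
  shows "\<bar>a\<bar> powr p \<le> \<eta> + M powr p / (\<eta> powr (1 / p))\<^sup>2 * a\<^sup>2"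
proof (cases "\<bar>a\<bar> \<le> \<eta> powr (1 / p)")
  case True
  then have "\<bar>a\<bar> powr p \<le> (\<eta> powr (1 / p)) powr p" using assms by (intro powr_mono2) auto
  then have "\<bar>a\<bar> powr p \<le> \<eta>" using assms by (simp add: powr_powr)
  moreover have "0 \<le> M powr p / (\<eta> powr (1 / p))\<^sup>2 * a\<^sup>2" by simp
  ultimately show ?thesis by linarith
next
  case False
  have "\<bar>a\<bar> powr p \<le> M powr p" using assms by (intro powr_mono2) auto
  also have "\<dots> \<le> M powr p * (a\<^sup>2 / (\<eta> powr (1 / p))\<^sup>2)"
  proof -
    have "(\<eta> powr (1 / p))\<^sup>2 \<le> a\<^sup>2"
      using False power_mono[of "\<eta> powr (1 / p)" "\<bar>a\<bar>" 2] by simp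
    then have "1 \<le> a\<^sup>2 / (\<eta> powr (1 / p))\<^sup>2" using assms by (simp add: le_divide_eq_1)
    from mult_left_mono[OF this, of "M powr p"] show ?thesis by simp
  qed
  finally show ?thesis using assms by simp
qed

lemma in_Lp_continuous_diff:
  fixes h f :: "real^3 \<Rightarrow> real"
  assumes h: "continuous_on S2 h" and f: "in_Lp p f" and p: "0 < p"
  shows "in_Lp p (\<lambda>x. h x - f x)"
proof -
  have m: "(\<lambda>x. h x - f x) \<in> borel_measurable \<sigma>"
    using f continuous_on_measurable_\<sigma>[OF h] by (intro borel_measurable_diff) (auto simp: in_Lp_def)
  have "integrable \<sigma> (\<lambda>x. \<bar>h x - f x\<bar> powr p)"
  proof (rule Bochner_Integration.integrable_bound)
    have "continuous_on S2 (\<lambda>x. \<bar>h x\<bar> powr p)"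
      using p by (intro continuous_on_powr' continuous_intros h) auto
    then have "integrable \<sigma> (\<lambda>x. \<bar>h x\<bar> powr p)" by (rule integrable_\<sigma>_continuous)
    moreover have "integrable \<sigma> (\<lambda>x. \<bar>f x\<bar> powr p)" using f by (simp add: in_Lp_def)
    ultimately show "integrable \<sigma> (\<lambda>x. 3 powr p * (\<bar>h x\<bar> powr p + \<bar>f x\<bar> powr p))"
      by (intro integrable_mult_right Bochner_Integration.integrable_add)
    show "AE x in \<sigma>. norm (\<bar>h x - f x\<bar> powr p) \<le> norm (3 powr p * (\<bar>h x\<bar> powr p + \<bar>f x\<bar> powr p))"
      using abs_powr_add_le[of p "h _" "- f _"] p by (intro AE_I2) simp
  qed (use m in measurable)
  then show ?thesis using m by (simp add: in_Lp_def)
qed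

text \<open>The initial states \<open>v0 k\<close> and the states \<open>v k\<close> at later times
  depending on \<open>k\<close>. Equimeasurability is phrased by continuous functions, as
  conservation of Casimirs provides it; weak convergence is phrased by polynomials, whose pairings
  the energy controls.\<close>

locale equimeasurable_sequence =
  fixes p :: real and \<zeta> :: "real^3 \<Rightarrow> real" and v0 v :: "nat \<Rightarrow> real^3 \<Rightarrow> real"
  assumes p: "1 < p" and \<zeta>: "in_Lp p \<zeta>"
    and v0_cont: "\<And>k. continuous_on S2 (v0 k)" and v_cont: "\<And>k. continuous_on S2 (v k)"
    and v0_lim: "(\<lambda>k. \<integral>x. \<bar>v0 k x - \<zeta> x\<bar> powr p \<partial>\<sigma>) \<longlonglongrightarrow> 0"
    and equi: "\<And>k f. continuous_on UNIV f \<Longrightarrow> (\<integral>x. f (v k x) \<partial>\<sigma>) = (\<integral>x. f (v0 k x) \<partial>\<sigma> :: real)"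
    and weak: "\<And>q. real_polynomial_function q \<Longrightarrow> (\<lambda>k. \<integral>x. q x * (v k x - \<zeta> x) \<partial>\<sigma>) \<longlonglongrightarrow> 0"
begin

lemma \<zeta>_int: "integrable \<sigma> \<zeta>" and \<zeta>_meas: "\<zeta> \<in> borel_measurable \<sigma>"
  and \<zeta>_powr: "integrable \<sigma> (\<lambda>x. \<bar>\<zeta> x\<bar> powr p)"
  using in_Lp_integrable[OF \<zeta> p] \<zeta> by (auto simp: in_Lp_def)

lemma v_int: "integrable \<sigma> (v k)" and v0_int: "integrable \<sigma> (v0 k)"
  by (intro integrable_\<sigma>_continuous v_cont v0_cont)+

lemma continuous_comp_int:
  fixes f :: "real \<Rightarrow> real"
  assumes "continuous_on UNIV f"
  shows "integrable \<sigma> (\<lambda>x. f (v k x))" "integrable \<sigma> (\<lambda>x. f (v0 k x))"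
  by (intro integrable_\<sigma>_continuous continuous_on_compose2[OF assms v_cont]
      continuous_on_compose2[OF assms v0_cont]; simp)+

lemma diff_powr_int: "continuous_on S2 h \<Longrightarrow> integrable \<sigma> (\<lambda>x. \<bar>h x - \<zeta> x\<bar> powr p)"
  using in_Lp_continuous_diff[OF _ \<zeta>] p by (simp add: in_Lp_def)

definition e :: "nat \<Rightarrow> real" where "e k = (\<integral>x. \<bar>v0 k x - \<zeta> x\<bar> \<partial>\<sigma>)"

lemma e_lim: "e \<longlonglongrightarrow> 0"
proof (rule LIMSEQ_I)
  fix r :: real assume r: "0 < r"
  define M where "M = r / (2 * area)"
  have M: "0 < M" "M * area = r / 2" using r area_pos by (auto simp: M_def)
  have "(\<lambda>k. M powr (1 - p) * (\<integral>x. \<bar>v0 k x - \<zeta> x\<bar> powr p \<partial>\<sigma>)) \<longlonglongrightarrow> 0"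
    using v0_lim by (rule tendsto_mult_right_zero)
  then have "\<forall>\<^sub>F k in sequentially. M powr (1 - p) * (\<integral>x. \<bar>v0 k x - \<zeta> x\<bar> powr p \<partial>\<sigma>) < r / 2"
    by (rule order_tendstoD) (use r in simp)
  then have "\<forall>\<^sub>F k in sequentially. e k < r"
  proof eventually_elim
    case (elim k)
    have "e k \<le> (\<integral>x. M + M powr (1 - p) * \<bar>v0 k x - \<zeta> x\<bar> powr p \<partial>\<sigma>)"
      unfolding e_def
      by (intro integral_mono le_truncation_powr p M integrable_abs Bochner_Integration.integrable_diff
          v0_int \<zeta>_int Bochner_Integration.integrable_add integrable_mult_right diff_powr_int v0_cont) auto
    also have "\<dots> = M * area + M powr (1 - p) * (\<integral>x. \<bar>v0 k x - \<zeta> x\<bar> powr p \<partial>\<sigma>)"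
      using diff_powr_int[OF v0_cont] by (simp add: mult.commute)
    also have "\<dots> < r" using elim M by simp
    finally show ?case .
  qed
  moreover have "0 \<le> e k" for k unfolding e_def by simp
  ultimately show "\<exists>no. \<forall>k\<ge>no. norm (e k - 0) < r"
    by (simp add: eventually_sequentially)
qed

text \<open>The excess over the truncation level. The power \<open>q = 1\<close> serves uniform
  integrability, the power \<open>q = p\<close> the final norm estimate.\<close>

definition res :: "real \<Rightarrow> real \<Rightarrow> real \<Rightarrow> real" where "res q M a = \<bar>a - trunc M a\<bar> powr q"

lemma continuous_on_res: "0 < q \<Longrightarrow> continuous_on T (res q M)"
  unfolding res_def[abs_def]
  by (intro continuous_on_powr' continuous_intros continuous_on_trunc) auto

lemma res_\<zeta>_meas: "(\<lambda>x. res q M (\<zeta> x)) \<in> borel_measurable \<sigma>"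
  unfolding res_def using \<zeta>_meas by measurable

lemma res_le: "0 < q \<Longrightarrow> 0 \<le> M \<Longrightarrow> res q M a \<le> \<bar>a\<bar> powr q"
  unfolding res_def using trunc_residual_le by (intro powr_mono2) auto

lemma abs_powr_\<zeta>_int: "q = 1 \<or> q = p \<Longrightarrow> integrable \<sigma> (\<lambda>x. \<bar>\<zeta> x\<bar> powr q)"
  using \<zeta>_int \<zeta>_powr by auto

lemma res_\<zeta>_int:
  assumes "q = 1 \<or> q = p" "0 \<le> M"
  shows "integrable \<sigma> (\<lambda>x. res q M (\<zeta> x))"
proof (rule Bochner_Integration.integrable_bound[OF abs_powr_\<zeta>_int[OF assms(1)] res_\<zeta>_meas])
  show "AE x in \<sigma>. norm (res q M (\<zeta> x)) \<le> norm (\<bar>\<zeta> x\<bar> powr q)"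
    using assms p res_le[of q M] by (intro AE_I2) (auto simp: res_def)
qed

lemma res_lim:
  assumes q: "q = 1 \<or> q = p"
  shows "(\<lambda>n. \<integral>x. res q (real n) (\<zeta> x) \<partial>\<sigma>) \<longlonglongrightarrow> 0"
proof -
  have "(\<lambda>n. \<integral>x. res q (real n) (\<zeta> x) \<partial>\<sigma>) \<longlonglongrightarrow> (\<integral>x. 0 \<partial>\<sigma>)"
  proof (rule integral_dominated_convergence[where w="\<lambda>x. \<bar>\<zeta> x\<bar> powr q"])
    show "AE x in \<sigma>. (\<lambda>n. res q (real n) (\<zeta> x)) \<longlonglongrightarrow> 0"
    proof (rule AE_I2)
      fix x
      have "\<forall>\<^sub>F n in sequentially. \<bar>\<zeta> x\<bar> \<le> real n"
        using eventually_ge_at_top[of "nat \<lceil>\<bar>\<zeta> x\<bar>\<rceil>"] by eventually_elim linarith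
      then have "\<forall>\<^sub>F n in sequentially. res q (real n) (\<zeta> x) = 0"
        by eventually_elim (auto simp: res_def trunc_def)
      then show "(\<lambda>n. res q (real n) (\<zeta> x)) \<longlonglongrightarrow> 0" by (rule tendsto_eventually)
    qed
    show "AE x in \<sigma>. norm (res q (real n) (\<zeta> x)) \<le> \<bar>\<zeta> x\<bar> powr q" for n
      using q p res_le[of q "real n"] by (intro AE_I2) (auto simp: res_def)
  qed (use abs_powr_\<zeta>_int[OF q] res_\<zeta>_meas in auto)
  then show ?thesis by simp
qed

abbreviation tail :: "real \<Rightarrow> real \<Rightarrow> real" where "tail \<equiv> res 1"

lemma tail_facts:
  "0 \<le> tail L a" "0 \<le> L \<Longrightarrow> \<bar>a\<bar> \<le> L + tail L a" "tail L a \<le> tail L b + \<bar>a - b\<bar>"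
proof -
  have eq: "tail L a = \<bar>a - trunc L a\<bar>" for a by (simp add: res_def)
  show "0 \<le> tail L a" by (simp add: eq)
  show "\<bar>a\<bar> \<le> L + tail L a" if "0 \<le> L" using trunc_abs_le[OF that, of a] unfolding eq by linarith
  show "tail L a \<le> tail L b + \<bar>a - b\<bar>" using trunc_residual_lipschitz[of a L b] unfolding eq by linarith
qed

lemma continuous_on_tail: "continuous_on T (tail L)"
  by (rule continuous_on_res) simp

lemma tail_\<zeta>_int: "0 \<le> L \<Longrightarrow> integrable \<sigma> (\<lambda>x. tail L (\<zeta> x))"
  by (rule res_\<zeta>_int) simp_all

text \<open>Uniform integrability of \<open>v k\<close>: equimeasurability moves the tail to
  \<open>v0 k\<close>, which is close to \<zeta> in \<open>L^1\<close>.\<close>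

lemma tail_v_le:
  assumes L: "0 \<le> L"
  shows "(\<integral>x. tail L (v k x) \<partial>\<sigma>) \<le> (\<integral>x. tail L (\<zeta> x) \<partial>\<sigma>) + e k"
proof -
  note int = tail_\<zeta>_int[OF L] continuous_comp_int[OF continuous_on_tail[of UNIV L]]
  have "(\<integral>x. tail L (v k x) \<partial>\<sigma>) = (\<integral>x. tail L (v0 k x) \<partial>\<sigma>)"
    by (rule equi[OF continuous_on_tail])
  also have "\<dots> \<le> (\<integral>x. tail L (\<zeta> x) + \<bar>v0 k x - \<zeta> x\<bar> \<partial>\<sigma>)"
    by (intro integral_mono tail_facts(3) int Bochner_Integration.integrable_add integrable_abs
        Bochner_Integration.integrable_diff v0_int \<zeta>_int)
  also have "\<dots> = (\<integral>x. tail L (\<zeta> x) \<partial>\<sigma>) + e k"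
    unfolding e_def using int v0_int \<zeta>_int by simp
  finally show ?thesis .
qed

text \<open>Covers two kinds of small test function: with \<open>L = 0\<close>, those small in the
  sup norm \<open>C\<close>; with \<open>L\<close> large, those bounded by \<open>C\<close> and
  small in \<open>L^1\<close>, where the tails are paid for by uniform integrability.\<close>

lemma pairing_bound:
  assumes h: "h \<in> borel_measurable \<sigma>" and C: "\<And>x. x \<in> S2 \<Longrightarrow> \<bar>h x\<bar> \<le> C" and L: "0 \<le> L"
  shows "\<bar>\<integral>x. h x * (v k x - \<zeta> x) \<partial>\<sigma>\<bar> \<le> 2 * L * (\<integral>x. \<bar>h x\<bar> \<partial>\<sigma>) + C * (2 * (\<integral>x. tail L (\<zeta> x) \<partial>\<sigma>) + e k)"
proof -
  have C0: "0 \<le> C" using C[of "axis 1 1"] by (simp add: order_trans[OF abs_ge_zero])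
  have inth: "integrable \<sigma> h"
    using C by (intro S.integrable_const_bound[of _ C] AE_I2 h) simp
  note int = tail_\<zeta>_int[OF L] continuous_comp_int[OF continuous_on_tail[of UNIV L]]
  have "\<bar>\<integral>x. h x * (v k x - \<zeta> x) \<partial>\<sigma>\<bar> \<le> (\<integral>x. \<bar>h x * (v k x - \<zeta> x)\<bar> \<partial>\<sigma>)" by (rule integral_abs_bound)
  also have "\<dots> \<le> (\<integral>x. 2 * L * \<bar>h x\<bar> + C * (tail L (v k x) + tail L (\<zeta> x)) \<partial>\<sigma>)"
  proof (rule integral_mono')
    show "integrable \<sigma> (\<lambda>x. 2 * L * \<bar>h x\<bar> + C * (tail L (v k x) + tail L (\<zeta> x)))"
      using inth int by (intro Bochner_Integration.integrable_add integrable_mult_right integrable_abs) auto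
    show "0 \<le> 2 * L * \<bar>h x\<bar> + C * (tail L (v k x) + tail L (\<zeta> x))" for x
      using C0 L by (intro add_nonneg_nonneg mult_nonneg_nonneg tail_facts(1)) auto
    fix x assume "x \<in> space \<sigma>"
    then have x: "x \<in> S2" by simp
    have "\<bar>v k x - \<zeta> x\<bar> \<le> 2 * L + (tail L (v k x) + tail L (\<zeta> x))"
      using tail_facts(2)[OF L, of "v k x"] tail_facts(2)[OF L, of "\<zeta> x"] by linarith
    then have "\<bar>h x * (v k x - \<zeta> x)\<bar> \<le> \<bar>h x\<bar> * (2 * L + (tail L (v k x) + tail L (\<zeta> x)))"
      unfolding abs_mult by (rule mult_left_mono) simp
    also have "\<dots> \<le> 2 * L * \<bar>h x\<bar> + C * (tail L (v k x) + tail L (\<zeta> x))"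
      using mult_right_mono[OF C[OF x], of "tail L (v k x) + tail L (\<zeta> x)"] tail_facts(1)
      by (simp add: algebra_simps)
    finally show "\<bar>h x * (v k x - \<zeta> x)\<bar> \<le> 2 * L * \<bar>h x\<bar> + C * (tail L (v k x) + tail L (\<zeta> x))" .
  qed
  also have "\<dots> = 2 * L * (\<integral>x. \<bar>h x\<bar> \<partial>\<sigma>) + C * ((\<integral>x. tail L (v k x) \<partial>\<sigma>) + (\<integral>x. tail L (\<zeta> x) \<partial>\<sigma>))"
    using inth int by simp
  also have "\<dots> \<le> 2 * L * (\<integral>x. \<bar>h x\<bar> \<partial>\<sigma>) + C * ((\<integral>x. tail L (\<zeta> x) \<partial>\<sigma>) + e k + (\<integral>x. tail L (\<zeta> x) \<partial>\<sigma>))"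
    by (intro add_mono mult_left_mono order_refl C0 tail_v_le L)
  finally show ?thesis by (simp add: algebra_simps)
qed

text \<open>The test function needed in the end, \<open>trunc M\<close> of \<zeta>, is bounded but
  only measurable, so weak convergence is extended from polynomials to continuous functions,
  indicators and bounded measurable functions.\<close>

definition good :: "(real^3 \<Rightarrow> real) \<Rightarrow> bool"
  where "good h \<longleftrightarrow> h \<in> borel_measurable \<sigma> \<and> (\<lambda>k. \<integral>x. h x * (v k x - \<zeta> x) \<partial>\<sigma>) \<longlonglongrightarrow> 0"

lemma bounded_mult_int:
  assumes "h \<in> borel_measurable \<sigma>" "\<And>x. x \<in> S2 \<Longrightarrow> \<bar>h x\<bar> \<le> C"
  shows "integrable \<sigma> (\<lambda>x. h x * (v k x - \<zeta> x))"
proof (rule Bochner_Integration.integrable_bound[where f="\<lambda>x. C * (v k x - \<zeta> x)"])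
  show "AE x in \<sigma>. norm (h x * (v k x - \<zeta> x)) \<le> norm (C * (v k x - \<zeta> x))"
    using assms(2) by (intro AE_I2) (force simp: abs_mult intro!: mult_right_mono)
  show "(\<lambda>x. h x * (v k x - \<zeta> x)) \<in> borel_measurable \<sigma>"
    using assms(1) borel_measurable_integrable[OF v_int[of k]] \<zeta>_meas by measurable
qed (intro integrable_mult_right Bochner_Integration.integrable_diff v_int \<zeta>_int)

lemma good_approx:
  assumes h: "h \<in> borel_measurable \<sigma>" "\<And>x. x \<in> S2 \<Longrightarrow> \<bar>h x\<bar> \<le> C"
    and a: "\<And>r. 0 < r \<Longrightarrow> \<exists>g C'. good g \<and> (\<forall>x\<in>S2. \<bar>g x\<bar> \<le> C') \<and>
      (\<forall>\<^sub>F k in sequentially. \<bar>\<integral>x. (h x - g x) * (v k x - \<zeta> x) \<partial>\<sigma>\<bar> \<le> r)"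
  shows "good h"
proof -
  have "(\<lambda>k. \<integral>x. h x * (v k x - \<zeta> x) \<partial>\<sigma>) \<longlonglongrightarrow> 0"
  proof (rule LIMSEQ_I)
    fix r :: real assume r: "0 < r"
    obtain g C' where g: "good g" "\<And>x. x \<in> S2 \<Longrightarrow> \<bar>g x\<bar> \<le> C'"
      and ev: "\<forall>\<^sub>F k in sequentially. \<bar>\<integral>x. (h x - g x) * (v k x - \<zeta> x) \<partial>\<sigma>\<bar> \<le> r / 2"
      using a[OF half_gt_zero[OF r]] by blast
    have gm: "g \<in> borel_measurable \<sigma>" and gl: "(\<lambda>k. \<integral>x. g x * (v k x - \<zeta> x) \<partial>\<sigma>) \<longlonglongrightarrow> 0"
      using g by (auto simp: good_def)
    have "\<forall>\<^sub>F k in sequentially. \<bar>\<integral>x. g x * (v k x - \<zeta> x) \<partial>\<sigma>\<bar> < r / 2"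
      using order_tendstoD(2)[OF tendsto_rabs_zero[OF gl] half_gt_zero[OF r]] .
    then have "\<forall>\<^sub>F k in sequentially. \<bar>\<integral>x. h x * (v k x - \<zeta> x) \<partial>\<sigma>\<bar> < r"
      using ev
    proof eventually_elim
      case (elim k)
      have "(\<integral>x. (h x - g x) * (v k x - \<zeta> x) \<partial>\<sigma>)
         = (\<integral>x. h x * (v k x - \<zeta> x) \<partial>\<sigma>) - (\<integral>x. g x * (v k x - \<zeta> x) \<partial>\<sigma>)"
        unfolding left_diff_distrib[of "h _" "g _"]
        by (rule Bochner_Integration.integral_diff[OF bounded_mult_int[OF h] bounded_mult_int[OF gm g(2)]])
      then show ?case using elim by linarith
    qed
    then show "\<exists>no. \<forall>k\<ge>no. norm ((\<integral>x. h x * (v k x - \<zeta> x) \<partial>\<sigma>) - 0) < r"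
      by (simp add: eventually_sequentially)
  qed
  then show ?thesis using h by (simp add: good_def)
qed

lemma good_continuous:
  assumes "continuous_on S2 h"
  shows "good h"
proof -
  obtain C where C: "\<And>x. x \<in> S2 \<Longrightarrow> \<bar>h x\<bar> \<le> C"
    using continuous_on_S2_bounded[OF assms] by (auto simp: real_norm_def)
  \<comment> \<open>Since \<open>trunc 0\<close> is the zero function, \<open>tail 0\<close> is the
    absolute value and \<open>T\<close> is the \<open>L^1\<close> norm of \<zeta>.\<close>
  define T where "T = (\<integral>x. tail 0 (\<zeta> x) \<partial>\<sigma>)"
  have T: "0 \<le> T" unfolding T_def using tail_facts(1) by (intro integral_nonneg_AE) simp
  show ?thesis
  proof (rule good_approx[OF continuous_on_measurable_\<sigma>[OF assms] C])
    fix r :: real assume r: "0 < r"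
    define \<eta> where "\<eta> = r / (2 * T + 1)"
    have \<eta>: "0 < \<eta>" "\<eta> * (2 * T + 1) = r" using r T by (auto simp: \<eta>_def)
    obtain q where q: "real_polynomial_function q" "\<And>x. x \<in> S2 \<Longrightarrow> \<bar>h x - q x\<bar> < \<eta>"
      using Stone_Weierstrass_real_polynomial_function[of S2 h \<eta>] assms \<eta> by auto
    have cq: "continuous_on S2 q"
      using q(1) by (simp add: continuous_on_polymonial_function real_polynomial_function_eq)
    have gq: "good q" using weak[OF q(1)] continuous_on_measurable_\<sigma>[OF cq] by (simp add: good_def)
    obtain C' where "\<And>x. x \<in> S2 \<Longrightarrow> norm (q x) \<le> C'"
      using continuous_on_S2_bounded[OF cq] by blast
    then have C': "\<forall>x\<in>S2. \<bar>q x\<bar> \<le> C'" by simp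
    have "\<forall>\<^sub>F k in sequentially. e k < 1" by (rule order_tendstoD[OF e_lim]) simp
    then have "\<forall>\<^sub>F k in sequentially. \<bar>\<integral>x. (h x - q x) * (v k x - \<zeta> x) \<partial>\<sigma>\<bar> \<le> r"
    proof eventually_elim
      case (elim k)
      have "\<bar>\<integral>x. (h x - q x) * (v k x - \<zeta> x) \<partial>\<sigma>\<bar> \<le> \<eta> * (2 * T + e k)"
        using pairing_bound[of "\<lambda>x. h x - q x" \<eta> 0 k] q(2)
          continuous_on_measurable_\<sigma>[OF continuous_on_diff[OF assms cq]] by (auto simp: T_def less_imp_le)
      also have "\<dots> \<le> \<eta> * (2 * T + 1)" using elim \<eta> by (intro mult_left_mono) auto
      finally show ?case using \<eta> by simp
    qed
    then show "\<exists>g C'. good g \<and> (\<forall>x\<in>S2. \<bar>g x\<bar> \<le> C') \<and>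
      (\<forall>\<^sub>F k in sequentially. \<bar>\<integral>x. (h x - g x) * (v k x - \<zeta> x) \<partial>\<sigma>\<bar> \<le> r)"
      using gq C' by blast
  qed
qed

text \<open>Closure under bounded pointwise limits. The order of choices matters: the level
  \<open>n\<close> makes the tails of \<zeta> small, then \<open>j\<close> depends on
  \<open>n\<close> through the factor \<open>2 * n\<close>, and only then \<open>k\<close>
  grows.\<close>

lemma good_limit:
  assumes g: "\<And>j. good (h j)" "\<And>j x. x \<in> S2 \<Longrightarrow> \<bar>h j x\<bar> \<le> C"
    and lim: "\<And>x. x \<in> S2 \<Longrightarrow> (\<lambda>j. h j x) \<longlonglongrightarrow> H x"
  shows "good H"
proof -
  have hm: "h j \<in> borel_measurable \<sigma>" for j using g by (simp add: good_def)
  have Hm: "H \<in> borel_measurable \<sigma>"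
    by (rule borel_measurable_LIMSEQ_real[OF _ hm]) (use lim in simp)
  have HC: "\<bar>H x\<bar> \<le> C" if "x \<in> S2" for x
    using tendsto_rabs[OF lim[OF that]] g(2)[OF that] by (intro LIMSEQ_le_const2) auto
  have C0: "0 \<le> C" using HC[of "axis 1 1"] by (simp add: order_trans[OF abs_ge_zero])
  have l1: "(\<lambda>j. \<integral>x. \<bar>H x - h j x\<bar> \<partial>\<sigma>) \<longlonglongrightarrow> 0"
  proof -
    have "(\<lambda>j. \<integral>x. \<bar>H x - h j x\<bar> \<partial>\<sigma>) \<longlonglongrightarrow> (\<integral>x. 0 \<partial>\<sigma>)"
    proof (rule integral_dominated_convergence[where w="\<lambda>x. 2 * C"])
      show "AE x in \<sigma>. (\<lambda>j. \<bar>H x - h j x\<bar>) \<longlonglongrightarrow> 0"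
      proof (rule AE_I2)
        fix x assume "x \<in> space \<sigma>"
        then have "(\<lambda>j. \<bar>H x - h j x\<bar>) \<longlonglongrightarrow> \<bar>H x - H x\<bar>"
          by (intro tendsto_intros lim) simp
        then show "(\<lambda>j. \<bar>H x - h j x\<bar>) \<longlonglongrightarrow> 0" by simp
      qed
      show "AE x in \<sigma>. norm \<bar>H x - h j x\<bar> \<le> 2 * C" for j
      proof (rule AE_I2)
        fix x assume "x \<in> space \<sigma>"
        then show "norm \<bar>H x - h j x\<bar> \<le> 2 * C" using HC[of x] g(2)[of x j] by simp
      qed
    qed (use Hm hm in auto)
    then show ?thesis by simp
  qed
  show ?thesis
  proof (rule good_approx[OF Hm HC])
    fix r :: real assume r: "0 < r"
    have "\<forall>\<^sub>F n in sequentially. 2 * C * (2 * (\<integral>x. tail (real n) (\<zeta> x) \<partial>\<sigma>)) < r / 3"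
      by (rule order_tendstoD) (use r in \<open>auto intro!: tendsto_eq_intros res_lim[of 1]\<close>)
    then obtain n where n: "2 * C * (2 * (\<integral>x. tail (real n) (\<zeta> x) \<partial>\<sigma>)) < r / 3"
      using eventually_happens by force
    have "\<forall>\<^sub>F j in sequentially. 2 * real n * (\<integral>x. \<bar>H x - h j x\<bar> \<partial>\<sigma>) < r / 3"
      by (rule order_tendstoD) (use r in \<open>auto intro!: tendsto_eq_intros l1\<close>)
    then obtain j where j: "2 * real n * (\<integral>x. \<bar>H x - h j x\<bar> \<partial>\<sigma>) < r / 3"
      using eventually_happens by force
    have "\<forall>\<^sub>F k in sequentially. 2 * C * e k < r / 3"
      by (rule order_tendstoD) (use r in \<open>auto intro!: tendsto_eq_intros e_lim\<close>)
    then have "\<forall>\<^sub>F k in sequentially. \<bar>\<integral>x. (H x - h j x) * (v k x - \<zeta> x) \<partial>\<sigma>\<bar> \<le> r"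
    proof eventually_elim
      case (elim k)
      have "\<bar>H x - h j x\<bar> \<le> 2 * C" if "x \<in> S2" for x using HC[OF that] g(2)[OF that, of j] by simp
      then have "\<bar>\<integral>x. (H x - h j x) * (v k x - \<zeta> x) \<partial>\<sigma>\<bar> \<le> 2 * real n * (\<integral>x. \<bar>H x - h j x\<bar> \<partial>\<sigma>)
         + 2 * C * (2 * (\<integral>x. tail (real n) (\<zeta> x) \<partial>\<sigma>) + e k)"
        using Hm hm by (intro pairing_bound) auto
      then show ?case using n j elim by (simp add: distrib_left)
    qed
    then show "\<exists>g C'. good g \<and> (\<forall>x\<in>S2. \<bar>g x\<bar> \<le> C') \<and>
      (\<forall>\<^sub>F k in sequentially. \<bar>\<integral>x. (H x - g x) * (v k x - \<zeta> x) \<partial>\<sigma>\<bar> \<le> r)"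
      using g by blast
  qed
qed

lemma good_cong: "(\<And>x. x \<in> S2 \<Longrightarrow> f x = h x) \<Longrightarrow> good f \<longleftrightarrow> good h"
proof -
  assume eq: "\<And>x. x \<in> S2 \<Longrightarrow> f x = h x"
  have "f \<in> borel_measurable \<sigma> \<longleftrightarrow> h \<in> borel_measurable \<sigma>"
    by (rule measurable_cong) (use eq in simp)
  moreover have "(\<integral>x. f x * (v k x - \<zeta> x) \<partial>\<sigma>) = (\<integral>x. h x * (v k x - \<zeta> x) \<partial>\<sigma>)" for k
    by (rule Bochner_Integration.integral_cong) (use eq in auto)
  ultimately show ?thesis by (simp add: good_def)
qed

lemma good_add:
  assumes "good f" "good h" "\<And>x. x \<in> S2 \<Longrightarrow> \<bar>f x\<bar> \<le> C" "\<And>x. x \<in> S2 \<Longrightarrow> \<bar>h x\<bar> \<le> C'"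
  shows "good (\<lambda>x. f x + h x)"
proof -
  have m: "f \<in> borel_measurable \<sigma>" "h \<in> borel_measurable \<sigma>" using assms by (auto simp: good_def)
  have "(\<integral>x. (f x + h x) * (v k x - \<zeta> x) \<partial>\<sigma>) = (\<integral>x. f x * (v k x - \<zeta> x) \<partial>\<sigma>) + (\<integral>x. h x * (v k x - \<zeta> x) \<partial>\<sigma>)" for k
    unfolding distrib_right
    by (rule Bochner_Integration.integral_add[OF bounded_mult_int[OF m(1) assms(3)] bounded_mult_int[OF m(2) assms(4)]])
  moreover have "(\<lambda>k. (\<integral>x. f x * (v k x - \<zeta> x) \<partial>\<sigma>) + (\<integral>x. h x * (v k x - \<zeta> x) \<partial>\<sigma>)) \<longlonglongrightarrow> 0 + 0"
    using assms by (intro tendsto_add) (auto simp: good_def)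
  ultimately show ?thesis using m by (simp add: good_def)
qed

lemma good_cmult:
  assumes "good f"
  shows "good (\<lambda>x. c * f x)"
proof -
  have "(\<lambda>k. c * (\<integral>x. f x * (v k x - \<zeta> x) \<partial>\<sigma>)) \<longlonglongrightarrow> 0"
    using assms by (intro tendsto_mult_right_zero) (auto simp: good_def)
  moreover have "(\<lambda>x. c * f x) \<in> borel_measurable \<sigma>"
    using assms by (intro borel_measurable_times borel_measurable_const) (simp add: good_def)
  ultimately show ?thesis by (simp add: good_def mult.assoc)
qed

lemma good_sum:
  assumes "finite I" "\<And>i. i \<in> I \<Longrightarrow> good (f i)" "\<And>i x. i \<in> I \<Longrightarrow> x \<in> S2 \<Longrightarrow> \<bar>f i x\<bar> \<le> C"
  shows "good (\<lambda>x. \<Sum>i\<in>I. f i x)"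
  using assms
proof (induction I rule: finite_induct)
  case empty
  then show ?case by (simp add: good_def)
next
  case (insert i I)
  have "\<bar>\<Sum>i\<in>I. f i x\<bar> \<le> (\<Sum>i\<in>I. C)" if "x \<in> S2" for x
    by (rule order_trans[OF sum_abs sum_mono]) (use insert.prems that in auto)
  then have "good (\<lambda>x. f i x + (\<Sum>i\<in>I. f i x))"
    using insert by (intro good_add[of _ _ C "\<Sum>i\<in>I. C"]) auto
  then show ?case using insert by simp
qed

lemma good_indicator_open:
  assumes "open U"
  shows "good (indicator U)"
\<comment> \<open>The distance \<open>infdist\<close> to the empty set is 0 by convention, so the
  approximation by distances to the complement fails for the whole space.\<close>
proof (cases "U = UNIV")
  case True
  then show ?thesis
    by (subst good_cong[of _ "\<lambda>x. 1"]) (auto intro: good_continuous)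
next
  case False
  define h where "h j x = min 1 (real j * infdist x (- U))" for j x
  have lim: "(\<lambda>j. h j x) \<longlonglongrightarrow> indicator U x" for x
  proof (cases "x \<in> U")
    case True
    then have pos: "0 < infdist x (- U)"
      using assms False infdist_pos_not_in_closed[of "- U" x] by (auto simp: closed_Compl)
    have "\<forall>\<^sub>F j in sequentially. 1 / infdist x (- U) \<le> real j"
      using eventually_ge_at_top[of "nat \<lceil>1 / infdist x (- U)\<rceil>"] by eventually_elim linarith
    then have "\<forall>\<^sub>F j in sequentially. h j x = 1"
      by eventually_elim (use pos in \<open>simp add: h_def field_simps min_def\<close>)
    then show ?thesis using True by (simp add: tendsto_eventually)
  next
    case False
    then show ?thesis by (simp add: h_def)
  qed
  show ?thesis
  proof (rule good_limit[where h=h and C=1])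
    show "good (h j)" for j
      unfolding h_def[abs_def] by (intro good_continuous continuous_intros)
    show "\<bar>h j x\<bar> \<le> 1" for j x
      unfolding h_def by (simp add: infdist_nonneg abs_le_iff min_le_iff_disj)
  qed (rule lim)
qed

text \<open>A Dynkin argument: open sets are stable under intersection and generate the Borel sets,
  while complements and countable disjoint unions are handled by linearity and
  \<open>good_limit\<close>.\<close>

lemma good_indicator_borel:
  assumes "A \<in> sets borel"
  shows "good (indicator A)"
proof -
  have "Int_stable {S :: (real^3) set. open S}" by (auto simp: Int_stable_def)
  moreover have "{S :: (real^3) set. open S} \<subseteq> Pow UNIV" by simp
  moreover have "A \<in> sigma_sets UNIV {S. open S}" using assms by (simp add: sets_borel)
  ultimately show ?thesis
  proof (induction A rule: sigma_sets_induct_disjoint)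
    case (basic A)
    then show ?case by (simp add: good_indicator_open)
  next
    case empty
    then show ?case by (simp add: good_def)
  next
    case (compl A)
    have "good (\<lambda>x. 1 + (- 1) * indicator A x)"
      by (rule good_add[OF good_continuous[OF continuous_on_const] good_cmult[OF compl(2)], where C=1 and C'=1])
         (simp_all add: indicator_def)
    moreover have "(\<lambda>x. 1 + (- 1) * indicator A x) = (indicator (UNIV - A) :: _ \<Rightarrow> real)"
      by (auto simp: indicator_def)
    ultimately show ?case by simp
  next
    case (union A)
    have partial: "(\<Sum>i<n. indicator (A i) x) = (indicator (\<Union>i<n. A i) x :: real)" for n x
    proof -
      have "disjoint_family_on A {..<n}" using union(1) by (auto simp: disjoint_family_on_def)
      then show ?thesis by (simp add: indicator_UN_disjoint)
    qed
    show ?case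
    proof (rule good_limit[where h="\<lambda>n x. \<Sum>i<n. indicator (A i) x" and C=1])
      show "good (\<lambda>x. \<Sum>i<n. indicator (A i) x)" for n
        by (rule good_sum[where C=1]) (use union in \<open>auto simp: indicator_def\<close>)
      show "\<bar>\<Sum>i<n. indicator (A i) x\<bar> \<le> (1::real)" for n x
        unfolding partial by (simp add: indicator_def)
      show "(\<lambda>n. \<Sum>i<n. indicator (A i) x) \<longlonglongrightarrow> (indicator (\<Union> (range A)) x :: real)" for x
        unfolding partial by (rule LIMSEQ_indicator_UN)
    qed
  qed
qed

lemma good_indicator:
  assumes "A \<in> sets \<sigma>"
  shows "good (indicator A)"
proof -
  obtain A' where "A' \<in> sets borel" "A = S2 \<inter> A'"
    using assms unfolding sets_\<sigma> sets_restrict_space by auto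
  then show ?thesis
    using good_indicator_borel[of A'] good_cong[of "indicator A" "indicator A'"] by (auto simp: indicator_def)
qed

lemma good_nonneg:
  assumes "h \<in> borel_measurable \<sigma>" "\<And>x. 0 \<le> h x" "\<And>x. x \<in> S2 \<Longrightarrow> h x \<le> C"
  shows "good h"
proof -
  \<comment> \<open>The bound is quantified inside the induction because the pieces have bounds of
    their own; a scalar factor \<open>c\<close> changes \<open>C\<close> to
    \<open>C / c\<close>.\<close>
  have "(\<forall>C. (\<forall>x\<in>S2. h x \<le> C) \<longrightarrow> good h)"
    using assms(1,2)
  proof (induction rule: borel_measurable_induct_real)
    case (set A)
    then show ?case by (simp add: good_indicator)
  next
    case (mult u c)
    show ?case
    proof (intro allI impI)
      fix C assume C: "\<forall>x\<in>S2. c * u x \<le> C"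
      show "good (\<lambda>x. c * u x)"
      proof (cases "c = 0")
        case False
        then have "\<forall>x\<in>S2. u x \<le> C / c" using C mult.hyps(1) by (simp add: field_simps)
        then show ?thesis using mult.IH by (blast intro: good_cmult)
      qed (simp add: good_def)
    qed
  next
    case (add u w)
    show ?case
    proof (intro allI impI)
      fix C assume C: "\<forall>x\<in>S2. w x + u x \<le> C"
      have "u x \<le> C" "w x \<le> C" if "x \<in> S2" for x
        using C that add.hyps(2)[of x] add.hyps(4)[of x] by (smt (verit, best))+
      then show "good (\<lambda>x. w x + u x)"
        using add.hyps(2,4) add.IH[rule_format, of C] by (intro good_add[where C=C and C'=C]) auto
    qed
  next
    case (seq U)
    show ?case
    proof (intro allI impI)
      fix C assume C: "\<forall>x\<in>S2. h x \<le> C"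
      have le: "U i x \<le> C" if x: "x \<in> S2" for i x
      proof -
        have "incseq (\<lambda>i. U i x)" using seq.hyps(3) by (auto simp: incseq_def le_fun_def)
        then have "U i x \<le> h x" using seq.hyps(4)[of x] x by (intro incseq_le) auto
        then show ?thesis using C x by force
      qed
      show "good h"
      proof (rule good_limit[where h=U and C=C])
        show "good (U j)" for j using seq.IH le by blast
        show "\<bar>U j x\<bar> \<le> C" if "x \<in> S2" for j x using le[OF that] seq.hyps(2) by simp
        show "(\<lambda>j. U j x) \<longlonglongrightarrow> h x" if "x \<in> S2" for x using seq.hyps(4) that by simp
      qed
    qed
  qed
  then show ?thesis using assms(3) by blast
qed

lemma good_bounded:
  assumes "h \<in> borel_measurable \<sigma>" "\<And>x. \<bar>h x\<bar> \<le> C"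
  shows "good h"
proof -
  have hC: "- C \<le> h x \<and> h x \<le> C" for x using assms(2)[of x] by (simp add: abs_le_iff)
  have "good (\<lambda>x. h x + C)"
  proof (rule good_nonneg[where C="2 * C"])
    show "0 \<le> h x + C" "h x + C \<le> 2 * C" for x using hC[of x] by linarith+
  qed (use assms in simp)
  then have "good (\<lambda>x. (h x + C) + (- C))"
  proof (rule good_add[OF _ good_continuous[OF continuous_on_const]])
    show "\<bar>h x + C\<bar> \<le> 2 * C" "\<bar>- C\<bar> \<le> \<bar>C\<bar>" for x using hC[of x] by linarith+
  qed
  then show ?thesis by simp
qed

section \<open>Strong convergence of the truncations and of the sequence\<close>

lemma trunc_\<zeta>_meas: "(\<lambda>x. trunc M (\<zeta> x)) \<in> borel_measurable \<sigma>"
  using \<zeta>_meas by measurable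

lemma huber_\<zeta>_int:
  assumes M: "0 \<le> M"
  shows "integrable \<sigma> (\<lambda>x. huber M (\<zeta> x))"
proof (rule Bochner_Integration.integrable_bound)
  show "integrable \<sigma> (\<lambda>x. M * \<bar>\<zeta> x\<bar>)" using \<zeta>_int by simp
  show "AE x in \<sigma>. norm (huber M (\<zeta> x)) \<le> norm (M * \<bar>\<zeta> x\<bar>)"
    using huber_lipschitz[OF M, of _ 0] M by (intro AE_I2) (simp add: huber_def trunc_def abs_mult)
  show "(\<lambda>x. huber M (\<zeta> x)) \<in> borel_measurable \<sigma>" using \<zeta>_meas by measurable
qed

text \<open>The Bregman divergence of the Huber function turns weak convergence plus equimeasurability into
  \<open>L\<^sup>2\<close> convergence of the truncations.\<close>

lemma trunc_L2:
  assumes M: "0 \<le> M"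
  shows "(\<lambda>k. \<integral>x. (trunc M (v k x) - trunc M (\<zeta> x))\<^sup>2 \<partial>\<sigma>) \<longlonglongrightarrow> 0"
proof -
  let ?B = "\<lambda>k. \<integral>x. trunc M (\<zeta> x) * (v k x - \<zeta> x) \<partial>\<sigma>"
  have ch: "continuous_on UNIV (huber M)" by (rule continuous_on_huber)
  note intv = continuous_comp_int[OF ch] and int\<zeta> = huber_\<zeta>_int[OF M]
  have intB: "integrable \<sigma> (\<lambda>x. trunc M (\<zeta> x) * (v k x - \<zeta> x))" for k
    by (rule bounded_mult_int[OF trunc_\<zeta>_meas]) (use trunc_abs_le[OF M] in auto)
  have "good (\<lambda>x. trunc M (\<zeta> x))"
    by (rule good_bounded[OF trunc_\<zeta>_meas]) (rule trunc_abs_le[OF M])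
  then have B: "?B \<longlonglongrightarrow> 0" by (simp add: good_def)
  have bound: "(\<integral>x. (trunc M (v k x) - trunc M (\<zeta> x))\<^sup>2 \<partial>\<sigma>) \<le> 2 * (M * e k - ?B k)" for k
  proof -
    have "(\<integral>x. (trunc M (v k x) - trunc M (\<zeta> x))\<^sup>2 \<partial>\<sigma>)
      \<le> (\<integral>x. 2 * (huber M (v k x) - huber M (\<zeta> x) - trunc M (\<zeta> x) * (v k x - \<zeta> x)) \<partial>\<sigma>)"
    proof (rule integral_mono')
      show "integrable \<sigma> (\<lambda>x. 2 * (huber M (v k x) - huber M (\<zeta> x) - trunc M (\<zeta> x) * (v k x - \<zeta> x)))"
        using intv int\<zeta> intB by (intro integrable_mult_right Bochner_Integration.integrable_diff) auto
      show *: "(trunc M (v k x) - trunc M (\<zeta> x))\<^sup>2 \<le> 2 * (huber M (v k x) - huber M (\<zeta> x) - trunc M (\<zeta> x) * (v k x - \<zeta> x))" for x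
        using huber_bregman[OF M, of "v k x" "\<zeta> x"] by simp
      show "0 \<le> 2 * (huber M (v k x) - huber M (\<zeta> x) - trunc M (\<zeta> x) * (v k x - \<zeta> x))" for x
        by (rule order_trans[OF zero_le_power2 *])
    qed
    also have "\<dots> = 2 * ((\<integral>x. huber M (v k x) \<partial>\<sigma>) - (\<integral>x. huber M (\<zeta> x) \<partial>\<sigma>) - ?B k)"
      using intv int\<zeta> intB by simp
    finally have 1: "(\<integral>x. (trunc M (v k x) - trunc M (\<zeta> x))\<^sup>2 \<partial>\<sigma>)
      \<le> 2 * ((\<integral>x. huber M (v k x) \<partial>\<sigma>) - (\<integral>x. huber M (\<zeta> x) \<partial>\<sigma>) - ?B k)" .
    \<comment> \<open>Weak convergence gives no upper bound for a convex integral; equimeasurability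
      supplies it by exchanging \<open>v k\<close> for \<open>v0 k\<close>, at the cost
      \<open>M * e k\<close>.\<close>
    have "(\<integral>x. huber M (v k x) \<partial>\<sigma>) = (\<integral>x. huber M (v0 k x) \<partial>\<sigma>)" by (rule equi[OF ch])
    also have "\<dots> \<le> (\<integral>x. huber M (\<zeta> x) + M * \<bar>v0 k x - \<zeta> x\<bar> \<partial>\<sigma>)"
    proof (rule integral_mono)
      show "integrable \<sigma> (\<lambda>x. huber M (\<zeta> x) + M * \<bar>v0 k x - \<zeta> x\<bar>)"
        by (intro Bochner_Integration.integrable_add int\<zeta> integrable_mult_right integrable_abs
            Bochner_Integration.integrable_diff v0_int \<zeta>_int)
      show "huber M (v0 k x) \<le> huber M (\<zeta> x) + M * \<bar>v0 k x - \<zeta> x\<bar>" for x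
        using huber_lipschitz[OF M, of "v0 k x" "\<zeta> x"] by linarith
    qed (rule intv)
    also have "\<dots> = (\<integral>x. huber M (\<zeta> x) \<partial>\<sigma>) + M * e k"
      unfolding e_def using int\<zeta> v0_int \<zeta>_int by simp
    finally show ?thesis using 1 by simp
  qed
  have "(\<lambda>k. 2 * (M * e k - ?B k)) \<longlonglongrightarrow> 2 * (M * 0 - 0)"
    by (intro tendsto_intros e_lim B)
  then have "(\<lambda>k. 2 * (M * e k - ?B k)) \<longlonglongrightarrow> 0" by simp
  from this show ?thesis
    by (rule tendsto_sandwich[OF _ _ tendsto_const, rotated 2]) (intro always_eventually allI; (rule bound | simp))+
qed

lemma res_v_le:
  assumes M: "0 \<le> M"
  shows "(\<integral>x. res p M (v k x) \<partial>\<sigma>) \<le> 3 powr p * ((\<integral>x. res p M (\<zeta> x) \<partial>\<sigma>) + (\<integral>x. \<bar>v0 k x - \<zeta> x\<bar> powr p \<partial>\<sigma>))"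
proof -
  have "(\<integral>x. res p M (v k x) \<partial>\<sigma>) = (\<integral>x. res p M (v0 k x) \<partial>\<sigma>)" by (rule equi[OF continuous_on_res], use p in simp)
  also have "\<dots> \<le> (\<integral>x. 3 powr p * (res p M (\<zeta> x) + \<bar>v0 k x - \<zeta> x\<bar> powr p) \<partial>\<sigma>)"
  proof (rule integral_mono)
    show "integrable \<sigma> (\<lambda>x. res p M (v0 k x))" by (intro continuous_comp_int continuous_on_res) (use p in simp)
    show "integrable \<sigma> (\<lambda>x. 3 powr p * (res p M (\<zeta> x) + \<bar>v0 k x - \<zeta> x\<bar> powr p))"
      by (intro integrable_mult_right Bochner_Integration.integrable_add res_\<zeta>_int disjI2 refl M diff_powr_int v0_cont)
    fix x
    let ?a = "\<zeta> x - trunc M (\<zeta> x)" and ?b = "(v0 k x - trunc M (v0 k x)) - (\<zeta> x - trunc M (\<zeta> x))"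
    have "res p M (v0 k x) = \<bar>?a + ?b\<bar> powr p" by (simp add: res_def)
    also have "\<dots> \<le> 3 powr p * (\<bar>?a\<bar> powr p + \<bar>?b\<bar> powr p)" by (rule abs_powr_add_le) (use p in simp)
    also have "\<dots> \<le> 3 powr p * (res p M (\<zeta> x) + \<bar>v0 k x - \<zeta> x\<bar> powr p)"
      unfolding res_def using p trunc_residual_lipschitz
      by (intro mult_left_mono add_mono powr_mono2) auto
    finally show "res p M (v0 k x) \<le> 3 powr p * (res p M (\<zeta> x) + \<bar>v0 k x - \<zeta> x\<bar> powr p)" .
  qed
  also have "\<dots> = 3 powr p * ((\<integral>x. res p M (\<zeta> x) \<partial>\<sigma>) + (\<integral>x. \<bar>v0 k x - \<zeta> x\<bar> powr p \<partial>\<sigma>))"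
    using res_\<zeta>_int[OF disjI2[OF refl] M] diff_powr_int[OF v0_cont] by simp
  finally show ?thesis .
qed

lemma trunc_sq_int: "0 \<le> M \<Longrightarrow> integrable \<sigma> (\<lambda>x. (trunc M (v k x) - trunc M (\<zeta> x))\<^sup>2)"
proof (rule S.integrable_const_bound[where B="(2 * M)\<^sup>2"])
  assume M: "0 \<le> M"
  have "\<bar>trunc M a - trunc M b\<bar> \<le> 2 * M" for a b
    using trunc_abs_le[OF M, of a] trunc_abs_le[OF M, of b] by linarith
  then have "\<bar>trunc M a - trunc M b\<bar> \<le> \<bar>2 * M\<bar>" for a b by (rule order_trans) simp
  then have "(trunc M a - trunc M b)\<^sup>2 \<le> (2 * M)\<^sup>2" for a b by (rule abs_le_square_iff[THEN iffD1])
  then show "AE x in \<sigma>. norm ((trunc M (v k x) - trunc M (\<zeta> x))\<^sup>2) \<le> (2 * M)\<^sup>2"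
    by (intro AE_I2) (simp only: real_norm_def abs_power2)
  show "(\<lambda>x. (trunc M (v k x) - trunc M (\<zeta> x))\<^sup>2) \<in> borel_measurable \<sigma>"
    using \<zeta>_meas borel_measurable_integrable[OF v_int[of k]] by measurable
qed

text \<open>The difference is split into the excess of \<open>v k\<close>, the difference of
  truncations and the excess of \<zeta>. The level \<open>n\<close> makes both excesses small
  uniformly in \<open>k\<close>, up to the initial error; at this fixed level
  \<open>trunc_L2\<close> applies.\<close>

lemma Lp_convergence: "(\<lambda>k. \<integral>x. \<bar>v k x - \<zeta> x\<bar> powr p \<partial>\<sigma>) \<longlonglongrightarrow> 0"
proof (rule LIMSEQ_I)
  fix r :: real assume r: "0 < r"
  define c where "c = (3::real) powr p"
  have c: "1 \<le> c" unfolding c_def using p by (intro ge_one_powr_ge_zero) auto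
  have "\<forall>\<^sub>F n in sequentially. c * (c + 1) * (\<integral>x. res p (real n) (\<zeta> x) \<partial>\<sigma>) < r / 4"
    by (rule order_tendstoD) (use r in \<open>auto intro!: tendsto_eq_intros res_lim[of p]\<close>)
  then obtain n where n: "c * (c + 1) * (\<integral>x. res p (real n) (\<zeta> x) \<partial>\<sigma>) < r / 4"
    using eventually_happens by force
  define M where "M = real n"
  have M: "0 \<le> M" by (simp add: M_def)
  define \<eta> where "\<eta> = r / (4 * c * area)"
  have \<eta>: "0 < \<eta>" "c * (\<eta> * area) = r / 4" using r c area_pos by (auto simp: \<eta>_def field_simps)
  \<comment> \<open>The constant of \<open>abs_powr_le_square\<close> for a difference of two
    truncations, which is at most \<open>2 * M\<close> in absolute value.\<close>
  define K where "K = (2 * M) powr p / (\<eta> powr (1 / p))\<^sup>2"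
  let ?T = "\<lambda>k. \<integral>x. (trunc M (v k x) - trunc M (\<zeta> x))\<^sup>2 \<partial>\<sigma>"
  let ?D = "\<lambda>k. \<integral>x. \<bar>v0 k x - \<zeta> x\<bar> powr p \<partial>\<sigma>"
  have bound: "(\<integral>x. \<bar>v k x - \<zeta> x\<bar> powr p \<partial>\<sigma>)
      \<le> c * (c + 1) * (\<integral>x. res p M (\<zeta> x) \<partial>\<sigma>) + c * (\<eta> * area) + (c * c * ?D k + c * K * ?T k)" for k
  proof -
    have "(\<integral>x. \<bar>v k x - \<zeta> x\<bar> powr p \<partial>\<sigma>) \<le> (\<integral>x. c * (res p M (v k x) + (\<eta> + K * (trunc M (v k x) - trunc M (\<zeta> x))\<^sup>2) + res p M (\<zeta> x)) \<partial>\<sigma>)"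
    proof (rule integral_mono)
      show "integrable \<sigma> (\<lambda>x. \<bar>v k x - \<zeta> x\<bar> powr p)" by (rule diff_powr_int[OF v_cont])
      show "integrable \<sigma> (\<lambda>x. c * (res p M (v k x) + (\<eta> + K * (trunc M (v k x) - trunc M (\<zeta> x))\<^sup>2) + res p M (\<zeta> x)))"
        by (intro integrable_mult_right Bochner_Integration.integrable_add res_\<zeta>_int disjI2 refl M trunc_sq_int
            continuous_comp_int continuous_on_res S.integrable_const) (use p in simp_all)
      fix x
      let ?a = "v k x - trunc M (v k x)" and ?b = "trunc M (v k x) - trunc M (\<zeta> x)" and ?c = "trunc M (\<zeta> x) - \<zeta> x"
      have "\<bar>v k x - \<zeta> x\<bar> powr p = \<bar>?a + ?b + ?c\<bar> powr p" by simp
      also have "\<dots> \<le> c * (\<bar>?a\<bar> powr p + \<bar>?b\<bar> powr p + \<bar>?c\<bar> powr p)"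
        unfolding c_def by (rule abs_powr_sum3_le) (use p in simp)
      also have "\<dots> \<le> c * (res p M (v k x) + (\<eta> + K * ?b\<^sup>2) + res p M (\<zeta> x))"
      proof (intro mult_left_mono add_mono)
        show "\<bar>?b\<bar> powr p \<le> \<eta> + K * ?b\<^sup>2"
          unfolding K_def using p \<eta> trunc_abs_le[OF M, of "v k x"] trunc_abs_le[OF M, of "\<zeta> x"]
          by (intro abs_powr_le_square) auto
      qed (use c in \<open>auto simp: res_def abs_minus_commute\<close>)
      finally show "\<bar>v k x - \<zeta> x\<bar> powr p \<le> c * (res p M (v k x) + (\<eta> + K * ?b\<^sup>2) + res p M (\<zeta> x))" .
    qed
    also have "\<dots> = c * ((\<integral>x. res p M (v k x) \<partial>\<sigma>) + (\<eta> * area + K * ?T k) + (\<integral>x. res p M (\<zeta> x) \<partial>\<sigma>))"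
      using res_\<zeta>_int[of p, OF _ M] trunc_sq_int[OF M, of k] continuous_comp_int[OF continuous_on_res[of p UNIV M], of k] p
      by (simp add: mult.commute[of area])
    also have "\<dots> \<le> c * (c * ((\<integral>x. res p M (\<zeta> x) \<partial>\<sigma>) + ?D k) + (\<eta> * area + K * ?T k) + (\<integral>x. res p M (\<zeta> x) \<partial>\<sigma>))"
      using c res_v_le[OF M, of k] by (intro mult_left_mono add_right_mono) (auto simp: c_def)
    finally show ?thesis by (simp add: algebra_simps)
  qed
  have "(\<lambda>k. c * c * ?D k + c * K * ?T k) \<longlonglongrightarrow> c * c * 0 + c * K * 0"
    by (intro tendsto_intros v0_lim trunc_L2 M)
  then have "\<forall>\<^sub>F k in sequentially. c * c * ?D k + c * K * ?T k < r / 4"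
    by (rule order_tendstoD) (use r in simp)
  then have "\<forall>\<^sub>F k in sequentially. (\<integral>x. \<bar>v k x - \<zeta> x\<bar> powr p \<partial>\<sigma>) < r"
  proof eventually_elim
    case (elim k)
    show ?case using bound[of k] n elim \<eta>(2) r unfolding M_def by linarith
  qed
  then show "\<exists>no. \<forall>k\<ge>no. norm ((\<integral>x. \<bar>v k x - \<zeta> x\<bar> powr p \<partial>\<sigma>) - 0) < r"
    by (simp add: eventually_sequentially)
qed

end

section \<open>Stability\<close>

text \<open>The derivative of \<open>F\<close> is minus the generalised inverse of \<open>g\<close>, cut off at \<open>\<plusminus>B\<close>; the cut-off is
  what makes \<open>F\<close> Lipschitz.\<close>

lemma antimono_convex_primitive:
  fixes g :: "real \<Rightarrow> ereal"
  assumes g: "antimono g" and B: "0 \<le> B"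
  obtains F :: "real \<Rightarrow> real" where "\<And>a b. \<bar>F a - F b\<bar> \<le> B * \<bar>a - b\<bar>"
    "\<And>\<theta> a b. \<bar>\<theta>\<bar> \<le> B \<Longrightarrow> g \<theta> = ereal b \<Longrightarrow> F b - \<theta> * (a - b) \<le> F a"
proof -
  \<comment> \<open>Inserting \<open>- B\<close> keeps the set nonempty even when \<open>g\<close>
    stays below \<open>s\<close> on all of \<open>{-B..B}\<close>.\<close>
  define L where "L s = insert (- B) {\<theta> \<in> {-B..B}. ereal s \<le> g \<theta>}" for s
  define \<gamma> where "\<gamma> s = Sup (L s)" for s
  have bdd: "bdd_above (L s)" for s
    using B by (intro bdd_aboveI[of _ B]) (auto simp: L_def)
  have ne: "L s \<noteq> {}" for s by (auto simp: L_def)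
  have \<gamma>_le: "\<gamma> s \<le> \<theta>" if "\<bar>\<theta>\<bar> \<le> B" "g \<theta> < ereal s" for s \<theta>
    unfolding \<gamma>_def
  proof (rule cSup_least[OF ne])
    fix x assume "x \<in> L s"
    then consider "x = - B" | "ereal s \<le> g x" by (auto simp: L_def)
    then show "x \<le> \<theta>"
    proof cases
      case 2
      then have "\<not> \<theta> \<le> x" using that(2) antimonoD[OF g, of \<theta> x] by auto
      then show ?thesis by simp
    qed (use that in auto)
  qed
  have \<gamma>_ge: "\<theta> \<le> \<gamma> s" if "\<bar>\<theta>\<bar> \<le> B" "ereal s \<le> g \<theta>" for s \<theta>
    unfolding \<gamma>_def by (rule cSup_upper[OF _ bdd]) (use that in \<open>auto simp: L_def\<close>)
  have \<gamma>_bound: "- B \<le> \<gamma> s" "\<gamma> s \<le> B" for s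
  proof -
    show "- B \<le> \<gamma> s" unfolding \<gamma>_def by (rule cSup_upper[OF _ bdd]) (simp add: L_def)
    show "\<gamma> s \<le> B" unfolding \<gamma>_def by (rule cSup_least[OF ne]) (use B in \<open>auto simp: L_def\<close>)
  qed
  have mono: "mono_on {a..b} (\<lambda>s. - \<gamma> s)" for a b
  proof (rule mono_onI)
    fix r s :: real assume "r \<le> s"
    then have "L s \<subseteq> L r" by (auto simp: L_def intro: order_trans[of "ereal r" "ereal s"])
    then show "- \<gamma> r \<le> - \<gamma> s"
      unfolding \<gamma>_def by (simp add: cSup_subset_mono[OF ne bdd])
  qed
  have int: "\<gamma> integrable_on {a..b}" for a b
    using integrable_neg[OF integrable_on_mono_on[OF mono]] by simp
  define F where "F a = (if 0 \<le> a then - integral {0..a} \<gamma> else integral {a..0} \<gamma>)" for a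
  have F: "F b = F a - integral {a..b} \<gamma>" if "a \<le> b" for a b
  proof -
    consider "0 \<le> a" | "a < 0" "0 \<le> b" | "b < 0" using that by linarith
    then show ?thesis
    proof cases
      case 1
      then show ?thesis using that Henstock_Kurzweil_Integration.integral_combine[OF _ that int, of 0] by (simp add: F_def)
    next
      case 2
      then show ?thesis using Henstock_Kurzweil_Integration.integral_combine[of a 0 b, OF _ _ int] by (simp add: F_def)
    next
      case 3
      then show ?thesis using that Henstock_Kurzweil_Integration.integral_combine[of a b 0, OF that _ int] by (simp add: F_def)
    qed
  qed
  have Lip: "\<bar>F b - F a\<bar> \<le> B * \<bar>b - a\<bar>" if "a \<le> b" for a b
  proof -
    have "integral {a..b} (\<lambda>s. - B) \<le> integral {a..b} \<gamma>" "integral {a..b} \<gamma> \<le> integral {a..b} (\<lambda>s. B)"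
      by (intro integral_le int integrable_const_ivl \<gamma>_bound)+
    then show ?thesis unfolding F[OF that] using that by (simp add: abs_le_iff mult.commute)
  qed
  show thesis
  proof (rule that)
    show "\<bar>F a - F b\<bar> \<le> B * \<bar>a - b\<bar>" for a b
      using Lip[of a b] Lip[of b a] by (cases "a \<le> b") (auto simp: abs_minus_commute)
    fix \<theta> a b :: real assume \<theta>: "\<bar>\<theta>\<bar> \<le> B" and gb: "g \<theta> = ereal b"
    show "F b - \<theta> * (a - b) \<le> F a"
    proof (cases "b \<le> a")
      case True
      \<comment> \<open>At \<open>s = b\<close> there is equality
        \<open>g \<theta> = ereal s\<close>, where \<open>\<gamma>_le\<close> does not apply and
        \<gamma> may exceed \<theta> if \<open>g\<close> is constant there; the value at this single
        point is changed.\<close>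
      have "integral {b..a} \<gamma> = integral {b..a} (\<lambda>s. if s = b then \<theta> else \<gamma> s)"
        by (rule integral_spike[of "{b}"]) auto
      also have "\<dots> \<le> integral {b..a} (\<lambda>s. \<theta>)"
      proof (rule integral_le)
        show "(\<lambda>s. if s = b then \<theta> else \<gamma> s) integrable_on {b..a}"
          by (rule integrable_spike[OF int, of "{b}"]) auto
        show "(if s = b then \<theta> else \<gamma> s) \<le> \<theta>" if "s \<in> {b..a}" for s
          using \<gamma>_le[OF \<theta>, of s] gb that by auto
      qed (rule integrable_const_ivl)
      finally show ?thesis using True F[OF True] by (simp add: mult.commute)
    next
      case False
      then have ab: "a \<le> b" by simp
      have "integral {a..b} (\<lambda>s. \<theta>) \<le> integral {a..b} \<gamma>"
        by (intro integral_le integrable_const_ivl int \<gamma>_ge[OF \<theta>]) (use gb in auto)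
      then show ?thesis using ab F[OF ab] by (simp add: algebra_simps)
    qed
  qed
qed

text \<open>The constant \<open>C\<close> precedes the solution, the time and \<open>d\<close>, so
  the estimate is uniform in time. A bound linear in \<open>d\<close> suffices, which is where
  \<open>d \<le> 1\<close> enters.\<close>

lemma energy_difference_bound:
  fixes g :: "real \<Rightarrow> ereal"
  assumes p: "1 < p" and \<zeta>: "in_Lp p \<zeta>" and u: "green_potential \<zeta> u" and g: "antimono g"
    and eq: "AE x in \<sigma>. ereal (\<zeta> x) = g (u x + \<beta> * (P \<bullet> x))"
  shows "\<exists>C. \<forall>Z \<psi> Zt Zx w t d. smooth_flow Z \<psi> Zt Zx w \<longrightarrow> 0 < d \<longrightarrow> d \<le> 1 \<longrightarrow>
      (\<integral>x. \<bar>Z 0 x - \<zeta> x\<bar> powr p \<partial>\<sigma>) \<le> d powr p \<longrightarrow>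
      (\<integral>x. (\<psi> t x - u x) * (Z t x - \<zeta> x) \<partial>\<sigma>) \<le> C * d"
proof -
  define \<Theta> where "\<Theta> x = u x + \<beta> * (P \<bullet> x)" for x
  have cu: "continuous_on S2 u" and int\<zeta>: "integrable \<sigma> \<zeta>" using u by (auto simp: green_potential_def)
  have c\<Theta>: "continuous_on S2 \<Theta>" unfolding \<Theta>_def by (intro continuous_intros cu)
  obtain B where B: "0 \<le> B" "\<And>x. x \<in> S2 \<Longrightarrow> norm (\<Theta> x) \<le> B"
    using continuous_on_S2_bounded[OF c\<Theta>] by blast
  obtain F where F: "\<And>a b. \<bar>F a - F b\<bar> \<le> B * \<bar>a - b\<bar>"
    "\<And>\<theta> a b. \<bar>\<theta>\<bar> \<le> B \<Longrightarrow> g \<theta> = ereal b \<Longrightarrow> F b - \<theta> * (a - b) \<le> F a"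
    using antimono_convex_primitive[OF g B(1)] by blast
  have cF: "continuous_on UNIV F"
  proof (rule continuous_onI)
    fix x e :: real assume e: "0 < e"
    show "\<exists>d>0. \<forall>x'\<in>UNIV. dist x' x < d \<longrightarrow> dist (F x') (F x) \<le> e"
    proof (intro exI[of _ "e / (B + 1)"] conjI ballI impI)
      fix y assume "dist y x < e / (B + 1)"
      then have "(B + 1) * \<bar>y - x\<bar> < e" using B(1) by (simp add: dist_real_def field_simps)
      moreover have "B * \<bar>y - x\<bar> \<le> (B + 1) * \<bar>y - x\<bar>" by (intro mult_right_mono) auto
      ultimately show "dist (F y) (F x) \<le> e" using F(1)[of y x] by (simp add: dist_real_def)
    qed (use e B in simp)
  qed
  have mF: "F \<in> borel_measurable borel" by (rule borel_measurable_continuous_onI[OF cF])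
  have intF\<zeta>: "integrable \<sigma> (\<lambda>x. F (\<zeta> x))"
  proof (rule Bochner_Integration.integrable_bound)
    show "integrable \<sigma> (\<lambda>x. \<bar>F 0\<bar> + B * \<bar>\<zeta> x\<bar>)"
      using int\<zeta> by (intro Bochner_Integration.integrable_add S.integrable_const integrable_mult_right integrable_abs)
    show "AE x in \<sigma>. norm (F (\<zeta> x)) \<le> norm (\<bar>F 0\<bar> + B * \<bar>\<zeta> x\<bar>)"
    proof (rule AE_I2)
      fix x
      have "\<bar>F (\<zeta> x)\<bar> \<le> \<bar>F 0\<bar> + B * \<bar>\<zeta> x\<bar>" using F(1)[of "\<zeta> x" 0] by simp
      then show "norm (F (\<zeta> x)) \<le> norm (\<bar>F 0\<bar> + B * \<bar>\<zeta> x\<bar>)" by simp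
    qed
    show "(\<lambda>x. F (\<zeta> x)) \<in> borel_measurable \<sigma>"
      using mF borel_measurable_integrable[OF int\<zeta>] by measurable
  qed
  define K where "K = 2 * area + 1"
  \<comment> \<open>The first summand bounds the initial energy, the sup of the potential difference
    times the initial \<open>L^1\<close> distance, which is at most \<open>K * d\<close>. The second
    is twice the bound \<open>2 * B * K * d\<close> for the change of the pairing with
    \<Theta>.\<close>
  define C where "C = K * suminf (green_const p) / area * K + 4 * B * K"
  have K: "0 \<le> K" using area_pos by (simp add: K_def)
  have G0: "0 \<le> suminf (green_const p)"
    by (intro suminf_nonneg summable_green_const p) (simp add: green_const_def)
  have "(\<integral>x. (\<psi> t x - u x) * (Z t x - \<zeta> x) \<partial>\<sigma>) \<le> C * d"
    if flow: "smooth_flow Z \<psi> Zt Zx w" and d: "0 < d" "d \<le> 1"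
      and near: "(\<integral>x. \<bar>Z 0 x - \<zeta> x\<bar> powr p \<partial>\<sigma>) \<le> d powr p" for Z \<psi> Zt Zx w t d
  proof -
    interpret smooth_flow Z \<psi> Zt Zx w by (rule flow)
    have intZ: "integrable \<sigma> (Z s)" for s by (rule integrable_\<sigma>_continuous[OF Z_cont_slice])
    have int: "integrable \<sigma> (\<lambda>x. h x * Z s x)" "integrable \<sigma> (\<lambda>x. h x * \<zeta> x)" if "continuous_on S2 h" for s h
      by (intro integrable_\<sigma>_mult_continuous that intZ int\<zeta>)+
    define E where "E s = (\<integral>x. (\<psi> s x - u x) * (Z s x - \<zeta> x) \<partial>\<sigma>)" for s
    have E: "E s = (\<integral>x. \<psi> s x * Z s x \<partial>\<sigma>) - 2 * (\<integral>x. u x * Z s x \<partial>\<sigma>) + (\<integral>x. u x * \<zeta> x \<partial>\<sigma>)" for s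
    proof -
      have "E s = (\<integral>x. \<psi> s x * Z s x - \<psi> s x * \<zeta> x - u x * Z s x + u x * \<zeta> x \<partial>\<sigma>)"
        unfolding E_def by (simp add: algebra_simps)
      also have "\<dots> = (\<integral>x. \<psi> s x * Z s x \<partial>\<sigma>) - (\<integral>x. \<psi> s x * \<zeta> x \<partial>\<sigma>) - (\<integral>x. u x * Z s x \<partial>\<sigma>) + (\<integral>x. u x * \<zeta> x \<partial>\<sigma>)"
        using int[OF psi_cont] int[OF cu] by simp
      also have "(\<integral>x. \<psi> s x * \<zeta> x \<partial>\<sigma>) = (\<integral>x. u x * Z s x \<partial>\<sigma>)"
        by (rule green_potential_symmetric[OF pot u])
      finally show ?thesis by simp
    qed
    have \<Theta>: "(\<integral>x. \<Theta> x * Z s x \<partial>\<sigma>) = (\<integral>x. u x * Z s x \<partial>\<sigma>) + \<beta> * (\<integral>x. (P \<bullet> x) * Z s x \<partial>\<sigma>)" for s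
    proof -
      have "(\<integral>x. \<Theta> x * Z s x \<partial>\<sigma>) = (\<integral>x. u x * Z s x + \<beta> * ((P \<bullet> x) * Z s x) \<partial>\<sigma>)"
        by (simp add: \<Theta>_def algebra_simps)
      also have "\<dots> = (\<integral>x. u x * Z s x \<partial>\<sigma>) + (\<integral>x. \<beta> * ((P \<bullet> x) * Z s x) \<partial>\<sigma>)"
        by (intro Bochner_Integration.integral_add integrable_mult_right int cu continuous_intros)
      finally show ?thesis by simp
    qed
    \<comment> \<open>Conservation of angular momentum allows \<open>u\<close> to be replaced by
      \<Theta>, the function in terms of which \<zeta> is a profile.\<close>
    have Et: "E t = E 0 + 2 * ((\<integral>x. \<Theta> x * Z 0 x \<partial>\<sigma>) - (\<integral>x. \<Theta> x * Z t x \<partial>\<sigma>))"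
      unfolding E \<Theta> using energy_conserved[of t 0] momentum_conserved[of P t 0] by simp
    define I where "I = (\<integral>x. \<bar>Z 0 x - \<zeta> x\<bar> \<partial>\<sigma>)"
    have intw: "integrable \<sigma> (\<lambda>x. \<bar>Z 0 x - \<zeta> x\<bar>)"
      by (intro integrable_abs Bochner_Integration.integrable_diff intZ int\<zeta>)
    have Z0: "in_Lp p (\<lambda>x. Z 0 x - \<zeta> x)"
      using p by (intro in_Lp_continuous_diff \<zeta> Z_cont_slice) simp
    have I: "I \<le> K * d"
    proof -
      have "axis 1 1 \<in> S2" by simp
      from abs_moment_Lp_le[OF Z0 p d(1) near this, of 0] show ?thesis by (simp add: I_def K_def)
    qed
    have E0: "E 0 \<le> K * suminf (green_const p) / area * I"
    proof -
      have sup: "\<bar>\<psi> 0 x - u x\<bar> \<le> K * suminf (green_const p) / area" if x: "x \<in> S2" for x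
      proof -
        have "area * \<bar>\<psi> 0 x - u x\<bar> \<le> K * d * suminf (green_const p)"
          unfolding K_def by (rule green_potential_Lp_bound[OF green_potential_diff[OF pot u] Z0 p d(1) near x])
        also have "\<dots> \<le> K * 1 * suminf (green_const p)"
          using K G0 d by (intro mult_right_mono mult_left_mono) auto
        finally show ?thesis using area_pos by (simp add: field_simps)
      qed
      have "E 0 \<le> (\<integral>x. K * suminf (green_const p) / area * \<bar>Z 0 x - \<zeta> x\<bar> \<partial>\<sigma>)"
        unfolding E_def
      proof (rule integral_mono)
        show "integrable \<sigma> (\<lambda>x. (\<psi> 0 x - u x) * (Z 0 x - \<zeta> x))"
          by (intro integrable_\<sigma>_mult_continuous continuous_intros psi_cont cu Bochner_Integration.integrable_diff intZ int\<zeta>)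
        fix x assume "x \<in> space \<sigma>"
        then have x: "x \<in> S2" by simp
        have "(\<psi> 0 x - u x) * (Z 0 x - \<zeta> x) \<le> \<bar>\<psi> 0 x - u x\<bar> * \<bar>Z 0 x - \<zeta> x\<bar>"
          by (metis abs_ge_self abs_mult)
        also have "\<dots> \<le> K * suminf (green_const p) / area * \<bar>Z 0 x - \<zeta> x\<bar>"
          using sup[OF x] by (rule mult_right_mono) simp
        finally show "(\<psi> 0 x - u x) * (Z 0 x - \<zeta> x) \<le> K * suminf (green_const p) / area * \<bar>Z 0 x - \<zeta> x\<bar>" .
      qed (intro integrable_mult_right intw)
      then show ?thesis by (simp add: I_def)
    qed
    have intFZ: "integrable \<sigma> (\<lambda>x. F (Z s x))" for s
      by (intro integrable_\<sigma>_continuous continuous_on_compose2[OF cF Z_cont_slice]) auto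
    have 1: "(\<integral>x. F (\<zeta> x) \<partial>\<sigma>) - ((\<integral>x. \<Theta> x * Z t x \<partial>\<sigma>) - (\<integral>x. \<Theta> x * \<zeta> x \<partial>\<sigma>)) \<le> (\<integral>x. F (Z t x) \<partial>\<sigma>)"
    proof -
      have "(\<integral>x. F (\<zeta> x) - (\<Theta> x * Z t x - \<Theta> x * \<zeta> x) \<partial>\<sigma>) \<le> (\<integral>x. F (Z t x) \<partial>\<sigma>)"
      proof (rule integral_mono_AE)
        show "AE x in \<sigma>. F (\<zeta> x) - (\<Theta> x * Z t x - \<Theta> x * \<zeta> x) \<le> F (Z t x)"
          using eq AE_space
        proof eventually_elim
          case (elim x)
          then show ?case
            using F(2)[of "\<Theta> x" "\<zeta> x" "Z t x"] B(2)[of x] by (simp add: \<Theta>_def right_diff_distrib)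
        qed
      qed (intro Bochner_Integration.integrable_diff intF\<zeta> intFZ int c\<Theta>)+
      then show ?thesis using intF\<zeta> int[OF c\<Theta>] by simp
    qed
    have 2: "(\<integral>x. F (Z 0 x) \<partial>\<sigma>) - (\<integral>x. F (\<zeta> x) \<partial>\<sigma>) \<le> B * I"
    proof -
      have "(\<integral>x. F (Z 0 x) - F (\<zeta> x) \<partial>\<sigma>) \<le> (\<integral>x. B * \<bar>Z 0 x - \<zeta> x\<bar> \<partial>\<sigma>)"
        by (intro integral_mono Bochner_Integration.integrable_diff intF\<zeta> intFZ integrable_mult_right intw
            order_trans[OF abs_ge_self F(1)])
      then show ?thesis using intF\<zeta> intFZ by (simp add: I_def)
    qed
    have 3: "(\<integral>x. \<Theta> x * Z 0 x \<partial>\<sigma>) - (\<integral>x. \<Theta> x * \<zeta> x \<partial>\<sigma>) \<le> B * I"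
    proof -
      have "(\<integral>x. \<Theta> x * Z 0 x - \<Theta> x * \<zeta> x \<partial>\<sigma>) \<le> (\<integral>x. B * \<bar>Z 0 x - \<zeta> x\<bar> \<partial>\<sigma>)"
      proof (rule integral_mono)
        fix x assume "x \<in> space \<sigma>"
        then have "\<bar>\<Theta> x\<bar> * \<bar>Z 0 x - \<zeta> x\<bar> \<le> B * \<bar>Z 0 x - \<zeta> x\<bar>" using B(2) by (intro mult_right_mono) auto
        then show "\<Theta> x * Z 0 x - \<Theta> x * \<zeta> x \<le> B * \<bar>Z 0 x - \<zeta> x\<bar>"
          unfolding right_diff_distrib[symmetric] by (metis abs_ge_self abs_mult order_trans)
      qed (intro Bochner_Integration.integrable_diff int c\<Theta> integrable_mult_right intw)+
      then show ?thesis using int[OF c\<Theta>] by (simp add: I_def)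
    qed
    have "E t \<le> K * suminf (green_const p) / area * I + 4 * (B * I)"
    proof -
      \<comment> \<open>The pairing with \<zeta> is inserted in between. From time 0 to \<zeta> the
        boundedness of \<Theta> is used; from \<zeta> to time \<open>t\<close> the minimality, which
        gives the increment of the integral of \<open>F\<close>, computed at time 0 since it is a
        Casimir.\<close>
      have "(\<integral>x. \<Theta> x * Z 0 x \<partial>\<sigma>) - (\<integral>x. \<Theta> x * Z t x \<partial>\<sigma>) \<le> B * I + B * I"
      proof -
        have "a - b \<le> c + c" if "fz - (b - z) \<le> ft" "f0 - fz \<le> c" "a - z \<le> c" "ft = f0"
          for a b c z f0 ft fz :: real
          using that by linarith
        from this[OF 1 2 3 casimir_conserved[OF cF]] show ?thesis .
      qed
      then show ?thesis using E0 unfolding Et by simp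
    qed
    also have "\<dots> \<le> K * suminf (green_const p) / area * (K * d) + 4 * (B * (K * d))"
      using I K G0 B area_pos by (intro add_mono mult_left_mono) auto
    also have "\<dots> = C * d" by (simp add: C_def algebra_simps)
    finally show ?thesis by (simp add: E_def)
  qed
  then show ?thesis by (intro exI[of _ C] allI impI)
qed

text \<open>The energy estimate is quantitative, but the passage from moments to the norm is by
  limits; hence an argument by contradiction along a sequence of solutions \<open>Z k\<close> and
  times \<open>t k\<close>, with initial distances below \<open>1 / Suc k\<close>.\<close>

theorem theorem2p1:
  fixes p \<beta> :: real and \<zeta> G\<zeta> :: "real^3 \<Rightarrow> real" and g :: "real \<Rightarrow> ereal" and P :: "real^3"
  assumes "1 < p"
    and "in_Lp0 p \<zeta>"
    and "is_G p \<zeta> G\<zeta>"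
    and "antimono g"
    and "norm P = 1"
    and "AE x in \<sigma>. ereal (\<zeta> x) = g (G\<zeta> x + \<beta> * (P \<bullet> x))"
  shows "Lp_stable p \<zeta>"
  unfolding Lp_stable_def
proof (intro allI impI, rule ccontr)
  fix \<epsilon> :: real assume \<epsilon>: "0 < \<epsilon>"
  assume unstable: "\<not> (\<exists>\<delta>>0. \<forall>Z. smooth_euler_solution Z \<longrightarrow>
      Lp_norm p (\<lambda>x. Z 0 x - \<zeta> x) < \<delta> \<longrightarrow> (\<forall>t. Lp_norm p (\<lambda>x. Z t x - \<zeta> x) < \<epsilon>))"
  have "\<exists>Z t. smooth_euler_solution Z \<and>
      Lp_norm p (\<lambda>x. Z 0 x - \<zeta> x) < 1 / real (Suc k) \<and> \<epsilon> \<le> Lp_norm p (\<lambda>x. Z t x - \<zeta> x)" for k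
  proof (rule ccontr)
    assume *: "\<nexists>Z t. smooth_euler_solution Z \<and>
      Lp_norm p (\<lambda>x. Z 0 x - \<zeta> x) < 1 / real (Suc k) \<and> \<epsilon> \<le> Lp_norm p (\<lambda>x. Z t x - \<zeta> x)"
    have "Lp_norm p (\<lambda>x. Z t x - \<zeta> x) < \<epsilon>"
      if "smooth_euler_solution Z" "Lp_norm p (\<lambda>x. Z 0 x - \<zeta> x) < 1 / real (Suc k)" for Z t
    proof (rule ccontr)
      assume "\<not> Lp_norm p (\<lambda>x. Z t x - \<zeta> x) < \<epsilon>"
      then have "\<epsilon> \<le> Lp_norm p (\<lambda>x. Z t x - \<zeta> x)" by simp
      with that have "\<exists>Z t. smooth_euler_solution Z \<and>
        Lp_norm p (\<lambda>x. Z 0 x - \<zeta> x) < 1 / real (Suc k) \<and> \<epsilon> \<le> Lp_norm p (\<lambda>x. Z t x - \<zeta> x)"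
        by (intro exI conjI)
      with * show False by (rule notE)
    qed
    then have "\<exists>\<delta>>0. \<forall>Z. smooth_euler_solution Z \<longrightarrow>
      Lp_norm p (\<lambda>x. Z 0 x - \<zeta> x) < \<delta> \<longrightarrow> (\<forall>t. Lp_norm p (\<lambda>x. Z t x - \<zeta> x) < \<epsilon>)"
      by (intro exI[of _ "1 / real (Suc k)"] conjI allI impI) simp_all
    with unstable show False by (rule notE)
  qed
  then obtain Z t where Z: "\<And>k. smooth_euler_solution (Z k)"
    and near: "\<And>k. Lp_norm p (\<lambda>x. Z k 0 x - \<zeta> x) < 1 / real (Suc k)"
    and far: "\<And>k. \<epsilon> \<le> Lp_norm p (\<lambda>x. Z k (t k) x - \<zeta> x)"
    by metis
  have \<zeta>: "in_Lp p \<zeta>" "(\<integral>x. \<zeta> x \<partial>\<sigma>) = 0" using assms by (auto simp: in_Lp0_def)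
  have int\<zeta>: "integrable \<sigma> \<zeta>" by (rule in_Lp_integrable[OF \<zeta>(1) assms(1)])
  have pot: "green_potential \<zeta> G\<zeta>" by (rule is_G_green_potential[OF assms(3,1)])
  have near': "(\<integral>x. \<bar>Z k 0 x - \<zeta> x\<bar> powr p \<partial>\<sigma>) \<le> (1 / real (Suc k)) powr p" for k
    by (rule Lp_norm_less_powr[OF _ near]) (use assms in simp)
  have "\<forall>k. \<exists>\<psi> Zt Zx w. smooth_flow (Z k) \<psi> Zt Zx w" using smooth_euler_solution_flow[OF Z] by metis
  then obtain \<psi> Zt Zx w where flow: "\<And>k. smooth_flow (Z k) (\<psi> k) (Zt k) (Zx k) (w k)" by metis
  obtain C where "\<forall>Z \<psi> Zt Zx w t d. smooth_flow Z \<psi> Zt Zx w \<longrightarrow> 0 < d \<longrightarrow> d \<le> 1 \<longrightarrow>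
      (\<integral>x. \<bar>Z 0 x - \<zeta> x\<bar> powr p \<partial>\<sigma>) \<le> d powr p \<longrightarrow>
      (\<integral>x. (\<psi> t x - G\<zeta> x) * (Z t x - \<zeta> x) \<partial>\<sigma>) \<le> C * d"
    using energy_difference_bound[OF assms(1) \<zeta>(1) pot assms(4,6)] by (rule exE)
  note C = this[rule_format]
  define v where "v k = Z k (t k)" for k
  have cZ: "continuous_on S2 (Z k s)" for k s by (rule smooth_flow.Z_cont_slice[OF flow])
  have intw: "integrable \<sigma> (\<lambda>x. v k x - \<zeta> x)" for k
    unfolding v_def by (intro Bochner_Integration.integrable_diff integrable_\<sigma>_continuous cZ int\<zeta>)
  have inv_lim: "(\<lambda>k. 1 / real (Suc k)) \<longlonglongrightarrow> 0" by real_asymp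
  have moments: "(\<lambda>k. \<integral>x. (v k x - \<zeta> x) * zmom n (\<lambda>x. v k x - \<zeta> x) x \<partial>\<sigma>) \<longlonglongrightarrow> 0" for n
  proof (cases n)
    \<comment> \<open>The energy series begins at degree 1, so degree 0 is settled by the zero means
      of the solutions and of \<zeta>.\<close>
    case 0
    have "(\<integral>x. v k x - \<zeta> x \<partial>\<sigma>) = 0" for k
      using Z[of k] \<zeta>(2) int\<zeta> integrable_\<sigma>_continuous[OF cZ]
      by (simp add: v_def smooth_euler_solution_def)
    then show ?thesis using 0 by (simp add: zmom_0)
  next
    case (Suc m)
    have le: "(\<integral>x. (v k x - \<zeta> x) * zmom (Suc m) (\<lambda>x. v k x - \<zeta> x) x \<partial>\<sigma>) \<le> area * real (Suc m) * (C * (1 / real (Suc k)))" for k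
    proof -
      have "(\<integral>x. (v k x - \<zeta> x) * zmom (Suc m) (\<lambda>x. v k x - \<zeta> x) x \<partial>\<sigma>)
         \<le> area * real (Suc m) * (\<integral>x. (\<psi> k (t k) x - G\<zeta> x) * (v k x - \<zeta> x) \<partial>\<sigma>)"
        unfolding v_def
        by (rule green_potential_energy_ge[OF green_potential_diff[OF smooth_flow.pot[OF flow] pot]])
      also have "\<dots> \<le> area * real (Suc m) * (C * (1 / real (Suc k)))"
        unfolding v_def using area_pos by (intro mult_left_mono C[OF flow _ _ near']) auto
      finally show ?thesis .
    qed
    have "(\<lambda>k. area * real (Suc m) * (C * (1 / real (Suc k)))) \<longlonglongrightarrow> 0"
      by (intro tendsto_mult_right_zero inv_lim)
    then show ?thesis
      unfolding Suc
      by (rule tendsto_sandwich[OF _ _ tendsto_const, rotated 2])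
         (intro always_eventually allI; (rule le zmom_form_nonneg[OF intw]))+
  qed
  have "equimeasurable_sequence p \<zeta> (\<lambda>k. Z k 0) v"
  proof
    show "(\<lambda>k. \<integral>x. \<bar>Z k 0 x - \<zeta> x\<bar> powr p \<partial>\<sigma>) \<longlonglongrightarrow> 0"
    proof (rule tendsto_sandwich[OF _ _ tendsto_const])
      show "(\<lambda>k. (1 / real (Suc k)) powr p) \<longlonglongrightarrow> 0"
        using assms(1) by real_asymp
    qed (use near' in auto)
    show "continuous_on UNIV f \<Longrightarrow> (\<integral>x. f (v k x) \<partial>\<sigma>) = (\<integral>x. f (Z k 0 x) \<partial>\<sigma>)" for k and f :: "real \<Rightarrow> real"
      unfolding v_def by (rule smooth_flow.casimir_conserved[OF flow])
    show "(\<lambda>k. \<integral>x. q x * (v k x - \<zeta> x) \<partial>\<sigma>) \<longlonglongrightarrow> 0" if "real_polynomial_function q" for q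
      by (rule polynomial_moments_tendsto_0[OF intw moments that])
  qed (use assms \<zeta> cZ in \<open>auto simp: v_def\<close>)
  then have "(\<lambda>k. \<integral>x. \<bar>v k x - \<zeta> x\<bar> powr p \<partial>\<sigma>) \<longlonglongrightarrow> 0"
    by (rule equimeasurable_sequence.Lp_convergence)
  then have "\<forall>\<^sub>F k in sequentially. (\<integral>x. \<bar>v k x - \<zeta> x\<bar> powr p \<partial>\<sigma>) < \<epsilon> powr p"
    by (rule order_tendstoD) (use \<epsilon> in simp)
  then obtain k where "(\<integral>x. \<bar>v k x - \<zeta> x\<bar> powr p \<partial>\<sigma>) < \<epsilon> powr p"
    using eventually_happens by force
  moreover have "\<epsilon> powr p \<le> (\<integral>x. \<bar>v k x - \<zeta> x\<bar> powr p \<partial>\<sigma>)"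
    using powr_mono2[OF _ _ far[of k], of p] \<epsilon> assms(1) by (simp add: Lp_norm_powr v_def)
  ultimately show False by simp
qed

end
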